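(* Let $\mathfrak h$ be the Lie algebra of vector fields on $M=\mathbb R^3(t,x,y)$ preserving the shape $$g=4\,dt\,dx+2u\,dt\,dy-(u^2+4v)\,dt^2-dy^2,\qquad \omega=(u u_x+2u_y+4v_x)\,dt-u_x\,dy$$ of pairs $(g,\omega)$, and let $\hat{\mathfrak h}$ be its lift to the total space $E=M\times\mathbb R^2(u,v)$. Then $\hat{\mathfrak h}$ is exactly the Lie algebra $\mathfrak g$ of infinitesimal point symmetries of the modified Manakov–Santini system $$F_1=(u_t+u u_y+v u_x)_x-(u_y)_y=0,\qquad F_2=(v_t+v v_x-u v_y)_x-(v_y-2u v_x)_y=0 .$$
   Context: Shape-preserving vector fields: $\mathfrak h$ consists of the vector fields $X$ on $M$ whose flow $\varphi_\tau$ sends each pair $(g,\omega)$ of the shape $$g=4\,dt\,dx+2u\,dt\,dy-(u^2+4v)\,dt^2-dy^2,\qquad \omega=(u u_x+2u_y+4v_x)\,dt-u_x\,dy,$$ with $u,v$ functions of $(t,x,y)$, to a pair of the same shape up to conformal rescaling, i.e. $\varphi_\tau^*g=f^\tau g^\tau$, $\varphi_\tau^*\omega=\omega^\tau+d\log f^\tau$ with $(g^\tau,\omega^\tau)$ given by the same formulas with functions $u^\tau,v^\tau$ in place of $u,v$, and with $f^0=1,u^0=u,v^0=v$. Explicitly, $\mathfrak h$ consists of the vector fields $$d\,\partial_t+(a+yc+2xe+y^2\dot e)\,\partial_x+(b+\tfrac12 y\dot d+ye)\,\partial_y$$ with $a,b,c,d,e$ arbitrary smooth functions of $t$ (dot $=d/dt$).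 Lift: let $\pi\colon E=M\times\mathbb R^2(u,v)\to M$, and let $\hat g=4\,dt\,dx+2u\,dt\,dy-(u^2+4v)\,dt^2-dy^2$ be the horizontal symmetric two-form on $E$, where now $u,v$ are the fiber coordinates. For $X\in\mathfrak h$ the lift is the vector field $\hat X=X+A\,\partial_u+B\,\partial_v$ on $E$ whose coefficients $A,B$ are uniquely determined by the condition $L_{\hat X}\hat g=\chi\,\hat g$ for some function $\chi$; $\hat{\mathfrak h}=\{\hat X:X\in\mathfrak h\}$. Point symmetries: a vector field $Y$ on $E$ is an infinitesimal point symmetry of the system if its prolongation $Y^{(2)}$ to $J^2\pi$ is tangent to $\mathcal E_2=\{F_1=F_2=0\}\subset J^2\pi$. Vector fields are understood locally. *)

theory Defs
  imports "HOL-Analysis.Analysis"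
begin

section \<open>Smooth maps\<close>

text \<open>Meant for open sets: derivatives are taken in the full space.\<close>

fun Ck_on :: "nat \<Rightarrow> 'a::real_normed_vector set \<Rightarrow> ('a \<Rightarrow> 'b::real_normed_vector) \<Rightarrow> bool" where
  "Ck_on 0 S f \<longleftrightarrow> continuous_on S f"
| "Ck_on (Suc k) S f \<longleftrightarrow>
     (\<forall>x\<in>S. f differentiable (at x)) \<and>
     (\<forall>v. Ck_on k S (\<lambda>x. frechet_derivative f (at x) v))"

definition smooth_on :: "'a::real_normed_vector set \<Rightarrow> ('a \<Rightarrow> 'b::real_normed_vector) \<Rightarrow> bool" where
  "smooth_on S f \<longleftrightarrow> (\<forall>k. Ck_on k S f)"

section \<open>Tensor calculus on a vector space\<close>

text \<open>A covariant 2-tensor field on \<open>'a\<close> is a function \<open>T\<close>, where \<open>T z v w\<close> is the value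
  at the point \<open>z\<close> on the tangent vectors \<open>v\<close>, \<open>w\<close>; a 1-form is a function of \<open>z\<close> and \<open>v\<close>.\<close>

definition sym_prod :: "('a \<Rightarrow> real) \<Rightarrow> ('a \<Rightarrow> real) \<Rightarrow> 'a \<Rightarrow> 'a \<Rightarrow> real" where
  "sym_prod \<alpha> \<beta> v w = (\<alpha> v * \<beta> w + \<alpha> w * \<beta> v) / 2"

definition pullback1 ::
  "('a::real_normed_vector \<Rightarrow> 'a) \<Rightarrow> ('a \<Rightarrow> 'a \<Rightarrow> real) \<Rightarrow> 'a \<Rightarrow> 'a \<Rightarrow> real" where
  "pullback1 \<phi> \<omega> z v = \<omega> (\<phi> z) (frechet_derivative \<phi> (at z) v)"

definition pullback2 ::
  "('a::real_normed_vector \<Rightarrow> 'a) \<Rightarrow> ('a \<Rightarrow> 'a \<Rightarrow> 'a \<Rightarrow> real) \<Rightarrow> 'a \<Rightarrow> 'a \<Rightarrow> 'a \<Rightarrow> real" where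
  "pullback2 \<phi> T z v w =
     T (\<phi> z) (frechet_derivative \<phi> (at z) v) (frechet_derivative \<phi> (at z) w)"

definition lie_deriv ::
  "('a::real_normed_vector \<Rightarrow> 'a) \<Rightarrow> ('a \<Rightarrow> 'a \<Rightarrow> 'a \<Rightarrow> real) \<Rightarrow> 'a \<Rightarrow> 'a \<Rightarrow> 'a \<Rightarrow> real" where
  "lie_deriv Y T z v w =
     frechet_derivative (\<lambda>z'. T z' v w) (at z) (Y z)
     + T z (frechet_derivative Y (at z) v) w
     + T z v (frechet_derivative Y (at z) w)"

definition local_flow ::
  "('a::real_normed_vector \<Rightarrow> 'a) \<Rightarrow> 'a set \<Rightarrow> 'a set \<Rightarrow> real \<Rightarrow> (real \<Rightarrow> 'a \<Rightarrow> 'a) \<Rightarrow> bool" where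
  "local_flow X U N \<epsilon> \<phi> \<longleftrightarrow>
     smooth_on ({-\<epsilon><..<\<epsilon>} \<times> N) (\<lambda>(\<tau>, q). \<phi> \<tau> q) \<and>
     (\<forall>q\<in>N. \<phi> 0 q = q) \<and>
     (\<forall>\<tau>\<in>{-\<epsilon><..<\<epsilon>}. \<forall>q\<in>N. \<phi> \<tau> q \<in> U \<and>
        ((\<lambda>\<sigma>. \<phi> \<sigma> q) has_vector_derivative X (\<phi> \<tau> q)) (at \<tau>))"

text \<open>Tangent vectors to a subset are the velocities of smooth curves lying in it.\<close>

definition tangent_to :: "'a::real_normed_vector set \<Rightarrow> 'a \<Rightarrow> 'a \<Rightarrow> bool" where
  "tangent_to S z w \<longleftrightarrow>
     (\<exists>\<epsilon>>0. \<exists>\<gamma>::real \<Rightarrow> 'a. smooth_on {-\<epsilon><..<\<epsilon>} \<gamma> \<and> \<gamma> ` {-\<epsilon><..<\<epsilon>} \<subseteq> S \<and>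
        \<gamma> 0 = z \<and> (\<gamma> has_vector_derivative w) (at 0))"

section \<open>Shape-preserving vector fields\<close>

text \<open>A point of \<open>base\<close> has the coordinates \<open>t = p$1\<close>, \<open>x = p$2\<close>, \<open>y = p$3\<close>.\<close>

type_synonym base = "real ^ 3"

abbreviation dt :: "base \<Rightarrow> real" where "dt w \<equiv> w $ 1"
abbreviation dx :: "base \<Rightarrow> real" where "dx w \<equiv> w $ 2"
abbreviation dy :: "base \<Rightarrow> real" where "dy w \<equiv> w $ 3"

definition partial :: "3 \<Rightarrow> (base \<Rightarrow> real) \<Rightarrow> base \<Rightarrow> real" where
  "partial i f p = frechet_derivative f (at p) (axis i 1)"

definition g_form :: "real \<Rightarrow> real \<Rightarrow> base \<Rightarrow> base \<Rightarrow> real" where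
  "g_form u v a b =
     4 * sym_prod dt dx a b + 2 * u * sym_prod dt dy a b
     - (u\<^sup>2 + 4 * v) * sym_prod dt dt a b - sym_prod dy dy a b"

definition metric :: "(base \<Rightarrow> real) \<Rightarrow> (base \<Rightarrow> real) \<Rightarrow> base \<Rightarrow> base \<Rightarrow> base \<Rightarrow> real" where
  "metric u v p = g_form (u p) (v p)"

definition weyl_form :: "(base \<Rightarrow> real) \<Rightarrow> (base \<Rightarrow> real) \<Rightarrow> base \<Rightarrow> base \<Rightarrow> real" where
  "weyl_form u v p w =
     (u p * partial 2 u p + 2 * partial 3 u p + 4 * partial 2 v p) * dt w
     - partial 2 u p * dy w"

definition flow_preserves_shape ::
  "base set \<Rightarrow> base set \<Rightarrow> real \<Rightarrow> (real \<Rightarrow> base \<Rightarrow> base) \<Rightarrow> bool" where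
  "flow_preserves_shape U N \<epsilon> \<phi> \<longleftrightarrow>
     (\<forall>u v. smooth_on U u \<longrightarrow> smooth_on U v \<longrightarrow>
       (\<exists>f u' v' :: real \<Rightarrow> base \<Rightarrow> real.
          smooth_on ({-\<epsilon><..<\<epsilon>} \<times> N) (\<lambda>(\<tau>, q). f \<tau> q) \<and>
          smooth_on ({-\<epsilon><..<\<epsilon>} \<times> N) (\<lambda>(\<tau>, q). u' \<tau> q) \<and>
          smooth_on ({-\<epsilon><..<\<epsilon>} \<times> N) (\<lambda>(\<tau>, q). v' \<tau> q) \<and>
          (\<forall>q\<in>N. f 0 q = 1 \<and> u' 0 q = u q \<and> v' 0 q = v q) \<and>
          (\<forall>\<tau>\<in>{-\<epsilon><..<\<epsilon>}. \<forall>q\<in>N. f \<tau> q > 0 \<and>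
             (\<forall>a b. pullback2 (\<phi> \<tau>) (metric u v) q a b
                    = f \<tau> q * metric (u' \<tau>) (v' \<tau>) q a b) \<and>
             (\<forall>a. pullback1 (\<phi> \<tau>) (weyl_form u v) q a
                  = weyl_form (u' \<tau>) (v' \<tau>) q a
                    + frechet_derivative (\<lambda>q'. ln (f \<tau> q')) (at q) a))))"

text \<open>The local flow of a smooth vector field exists near every point and is unique, so that
  the existential quantifier over \<open>\<phi>\<close> refers to the flow of \<open>X\<close>.\<close>

definition shape_fields :: "base set \<Rightarrow> (base \<Rightarrow> base) set" where
  "shape_fields U =
     {X. smooth_on U X \<and>
         (\<forall>p\<in>U. \<exists>N \<epsilon> \<phi>. open N \<and> p \<in> N \<and> N \<subseteq> U \<and> \<epsilon> > 0 \<and>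
            local_flow X U N \<epsilon> \<phi> \<and> flow_preserves_shape U N \<epsilon> \<phi>)}"

section \<open>The lift to the total space\<close>

text \<open>The fibre coordinates of \<open>z :: total\<close> are \<open>u = snd z $ 1\<close> and \<open>v = snd z $ 2\<close>.\<close>

type_synonym total = "base \<times> (real ^ 2)"

definition g_hat :: "total \<Rightarrow> total \<Rightarrow> total \<Rightarrow> real" where
  "g_hat z a b = g_form (snd z $ 1) (snd z $ 2) (fst a) (fst b)"

definition is_lift :: "total set \<Rightarrow> (base \<Rightarrow> base) \<Rightarrow> (total \<Rightarrow> total) \<Rightarrow> bool" where
  "is_lift W X Y \<longleftrightarrow>
     smooth_on W Y \<and> (\<forall>z\<in>W. fst (Y z) = X (fst z)) \<and>
     (\<exists>c::total \<Rightarrow> real. \<forall>z\<in>W. \<forall>a b. lie_deriv Y g_hat z a b = c z * g_hat z a b)"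

text \<open>Vector fields on \<open>W\<close> are total functions whose values outside \<open>W\<close> are irrelevant;
  this also applies to \<open>point_symmetries\<close> below.\<close>

definition lifted_shape_fields :: "total set \<Rightarrow> (total \<Rightarrow> total) set" where
  "lifted_shape_fields W = {Y. \<exists>X \<in> shape_fields (fst ` W). is_lift W X Y}"

section \<open>Jets and prolongation\<close>

text \<open>In \<open>((z, q), r) :: jet2\<close>, the entry \<open>q $ a $ i\<close> is the first derivative of the \<open>a\<close>-th dependent
  variable in direction \<open>i\<close>, and \<open>r $ a $ i $ j\<close> the second one; \<open>J\<^sup>2\<pi>\<close> is the subspace of symmetric \<open>r\<close>.\<close>

type_synonym jet1 = "total \<times> (real ^ 3 ^ 2)"
type_synonym jet2 = "jet1 \<times> (real ^ 3 ^ 3 ^ 2)"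

definition J2 :: "jet2 set" where
  "J2 = {(j, r). \<forall>a i k. r $ a $ i $ k = r $ a $ k $ i}"

text \<open>Total derivatives of functions on \<open>E\<close> and on \<open>J\<^sup>1\<pi>\<close>: the derivative along the lift
  of \<open>\<partial>\<^sub>i\<close> that a jet of the next order determines.\<close>

definition total_deriv1 :: "3 \<Rightarrow> (total \<Rightarrow> real) \<Rightarrow> jet1 \<Rightarrow> real" where
  "total_deriv1 i f = (\<lambda>(z, q). frechet_derivative f (at z) (axis i 1, \<chi> a. q $ a $ i))"

definition total_deriv2 :: "3 \<Rightarrow> (jet1 \<Rightarrow> real) \<Rightarrow> jet2 \<Rightarrow> real" where
  "total_deriv2 i f =
     (\<lambda>((z, q), r). frechet_derivative f (at (z, q))
        ((axis i 1, \<chi> a. q $ a $ i), \<chi> a k. r $ a $ k $ i))"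

text \<open>The standard recursive prolongation formula, for \<open>Y = \<xi>\<^sup>k \<partial>\<^sub>k + \<eta>\<^sup>a \<partial>\<^sub>a\<close>:
  \<open>\<eta>\<^sup>a\<^sub>i = D\<^sub>i \<eta>\<^sup>a - (D\<^sub>i \<xi>\<^sup>k) u\<^sup>a\<^sub>k\<close> and
  \<open>\<eta>\<^sup>a\<^sub>i\<^sub>j = D\<^sub>j \<eta>\<^sup>a\<^sub>i - (D\<^sub>j \<xi>\<^sup>k) u\<^sup>a\<^sub>i\<^sub>k\<close>.\<close>

definition prolong_coeff1 :: "(total \<Rightarrow> total) \<Rightarrow> 2 \<Rightarrow> 3 \<Rightarrow> jet1 \<Rightarrow> real" where
  "prolong_coeff1 Y a i = (\<lambda>(z, q).
     total_deriv1 i (\<lambda>z. snd (Y z) $ a) (z, q)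
     - (\<Sum>k\<in>UNIV. total_deriv1 i (\<lambda>z. fst (Y z) $ k) (z, q) * q $ a $ k))"

definition prolong_coeff2 :: "(total \<Rightarrow> total) \<Rightarrow> 2 \<Rightarrow> 3 \<Rightarrow> 3 \<Rightarrow> jet2 \<Rightarrow> real" where
  "prolong_coeff2 Y a i j = (\<lambda>((z, q), r).
     total_deriv2 j (prolong_coeff1 Y a i) ((z, q), r)
     - (\<Sum>k\<in>UNIV. total_deriv1 j (\<lambda>z. fst (Y z) $ k) (z, q) * r $ a $ i $ k))"

definition prolong2 :: "(total \<Rightarrow> total) \<Rightarrow> jet2 \<Rightarrow> jet2" where
  "prolong2 Y = (\<lambda>((z, q), r).
     ((Y z, \<chi> a i. prolong_coeff1 Y a i (z, q)),
      \<chi> a i j. prolong_coeff2 Y a i j ((z, q), r)))"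

section \<open>The modified Manakov--Santini system\<close>

abbreviation jet_u :: "jet1 \<Rightarrow> real" where "jet_u j \<equiv> snd (fst j) $ 1"
abbreviation jet_v :: "jet1 \<Rightarrow> real" where "jet_v j \<equiv> snd (fst j) $ 2"
abbreviation jet_ud :: "3 \<Rightarrow> jet1 \<Rightarrow> real" where "jet_ud i j \<equiv> snd j $ 1 $ i"
abbreviation jet_vd :: "3 \<Rightarrow> jet1 \<Rightarrow> real" where "jet_vd i j \<equiv> snd j $ 2 $ i"

definition F1 :: "jet2 \<Rightarrow> real" where
  "F1 j = total_deriv2 2 (\<lambda>j. jet_ud 1 j + jet_u j * jet_ud 3 j + jet_v j * jet_ud 2 j) j
        - total_deriv2 3 (\<lambda>j. jet_ud 3 j) j"

definition F2 :: "jet2 \<Rightarrow> real" where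
  "F2 j = total_deriv2 2 (\<lambda>j. jet_vd 1 j + jet_v j * jet_vd 2 j - jet_u j * jet_vd 3 j) j
        - total_deriv2 3 (\<lambda>j. jet_vd 3 j - 2 * jet_u j * jet_vd 2 j) j"

definition E2 :: "jet2 set" where
  "E2 = {j \<in> J2. F1 j = 0 \<and> F2 j = 0}"

definition point_symmetries :: "total set \<Rightarrow> (total \<Rightarrow> total) set" where
  "point_symmetries W =
     {Y. smooth_on W Y \<and>
         (\<forall>j\<in>E2. fst (fst j) \<in> W \<longrightarrow> tangent_to E2 j (prolong2 Y j))}"

end

theory Submission
  imports Defs
begin

text \<open>Write \<open>X = T \<partial>\<^sub>t + \<xi> \<partial>\<^sub>x + \<eta> \<partial>\<^sub>y\<close>. Both sides of the theorem are compared with one system of linear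
  equations for \<open>X\<close>, called \<open>shape_system\<close> below:
  \<open>T\<^sub>x = T\<^sub>y = \<eta>\<^sub>x = \<eta>\<^sub>y\<^sub>y = 0\<close>, \<open>\<xi>\<^sub>x = 2 \<eta>\<^sub>y - T\<^sub>t\<close> and \<open>\<xi>\<^sub>y\<^sub>y = \<xi>\<^sub>t\<^sub>x\<close>. Its local solutions are the fields with
  five free functions of \<open>t\<close>.

  If the flow of \<open>X\<close> preserves the shape, it suffices to test this on constant \<open>u\<close> and \<open>v\<close> and to
  differentiate at time zero: the metric gives the first-order equations and the one-form the other two
  (\<open>shape_fields_imp_shape_system\<close>). Conversely the explicit solutions form a triangular system of ordinary
  differential equations: a nonlinear equation in \<open>t\<close> alone, followed by linear ones in \<open>y\<close> and \<open>x\<close>. The first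
  is solved by a Picard iteration (\<open>scalar_flow\<close>), the others by quadratures. The resulting maps satisfy the
  finite analogue of the equations, \<open>T\<^sub>t \<Xi>\<^sub>x = H\<^sub>y\<^sup>2\<close> and \<open>\<Xi>\<^sub>y\<^sub>y = \<Xi>\<^sub>t\<^sub>x\<close>, which makes the pullbacks computable
  (\<open>pseudogroup_pullback\<close>, \<open>shape_system_imp_shape_fields\<close>).

  On the jet side both equations of the system have the same symbol \<open>G = p\<^sub>t p\<^sub>x + u p\<^sub>x p\<^sub>y + v p\<^sub>x\<^sup>2 - p\<^sub>y\<^sup>2\<close>,
  and \<open>G\<close> is inverse to the metric up to a factor. Comparing the second-order terms of the symmetry condition, a
  point symmetry must preserve \<open>G\<close> up to a factor. As \<open>G\<close> has rank three, this makes it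
  projectable (\<open>projectable\<close>), and connected fibres turn it into a lift of a field on the base. Conformality of
  \<open>G\<close> is then the condition that defines the lift, so that the lift appears with its first-order
  equations; the terms linear in \<open>u\<^sub>x\<close> give the two second-order equations (\<open>shape_system_base\<close>).
  In the other direction, the prolongation of a lift maps \<open>F1\<close> and \<open>F2\<close> to combinations of themselves
  (\<open>lift_is_point_symmetry\<close>).\<close>

section \<open>Calculus of smooth maps\<close>

subsection \<open>Closure properties of the classes of differentiability\<close>

abbreviation dderiv :: "('a::real_normed_vector \<Rightarrow> 'b::real_normed_vector) \<Rightarrow> 'a \<Rightarrow> 'a \<Rightarrow> 'b"
  where "dderiv f x \<equiv> frechet_derivative f (at x)"

named_theorems Ck_intros

lemma dderivI: "(f has_derivative f') (at x) \<Longrightarrow> dderiv f x = f'"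
  using frechet_derivative_at by metis

lemma dderiv_cong:
  assumes "open S" "x \<in> S" "\<And>y. y \<in> S \<Longrightarrow> f y = g y"
  shows "dderiv f x = dderiv g x"
proof -
  have "(f has_derivative D) (at x) = (g has_derivative D) (at x)" for D
    using has_derivative_transform_within_open[OF _ assms(1,2)] assms(3) by metis
  then show ?thesis by (simp add: frechet_derivative_def)
qed

lemma differentiable_cong:
  assumes "open S" "x \<in> S" "\<And>y. y \<in> S \<Longrightarrow> f y = g y" "g differentiable (at x)"
  shows "f differentiable (at x)"
proof -
  obtain D where "(g has_derivative D) (at x)" using assms(4) by (auto simp: differentiable_def)
  then have "(f has_derivative D) (at x)"
    using has_derivative_transform_within_open[OF _ assms(1,2)] assms(3) by metis
  then show ?thesis by (auto simp: differentiable_def)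
qed

lemma Ck_on_cong:
  assumes "Ck_on k S g" "open S" "\<And>x. x \<in> S \<Longrightarrow> f x = g x"
  shows "Ck_on k S f"
  using assms(1,3)
proof (induction k arbitrary: f g)
  case 0
  then show ?case by (simp cong: continuous_on_cong)
next
  case (Suc k)
  have "f differentiable (at x)" if "x \<in> S" for x
    using differentiable_cong[OF \<open>open S\<close> that Suc.prems(2)] Suc.prems(1) that by simp
  moreover have "Ck_on k S (\<lambda>x. dderiv f x v)" for v
    using Suc.IH[of "\<lambda>x. dderiv g x v" "\<lambda>x. dderiv f x v"] Suc.prems
      dderiv_cong[OF \<open>open S\<close> _ Suc.prems(2)] by simp
  ultimately show ?case by simp
qed

lemma Ck_on_SucI:
  assumes "\<And>x. x \<in> S \<Longrightarrow> (f has_derivative f' x) (at x)"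
    and "\<And>v. Ck_on k S (\<lambda>x. f' x v)" "open S"
  shows "Ck_on (Suc k) S f"
proof -
  have "f differentiable (at x)" if "x \<in> S" for x
    using assms(1)[OF that] differentiable_def by blast
  moreover have "Ck_on k S (\<lambda>x. dderiv f x v)" for v
    by (rule Ck_on_cong[OF assms(2)[of v] assms(3)]) (simp add: dderivI[OF assms(1)])
  ultimately show ?thesis by simp
qed

lemma Ck_on_SucD: "Ck_on (Suc k) S f \<Longrightarrow> Ck_on k S f"
proof (induction k arbitrary: f)
  case 0
  then show ?case
    by (auto intro!: continuous_at_imp_continuous_on differentiable_imp_continuous_within)
next
  case (Suc k)
  then show ?case by simp
qed

lemma Ck_on_le: "Ck_on k S f \<Longrightarrow> m \<le> k \<Longrightarrow> Ck_on m S f"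
proof (induction k)
  case (Suc k)
  then show ?case using Ck_on_SucD by (cases "m = Suc k") (auto simp del: Ck_on.simps(2))
qed simp

lemma Ck_on_has_derivative:
  "Ck_on (Suc k) S f \<Longrightarrow> x \<in> S \<Longrightarrow> (f has_derivative dderiv f x) (at x)"
  by (simp add: frechet_derivative_works)

lemma Ck_on_subset: "Ck_on k T f \<Longrightarrow> S \<subseteq> T \<Longrightarrow> Ck_on k S f"
  by (induction k arbitrary: f) (auto intro: continuous_on_subset)

lemma Ck_on_const [Ck_intros]: "Ck_on k S (\<lambda>x. c)"
  by (induction k arbitrary: c) (auto simp: dderivI[OF has_derivative_const])

lemma Ck_on_linear:
  assumes "bounded_linear L" "Ck_on k S f" "open S"
  shows "Ck_on k S (\<lambda>x. L (f x))"
  using assms(2)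
proof (induction k arbitrary: f)
  case 0
  then show ?case using assms(1) by (simp add: bounded_linear.continuous_on)
next
  case (Suc k)
  show ?case
    by (rule Ck_on_SucI[where f' = "\<lambda>x v. L (dderiv f x v)"])
      (use Suc assms in \<open>auto intro!: bounded_linear.has_derivative[OF assms(1)]
        Ck_on_has_derivative[OF Suc.prems]\<close>)
qed

lemma Ck_on_id [Ck_intros]: "Ck_on k S (\<lambda>x. x)"
proof (cases k)
  case (Suc m)
  have "dderiv (\<lambda>x::'a. x) x = (\<lambda>v. v)" for x
    by (rule dderivI) (rule has_derivative_ident)
  then show ?thesis by (simp add: Suc Ck_on_const)
qed simp

lemma Ck_on_add [Ck_intros]:
  assumes "Ck_on k S f" "Ck_on k S g" "open S"
  shows "Ck_on k S (\<lambda>x. f x + g x)"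
  using assms(1,2)
proof (induction k arbitrary: f g)
  case 0
  then show ?case by (simp add: continuous_on_add)
next
  case (Suc k)
  show ?case
    by (rule Ck_on_SucI[where f' = "\<lambda>x v. dderiv f x v + dderiv g x v"])
      (use Suc assms in \<open>auto intro!: has_derivative_add
        Ck_on_has_derivative[OF Suc.prems(1)] Ck_on_has_derivative[OF Suc.prems(2)]\<close>)
qed

lemma Ck_on_bilinear:
  assumes "bounded_bilinear b" "Ck_on k S f" "Ck_on k S g" "open S"
  shows "Ck_on k S (\<lambda>x. b (f x) (g x))"
  using assms(2,3)
proof (induction k arbitrary: f g)
  case 0
  then show ?case using assms(1) by (simp add: bounded_bilinear.continuous_on)
next
  case (Suc k)
  show ?case
  proof (rule Ck_on_SucI[where f' = "\<lambda>x v. b (f x) (dderiv g x v) + b (dderiv f x v) (g x)"])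
    show "((\<lambda>x. b (f x) (g x)) has_derivative
        (\<lambda>v. b (f x) (dderiv g x v) + b (dderiv f x v) (g x))) (at x)" if "x \<in> S" for x
      by (intro bounded_bilinear.FDERIV[OF assms(1)] Ck_on_has_derivative[OF Suc.prems(1)]
          Ck_on_has_derivative[OF Suc.prems(2)] that)
    show "Ck_on k S (\<lambda>x. b (f x) (dderiv g x v) + b (dderiv f x v) (g x))" for v
      using Suc.prems Ck_on_SucD[OF Suc.prems(1)] Ck_on_SucD[OF Suc.prems(2)]
      by (intro Ck_on_add Suc.IH assms) auto
  qed fact
qed

lemmas Ck_on_scaleR [Ck_intros] = Ck_on_bilinear[OF bounded_bilinear_scaleR]
lemmas Ck_on_mult [Ck_intros] = Ck_on_bilinear[OF bounded_bilinear_mult]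
lemmas Ck_on_minus [Ck_intros] = Ck_on_linear[OF bounded_linear_minus[OF bounded_linear_ident]]
lemmas Ck_on_inner = Ck_on_linear[OF bounded_linear_inner_left]
lemmas Ck_on_fst [Ck_intros] = Ck_on_linear[OF bounded_linear_fst]
lemmas Ck_on_snd [Ck_intros] = Ck_on_linear[OF bounded_linear_snd]
lemmas Ck_on_nth [Ck_intros] = Ck_on_linear[OF bounded_linear_vec_nth]

lemma Ck_on_diff [Ck_intros]:
  "Ck_on k S f \<Longrightarrow> Ck_on k S g \<Longrightarrow> open S \<Longrightarrow> Ck_on k S (\<lambda>x. f x - g x)"
  using Ck_on_add[of k S f "\<lambda>x. - g x"] Ck_on_minus[of k S g] by simp

lemma Ck_on_sum [Ck_intros]:
  "(\<And>i. i \<in> I \<Longrightarrow> Ck_on k S (f i)) \<Longrightarrow> open S \<Longrightarrow> Ck_on k S (\<lambda>x. \<Sum>i\<in>I. f i x)"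
  by (induction I rule: infinite_finite_induct) (auto intro!: Ck_on_const Ck_on_add)

lemma Ck_on_power [Ck_intros]:
  fixes f :: "'a::real_normed_vector \<Rightarrow> real"
  shows "Ck_on k S f \<Longrightarrow> open S \<Longrightarrow> Ck_on k S (\<lambda>x. f x ^ n)"
  by (induction n) (auto intro!: Ck_on_const Ck_on_mult)

lemma Ck_on_Pair [Ck_intros]:
  assumes "Ck_on k S f" "Ck_on k S g" "open S"
  shows "Ck_on k S (\<lambda>x. (f x, g x))"
proof -
  have "Ck_on k S (\<lambda>x. (f x, 0) + (0, g x))"
    using assms
    by (intro Ck_on_add Ck_on_linear[where L = "\<lambda>a. (a, 0)"] Ck_on_linear[where L = "\<lambda>a. (0, a)"]
        bounded_linear_Pair bounded_linear_ident bounded_linear_zero)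
  then show ?thesis by simp
qed

text \<open>Expanding the inner derivative in a basis turns the chain rule into a finite sum of
  products, so the degree of smoothness can be counted by induction.\<close>

lemma Ck_on_compose:
  fixes f :: "'b::euclidean_space \<Rightarrow> 'c::real_normed_vector"
    and g :: "'a::real_normed_vector \<Rightarrow> 'b"
  assumes "Ck_on k T f" "Ck_on k S g" "\<And>x. x \<in> S \<Longrightarrow> g x \<in> T" "open S"
  shows "Ck_on k S (\<lambda>x. f (g x))"
  using assms(1,2)
proof (induction k arbitrary: f)
  case 0
  then show ?case using assms(3) by (auto intro: continuous_on_compose2)
next
  case (Suc k)
  have fd: "(f has_derivative dderiv f (g x)) (at (g x))" if "x \<in> S" for x
    using Ck_on_has_derivative[OF Suc.prems(1)] assms(3) that by blast
  have expand: "dderiv f (g x) w = (\<Sum>b\<in>Basis. (w \<bullet> b) *\<^sub>R dderiv f (g x) b)"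
    if "x \<in> S" for x w
  proof -
    have "linear (dderiv f (g x))" using fd[OF that] by (rule has_derivative_linear)
    then have "dderiv f (g x) (\<Sum>b\<in>Basis. (w \<bullet> b) *\<^sub>R b)
        = (\<Sum>b\<in>Basis. (w \<bullet> b) *\<^sub>R dderiv f (g x) b)"
      by (simp add: linear_sum linear_scale)
    then show ?thesis by (simp add: euclidean_representation)
  qed
  show ?case
  proof (rule Ck_on_SucI[where f' = "\<lambda>x v. \<Sum>b\<in>Basis. (dderiv g x v \<bullet> b) *\<^sub>R dderiv f (g x) b"])
    show "((\<lambda>x. f (g x)) has_derivative
        (\<lambda>v. \<Sum>b\<in>Basis. (dderiv g x v \<bullet> b) *\<^sub>R dderiv f (g x) b)) (at x)" if "x \<in> S" for x
      using has_derivative_compose[OF Ck_on_has_derivative[OF Suc.prems(2) that] fd[OF that]]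
      by (rule has_derivative_eq_rhs) (intro ext expand that)
    show "Ck_on k S (\<lambda>x. \<Sum>b\<in>Basis. (dderiv g x v \<bullet> b) *\<^sub>R dderiv f (g x) b)" for v
      using Suc.prems Ck_on_SucD[OF Suc.prems(2)] assms(4)
      by (intro Ck_on_sum Ck_on_scaleR Ck_on_inner Suc.IH[of "\<lambda>y. dderiv f y _"]) auto
  qed fact
qed

lemma Ck_on_real_SucI:
  fixes f :: "real \<Rightarrow> real"
  assumes "\<And>x. x \<in> S \<Longrightarrow> (f has_real_derivative f' x) (at x)" "Ck_on k S f'" "open S"
  shows "Ck_on (Suc k) S f"
  by (rule Ck_on_SucI[where f' = "\<lambda>x v. f' x * v"])
    (use assms in \<open>auto simp: has_field_derivative_def intro!: Ck_intros\<close>)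

lemma Ck_on_real_exp: "Ck_on k UNIV (exp :: real \<Rightarrow> real)"
  by (induction k) (auto intro: Ck_on_real_SucI DERIV_exp continuous_on_exp continuous_on_id
      simp del: Ck_on.simps(2))

lemma Ck_on_real_inverse: "Ck_on k (- {0}) (inverse :: real \<Rightarrow> real)"
proof (induction k)
  case 0
  show ?case by (auto intro!: continuous_intros)
next
  case (Suc k)
  show ?case
    by (rule Ck_on_real_SucI[where f' = "\<lambda>x. - (inverse x * inverse x)"])
      (auto intro!: Ck_intros Suc derivative_eq_intros)
qed

lemma Ck_on_exp [Ck_intros]:
  fixes f :: "'a::real_normed_vector \<Rightarrow> real"
  shows "Ck_on k S f \<Longrightarrow> open S \<Longrightarrow> Ck_on k S (\<lambda>x. exp (f x))"
  using Ck_on_compose[OF Ck_on_real_exp] by blast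

lemma Ck_on_inverse [Ck_intros]:
  fixes f :: "'a::real_normed_vector \<Rightarrow> real"
  shows "Ck_on k S f \<Longrightarrow> (\<And>x. x \<in> S \<Longrightarrow> f x \<noteq> 0) \<Longrightarrow> open S \<Longrightarrow> Ck_on k S (\<lambda>x. inverse (f x))"
  using Ck_on_compose[OF Ck_on_real_inverse] by blast

lemma Ck_on_divide [Ck_intros]:
  fixes f g :: "'a::real_normed_vector \<Rightarrow> real"
  assumes "Ck_on k S f" "Ck_on k S g" "\<And>x. x \<in> S \<Longrightarrow> g x \<noteq> 0" "open S"
  shows "Ck_on k S (\<lambda>x. f x / g x)"
  using Ck_on_mult[OF assms(1) Ck_on_inverse[OF assms(2-4)] assms(4)]
  by (simp add: divide_inverse)

lemma Ck_on_local:
  assumes "\<And>x. x \<in> S \<Longrightarrow> \<exists>T. open T \<and> x \<in> T \<and> Ck_on k T f"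
  shows "Ck_on k S f"
  using assms
proof (induction k arbitrary: f)
  case 0
  then show ?case
    by (metis Ck_on.simps(1) continuous_at_imp_continuous_on continuous_on_eq_continuous_at)
next
  case (Suc k)
  have "\<exists>T. open T \<and> x \<in> T \<and> Ck_on k T (\<lambda>x. dderiv f x v)" if "x \<in> S" for x v
    using Suc.prems[OF that] by auto
  then show ?case using Suc by (metis Ck_on.simps(2))
qed

subsection \<open>Smoothness of every order\<close>

lemma smooth_onI: "(\<And>k. Ck_on k S f) \<Longrightarrow> smooth_on S f"
  by (simp add: smooth_on_def)

lemma smooth_onD: "smooth_on S f \<Longrightarrow> Ck_on k S f"
  by (simp add: smooth_on_def)

lemma smooth_on_has_derivative:
  "smooth_on S f \<Longrightarrow> x \<in> S \<Longrightarrow> (f has_derivative dderiv f x) (at x)"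
  using Ck_on_has_derivative smooth_onD by blast

lemma smooth_on_differentiable: "smooth_on S f \<Longrightarrow> x \<in> S \<Longrightarrow> f differentiable (at x)"
  using smooth_on_has_derivative differentiable_def by blast

lemma smooth_on_dderiv: "smooth_on S f \<Longrightarrow> smooth_on S (\<lambda>x. dderiv f x v)"
  unfolding smooth_on_def using Ck_on.simps(2) by blast

lemma smooth_on_continuous_on: "smooth_on S f \<Longrightarrow> continuous_on S f"
  using smooth_onD[of S f 0] by simp

lemma smooth_on_subset: "smooth_on T f \<Longrightarrow> S \<subseteq> T \<Longrightarrow> smooth_on S f"
  unfolding smooth_on_def using Ck_on_subset by blast

lemma smooth_on_compose:
  fixes f :: "'b::euclidean_space \<Rightarrow> 'c::real_normed_vector"
  assumes "smooth_on T f" "smooth_on S g" "\<And>x. x \<in> S \<Longrightarrow> g x \<in> T" "open S"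
  shows "smooth_on S (\<lambda>x. f (g x))"
  using assms unfolding smooth_on_def by (blast intro: Ck_on_compose)

lemma dderiv_linear:
  assumes "f differentiable (at x)"
  shows dderiv_add: "dderiv f x (v + w) = dderiv f x v + dderiv f x w"
    and dderiv_scale: "dderiv f x (c *\<^sub>R v) = c *\<^sub>R dderiv f x v"
    and dderiv_sum: "dderiv f x (\<Sum>i\<in>I. h i) = (\<Sum>i\<in>I. dderiv f x (h i))"
    and dderiv_zero: "dderiv f x 0 = 0"
  using linear_frechet_derivative[OF assms]
  by (auto simp: linear_add linear_scale linear_sum linear_0)

subsection \<open>Partial derivatives\<close>

lemma has_derivative_from_partials:
  fixes f :: "'a::euclidean_space \<times> 'b::euclidean_space \<Rightarrow> 'c::real_normed_vector"
  assumes "open S" "z \<in> S"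
    and d1: "\<And>x y. (x, y) \<in> S \<Longrightarrow> ((\<lambda>x. f (x, y)) has_derivative fx (x, y)) (at x)"
    and d2: "\<And>x y. (x, y) \<in> S \<Longrightarrow> ((\<lambda>y. f (x, y)) has_derivative fy (x, y)) (at y)"
    and c2: "\<And>v. continuous_on S (\<lambda>z. fy z v)"
  shows "(f has_derivative (\<lambda>(v, w). fx z v + fy z w)) (at z)"
proof -
  obtain A B where AB: "open A" "open B" "z \<in> A \<times> B" "A \<times> B \<subseteq> S"
    using assms(1,2) by (metis open_prod_def)
  obtain r where r: "r > 0" "ball (snd z) r \<subseteq> B"
    using AB openE by (metis mem_Times_iff)
  let ?B = "ball (snd z) r"
  have sub: "A \<times> ?B \<subseteq> S" using AB r by auto
  have zin: "fst z \<in> A" "snd z \<in> ?B" using AB r by auto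
  have bl: "bounded_linear (fy (x, y))" if "(x, y) \<in> S" for x y
    using d2[OF that] by (rule has_derivative_bounded_linear)
  have "((\<lambda>(x, y). f (x, y)) has_derivative
      (\<lambda>(tx, ty). fx z tx + blinfun_apply (Blinfun (fy (fst z, snd z))) ty))
      (at (fst z, snd z) within A \<times> ?B)"
  proof (rule has_derivative_partialsI[where fy = "\<lambda>x y. Blinfun (fy (x, y))"])
    show "((\<lambda>x. f (x, snd z)) has_derivative fx z) (at (fst z) within A)"
      using d1[of "fst z" "snd z"] assms(2) has_derivative_at_withinI by fastforce
    show "((\<lambda>y. f (x, y)) has_derivative blinfun_apply (Blinfun (fy (x, y)))) (at y within ?B)"
      if "x \<in> A" "y \<in> ?B" for x y
    proof -
      have "(x, y) \<in> S" using sub that by blast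
      then show ?thesis
        using has_derivative_at_withinI[OF d2] by (simp add: bounded_linear_Blinfun_apply[OF bl])
    qed
    have "continuous_on (A \<times> ?B) (\<lambda>z. Blinfun (fy z))"
    proof (rule continuous_on_blinfun_componentwise)
      fix i :: 'b assume "i \<in> Basis"
      have "continuous_on (A \<times> ?B) (\<lambda>z. fy z i)" using c2 sub continuous_on_subset by blast
      then show "continuous_on (A \<times> ?B) (\<lambda>z. blinfun_apply (Blinfun (fy z)) i)"
        by (rule continuous_on_eq) (use bl sub in \<open>auto simp: bounded_linear_Blinfun_apply\<close>)
    qed
    then have "continuous_on (A \<times> ?B) (\<lambda>(x, y). Blinfun (fy (x, y)))"
      by (simp add: case_prod_beta)
    then show "continuous (at (fst z, snd z) within A \<times> ?B) (\<lambda>(x, y). Blinfun (fy (x, y)))"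
      unfolding continuous_on_eq_continuous_within
      using zin by (metis mem_Sigma_iff)
  qed (use zin in auto)
  moreover have "at (fst z, snd z) within A \<times> ?B = at z"
    using at_within_open[of z "A \<times> ?B"] AB(1) zin by (simp add: open_Times mem_Times_iff)
  moreover have "blinfun_apply (Blinfun (fy (fst z, snd z))) = fy z"
    using bl[of "fst z" "snd z"] assms(2) by (simp add: bounded_linear_Blinfun_apply)
  ultimately show ?thesis by (simp add: case_prod_beta')
qed

text \<open>For functions known through the derivatives in each of their two arguments, such as flows.\<close>

lemma Ck_on_Suc_partials:
  fixes f :: "'a::euclidean_space \<times> 'b::euclidean_space \<Rightarrow> 'c::real_normed_vector"
  assumes "open S"
    and "\<And>x y. (x, y) \<in> S \<Longrightarrow> ((\<lambda>x. f (x, y)) has_derivative fx (x, y)) (at x)"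
    and "\<And>x y. (x, y) \<in> S \<Longrightarrow> ((\<lambda>y. f (x, y)) has_derivative fy (x, y)) (at y)"
    and "\<And>v. Ck_on k S (\<lambda>z. fx z v)" "\<And>v. Ck_on k S (\<lambda>z. fy z v)"
  shows "Ck_on (Suc k) S f"
proof (rule Ck_on_SucI[where f' = "\<lambda>z (v, w). fx z v + fy z w"])
  have "continuous_on S (\<lambda>z. fy z v)" for v
    using assms(5)[of v] Ck_on_le[of k S _ 0] by simp
  then show "(f has_derivative (\<lambda>(v, w). fx z v + fy z w)) (at z)" if "z \<in> S" for z
    using has_derivative_from_partials[OF assms(1) that assms(2,3)] by blast
  show "Ck_on k S (\<lambda>z. case v of (v, w) \<Rightarrow> fx z v + fy z w)" for v
    using assms by (cases v) (auto intro!: Ck_on_add)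
qed fact

lemma smooth_slice_differentiable:
  fixes G :: "'a::real_normed_vector \<times> 'b::real_normed_vector \<Rightarrow> 'c::real_normed_vector"
  assumes "smooth_on P G" "(\<tau>, q) \<in> P"
  shows "(\<lambda>q. G (\<tau>, q)) differentiable (at q)"
proof -
  have "((\<lambda>q. (\<tau>, q)) has_derivative (\<lambda>w. (0, w))) (at q)"
    by (auto intro!: derivative_eq_intros)
  from has_derivative_compose[OF this smooth_on_has_derivative[OF assms]]
  show ?thesis unfolding differentiable_def by blast
qed

text \<open>The mean value theorem, once in direction \<open>v\<close> and once in direction \<open>w\<close>.\<close>

lemma mixed_difference_MVT:
  fixes f :: "'a::real_normed_vector \<Rightarrow> real"
  assumes f: "smooth_on (ball x r) f" and h: "0 < h" "h * (norm v + norm w) < r"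
  shows "\<exists>y. norm (y - x) \<le> h * (norm v + norm w) \<and>
    f (x + h *\<^sub>R v + h *\<^sub>R w) - f (x + h *\<^sub>R v) - f (x + h *\<^sub>R w) + f x
      = h\<^sup>2 * dderiv (\<lambda>y. dderiv f y v) y w"
proof -
  have bound: "norm (s *\<^sub>R v + t *\<^sub>R w) \<le> h * (norm v + norm w)"
    if "0 \<le> s" "s \<le> h" "0 \<le> t" "t \<le> h" for s t
  proof -
    have "norm (s *\<^sub>R v + t *\<^sub>R w) \<le> s * norm v + t * norm w"
      using norm_triangle_ineq[of "s *\<^sub>R v" "t *\<^sub>R w"] that by simp
    also have "\<dots> \<le> h * norm v + h * norm w"
      by (intro add_mono mult_right_mono) (use that in auto)
    finally show ?thesis by (simp add: algebra_simps)
  qed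
  have inb: "x + s *\<^sub>R v + t *\<^sub>R w \<in> ball x r"
    if "0 \<le> s" "s \<le> h" "0 \<le> t" "t \<le> h" for s t
    using bound[OF that] h by (simp add: dist_norm norm_minus_commute add.assoc
        add_diff_eq[symmetric] del: mem_ball_0) (simp add: norm_minus_commute algebra_simps)
  have d: "((\<lambda>s. F (x + s *\<^sub>R v + t *\<^sub>R w)) has_real_derivative dderiv F (x + s *\<^sub>R v + t *\<^sub>R w) v) (at s)"
    "((\<lambda>t. F (x + s *\<^sub>R v + t *\<^sub>R w)) has_real_derivative dderiv F (x + s *\<^sub>R v + t *\<^sub>R w) w) (at t)"
    if F: "smooth_on (ball x r) F" and st: "0 \<le> s" "s \<le> h" "0 \<le> t" "t \<le> h" for F :: "'a \<Rightarrow> real" and s t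
  proof -
    note D = smooth_on_has_derivative[OF F inb[OF st]]
    have sc: "dderiv F (x + s *\<^sub>R v + t *\<^sub>R w) (c *\<^sub>R u) = c * dderiv F (x + s *\<^sub>R v + t *\<^sub>R w) u" for c u
      using linear_scale[OF has_derivative_linear[OF D]] by simp
    have "((\<lambda>s. x + s *\<^sub>R v + t *\<^sub>R w) has_derivative (\<lambda>c. c *\<^sub>R v)) (at s)"
      "((\<lambda>t. x + s *\<^sub>R v + t *\<^sub>R w) has_derivative (\<lambda>c. c *\<^sub>R w)) (at t)"
      by (auto intro!: derivative_eq_intros)
    from this[THEN has_derivative_compose, OF D]
    show "((\<lambda>s. F (x + s *\<^sub>R v + t *\<^sub>R w)) has_real_derivative dderiv F (x + s *\<^sub>R v + t *\<^sub>R w) v) (at s)"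
      "((\<lambda>t. F (x + s *\<^sub>R v + t *\<^sub>R w)) has_real_derivative dderiv F (x + s *\<^sub>R v + t *\<^sub>R w) w) (at t)"
      by (simp_all add: has_field_derivative_def sc mult_commute_abs)
  qed
  have "\<exists>s. 0 < s \<and> s < h \<and>
      (f (x + h *\<^sub>R v + h *\<^sub>R w) - f (x + h *\<^sub>R v + 0 *\<^sub>R w))
      - (f (x + 0 *\<^sub>R v + h *\<^sub>R w) - f (x + 0 *\<^sub>R v + 0 *\<^sub>R w))
      = (h - 0) * (dderiv f (x + s *\<^sub>R v + h *\<^sub>R w) v - dderiv f (x + s *\<^sub>R v + 0 *\<^sub>R w) v)"
    using h by (intro MVT2[where f = "\<lambda>s. f (x + s *\<^sub>R v + h *\<^sub>R w) - f (x + s *\<^sub>R v + 0 *\<^sub>R w)"]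
        DERIV_diff d(1)[OF f]) auto
  then obtain s where s: "0 < s" "s < h" and eq1:
      "f (x + h *\<^sub>R v + h *\<^sub>R w) - f (x + h *\<^sub>R v) - f (x + h *\<^sub>R w) + f x
      = h * (dderiv f (x + s *\<^sub>R v + h *\<^sub>R w) v - dderiv f (x + s *\<^sub>R v + 0 *\<^sub>R w) v)"
    by (auto simp: algebra_simps)
  have "\<exists>t. 0 < t \<and> t < h \<and>
      dderiv f (x + s *\<^sub>R v + h *\<^sub>R w) v - dderiv f (x + s *\<^sub>R v + 0 *\<^sub>R w) v
      = (h - 0) * dderiv (\<lambda>y. dderiv f y v) (x + s *\<^sub>R v + t *\<^sub>R w) w"
    using h s by (intro MVT2[where f = "\<lambda>t. dderiv f (x + s *\<^sub>R v + t *\<^sub>R w) v"]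
        d(2)[OF smooth_on_dderiv[OF f]]) auto
  then obtain t where "0 < t" "t < h"
      "dderiv f (x + s *\<^sub>R v + h *\<^sub>R w) v - dderiv f (x + s *\<^sub>R v + 0 *\<^sub>R w) v
      = h * dderiv (\<lambda>y. dderiv f y v) (x + s *\<^sub>R v + t *\<^sub>R w) w"
    by auto
  then show ?thesis
    using eq1 bound[of s t] s
    by (intro exI[of _ "x + s *\<^sub>R v + t *\<^sub>R w"]) (simp add: power2_eq_square add.assoc)
qed

text \<open>Both iterated derivatives at a nearby point equal the same second difference quotient.\<close>

lemma second_derivative_symmetric:
  fixes f :: "'a::real_normed_vector \<Rightarrow> real"
  assumes "open S" "smooth_on S f" "x \<in> S"
  shows "dderiv (\<lambda>y. dderiv f y v) x w = dderiv (\<lambda>y. dderiv f y w) x v"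
proof (rule ccontr)
  let ?A = "\<lambda>y. dderiv (\<lambda>y. dderiv f y v) y w" and ?B = "\<lambda>y. dderiv (\<lambda>y. dderiv f y w) y v"
  assume ne: "?A x \<noteq> ?B x"
  define e where "e = \<bar>?A x - ?B x\<bar> / 2"
  have "e > 0" using ne by (simp add: e_def)
  have cont: "continuous_on S ?A" "continuous_on S ?B"
    by (intro smooth_on_continuous_on smooth_on_dderiv assms)+
  then have "isCont ?A x" "isCont ?B x"
    using assms(1,3) continuous_on_eq_continuous_at by blast+
  then have "\<exists>d>0. \<forall>y. dist y x < d \<longrightarrow> dist (?A y) (?A x) < e"
    "\<exists>d>0. \<forall>y. dist y x < d \<longrightarrow> dist (?B y) (?B x) < e"
    using \<open>e > 0\<close> by (auto simp: continuous_at_eps_delta)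
  then obtain d1 d2 where d12: "d1 > 0" "d2 > 0"
    "\<And>y. dist y x < d1 \<Longrightarrow> dist (?A y) (?A x) < e" "\<And>y. dist y x < d2 \<Longrightarrow> dist (?B y) (?B x) < e"
    by blast
  obtain r where r: "r > 0" "ball x r \<subseteq> S" using assms openE by blast
  define m where "m = min r (min d1 d2)"
  define h where "h = m / (norm v + norm w + 1) / 2"
  have "m > 0" using r d12 by (simp add: m_def)
  have pos: "norm v + norm w + 1 > 0" by (simp add: add_nonneg_pos)
  have h: "h > 0" using \<open>m > 0\<close> pos by (simp add: h_def)
  have "h * (norm v + norm w) \<le> h * (norm v + norm w + 1)" using h by simp
  also have "\<dots> = m / 2" unfolding h_def using pos
    by (metis divide_divide_eq_left less_irrefl mult.commute nonzero_eq_divide_eq)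
  finally have hm: "h * (norm v + norm w) < m" using \<open>m > 0\<close> by linarith
  have f: "smooth_on (ball x m) f"
    using assms(2) r by (rule_tac smooth_on_subset) (auto simp: m_def)
  obtain y where y: "norm (y - x) \<le> h * (norm v + norm w)"
    "f (x + h *\<^sub>R v + h *\<^sub>R w) - f (x + h *\<^sub>R v) - f (x + h *\<^sub>R w) + f x = h\<^sup>2 * ?A y"
    using mixed_difference_MVT[OF f h hm] by blast
  have hm': "h * (norm w + norm v) < m" using hm by (simp add: add.commute)
  obtain y' where y': "norm (y' - x) \<le> h * (norm w + norm v)"
    "f (x + h *\<^sub>R w + h *\<^sub>R v) - f (x + h *\<^sub>R w) - f (x + h *\<^sub>R v) + f x = h\<^sup>2 * ?B y'"
    using mixed_difference_MVT[OF f h hm'] by blast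
  have "h\<^sup>2 * ?A y = h\<^sup>2 * ?B y'" using y(2) y'(2) by (simp add: algebra_simps)
  then have AB: "?A y = ?B y'" using h by simp
  have "dist y x < d1" using y(1) hm by (simp add: dist_norm m_def)
  moreover have "dist y' x < d2" using y'(1) hm' by (simp add: dist_norm m_def)
  ultimately have "dist (?A y) (?A x) < e" "dist (?B y') (?B x) < e" using d12 by blast+
  moreover have False if "\<bar>p - a\<bar> < \<bar>a - b\<bar> / 2" "\<bar>p - b\<bar> < \<bar>a - b\<bar> / 2" for p a b :: real
    using that by (auto simp: abs_if split: if_splits)
  ultimately show False using AB unfolding e_def dist_real_def by metis
qed

subsection \<open>Integrals depending on a parameter\<close>

text \<open>Differentiation under the integral sign. The set \<open>P\<close> is not assumed to be a product because the integrands of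
  time integrals live on the set of all \<open>((\<tau>, q), s)\<close> for which \<open>(s \<tau>, q)\<close> is admissible.\<close>

lemma Ck_on_integral:
  fixes f :: "'a::euclidean_space \<times> real \<Rightarrow> 'b::euclidean_space"
  assumes "Ck_on k P f" "open S" "S \<times> {0..1} \<subseteq> P"
  shows "Ck_on k S (\<lambda>x. integral {0..1} (\<lambda>s. f (x, s)))"
  using assms(1)
proof (induction k arbitrary: f)
  case 0
  then have "continuous_on (S \<times> cbox 0 1) (\<lambda>(x, s). f (x, s))"
    using assms(3) by (auto intro: continuous_on_subset)
  then show ?case using integral_continuous_on_param[of S 0 1 "\<lambda>x s. f (x, s)"] by simp
next
  case (Suc k)
  have D: "(f has_derivative dderiv f (x, s)) (at (x, s))" if "x \<in> S" "s \<in> {0..1}" for x s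
    using Ck_on_has_derivative[OF Suc.prems] assms(3) that by blast
  have bl: "bounded_linear (\<lambda>v. dderiv f (x, s) (v, 0))" if "x \<in> S" "s \<in> {0..1}" for x s
    using bounded_linear_compose[OF has_derivative_bounded_linear[OF D[OF that]]
        bounded_linear_Pair[OF bounded_linear_ident bounded_linear_zero]] .
  have c: "continuous_on (S \<times> {0..1}) f" "\<And>v. continuous_on (S \<times> {0..1}) (\<lambda>z. dderiv f z v)"
  proof -
    note sub = assms(3)
    have "Ck_on 0 (P) f" by (rule Ck_on_le[OF Suc.prems]) simp
    then show "continuous_on (S \<times> {0..1}) f" using sub continuous_on_subset by auto
    fix v
    have "Ck_on k (P) (\<lambda>z. dderiv f z v)"
      using Suc.prems by (metis Ck_on.simps(2))
    then have "Ck_on 0 (P) (\<lambda>z. dderiv f z v)" by (rule Ck_on_le) simp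
    then show "continuous_on (S \<times> {0..1}) (\<lambda>z. dderiv f z v)"
      using sub continuous_on_subset by auto
  qed
  show ?case
  proof (rule Ck_on_SucI[where f' = "\<lambda>x v. integral {0..1} (\<lambda>s. dderiv f (x, s) (v, 0))"])
    show "Ck_on k S (\<lambda>x. integral {0..1} (\<lambda>s. dderiv f (x, s) (v, 0)))" for v
      using Suc.prems Suc.IH[of "\<lambda>z. dderiv f z (v, 0)"] by simp
    fix x assume x: "x \<in> S"
    obtain r where r: "r > 0" "ball x r \<subseteq> S" using x assms(2) openE by blast
    let ?B = "\<lambda>x s. Blinfun (\<lambda>v. dderiv f (x, s) (v, 0))"
    have cB: "continuous_on (S \<times> {0..1}) (\<lambda>(x, s). ?B x s)"
    proof (rule continuous_on_blinfun_componentwise)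
      fix i :: 'a
      show "continuous_on (S \<times> {0..1}) (\<lambda>z. blinfun_apply (case z of (x, s) \<Rightarrow> ?B x s) i)"
        by (rule continuous_on_eq[OF c(2)[of "(i, 0)"]])
          (auto simp: bounded_linear_Blinfun_apply[OF bl])
    qed
    have "((\<lambda>x. integral (cbox 0 1) (\<lambda>s. f (x, s))) has_derivative
        blinfun_apply (integral (cbox 0 1) (?B x))) (at x within ball x r)"
    proof (rule leibniz_rule)
      fix y t assume yt: "y \<in> ball x r" "t \<in> cbox (0::real) 1"
      then have yS: "y \<in> S" "t \<in> {0..1}" using r by auto
      have "((\<lambda>y. (y, t)) has_derivative (\<lambda>v. (v, 0))) (at y)"
        by (auto intro!: derivative_eq_intros)
      from has_derivative_compose[OF this D[OF yS]]
      show "((\<lambda>y. f (y, t)) has_derivative blinfun_apply (?B y t)) (at y within ball x r)"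
        using has_derivative_at_withinI bounded_linear_Blinfun_apply[OF bl[OF yS]] by simp
    next
      fix y assume "y \<in> ball x r"
      then have y: "y \<in> S" using r by blast
      have "continuous_on (cbox 0 1) (\<lambda>s. f (y, s))"
        by (rule continuous_on_compose2[OF c(1)]) (use y in \<open>auto intro!: continuous_intros\<close>)
      then show "(\<lambda>s. f (y, s)) integrable_on cbox 0 1" by (rule integrable_continuous)
    next
      show "continuous_on (ball x r \<times> cbox 0 1) (\<lambda>(x, s). ?B x s)"
        by (rule continuous_on_subset[OF cB]) (use r in auto)
    qed (use r in auto)
    then have *: "((\<lambda>x. integral {0..1} (\<lambda>s. f (x, s))) has_derivative
        blinfun_apply (integral {0..1} (?B x))) (at x)"
      using at_within_open[of x "ball x r"] r by (simp add: cbox_interval)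
    have "continuous_on {0..1} (?B x)"
      by (rule continuous_on_compose2[OF cB, of _ "\<lambda>s. (x, s)", simplified])
        (use x in \<open>auto intro!: continuous_intros\<close>)
    then have int: "?B x integrable_on {0..1}"
      by (rule integrable_continuous_interval)
    have "blinfun_apply (integral {0..1} (?B x)) v = integral {0..1} (\<lambda>s. dderiv f (x, s) (v, 0))" for v
    proof -
      have "blinfun_apply (integral {0..1} (?B x)) v
          = integral {0..1} ((\<lambda>L. blinfun_apply L v) \<circ> ?B x)"
        by (rule integral_linear[OF int, symmetric])
          (rule bounded_bilinear.bounded_linear_left[OF bounded_bilinear_blinfun_apply])
      also have "\<dots> = integral {0..1} (\<lambda>s. dderiv f (x, s) (v, 0))"
        by (rule integral_cong) (auto simp: bounded_linear_Blinfun_apply[OF bl[OF x]])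
      finally show ?thesis .
    qed
    then show "((\<lambda>x. integral {0..1} (\<lambda>s. f (x, s))) has_derivative
        (\<lambda>v. integral {0..1} (\<lambda>s. dderiv f (x, s) (v, 0)))) (at x)"
      by (rule has_derivative_eq_rhs[OF *, OF ext])
  qed fact
qed

subsection \<open>Integration along the time variable\<close>

text \<open>This is \<open>\<integral>\<^sub>0\<^sup>\<tau> f (\<sigma>, q) d\<sigma>\<close>. The substitution \<open>\<sigma> = s \<tau>\<close> makes the domain of integration
  independent of \<open>\<tau>\<close>, which also may be negative.\<close>

definition time_integral :: "(real \<times> 'a \<Rightarrow> real) \<Rightarrow> real \<times> 'a \<Rightarrow> real" where
  "time_integral f = (\<lambda>(\<tau>, q). \<tau> * integral {0..1} (\<lambda>s. f (s * \<tau>, q)))"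

lemma time_integral_0 [simp]: "time_integral f (0, q) = 0"
  by (simp add: time_integral_def)

lemma scaled_time_in_interval:
  fixes s \<tau> \<epsilon> :: real
  assumes "\<tau> \<in> {-\<epsilon><..<\<epsilon>}" "s \<in> {0..1}"
  shows "s * \<tau> \<in> {-\<epsilon><..<\<epsilon>}"
proof -
  have "\<bar>s * \<tau>\<bar> \<le> \<bar>\<tau>\<bar>" using assms(2) by (simp add: abs_mult mult_left_le_one_le)
  then show ?thesis using assms(1) by auto
qed

text \<open>Only continuity is available when this is applied to a fixed point of the Picard operator, so the proof
  goes through an antiderivative on a compact interval around \<open>0\<close> and \<open>\<tau>\<close>.\<close>

lemma time_integral_DERIV:
  fixes f :: "real \<times> 'a \<Rightarrow> real"
  assumes "continuous_on {-\<epsilon><..<\<epsilon>} (\<lambda>\<tau>. f (\<tau>, q))" "\<tau> \<in> {-\<epsilon><..<\<epsilon>}"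
  shows "((\<lambda>\<tau>. time_integral f (\<tau>, q)) has_real_derivative f (\<tau>, q)) (at \<tau>)"
proof -
  define b where "b = (\<bar>\<tau>\<bar> + \<epsilon>) / 2"
  have b: "\<tau> \<in> {-b<..<b}" "b < \<epsilon>" "0 < b" using assms(2) by (auto simp: b_def abs_if field_simps)
  have sub: "{-b..b} \<subseteq> {-\<epsilon><..<\<epsilon>}" using b by auto
  obtain G where G: "\<And>x. x \<in> {-b..b} \<Longrightarrow>
      (G has_vector_derivative f (x, q)) (at x within {-b..b})"
    using antiderivative_continuous[OF continuous_on_subset[OF assms(1) sub]] by blast
  have eq: "time_integral f (x, q) = G x - G 0" if x: "x \<in> {-b<..<b}" for x
  proof -
    have "((\<lambda>s. G (s * x)) has_vector_derivative x *\<^sub>R f (s * x, q)) (at s within {0..1})"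
      if s: "s \<in> {0..1}" for s
    proof -
      have img: "(\<lambda>s. s * x) ` {0..1} \<subseteq> {-b..b}"
        using scaled_time_in_interval[OF x] by fastforce
      have "((\<lambda>s. s * x) has_vector_derivative x) (at s within {0..1})"
        by (auto intro!: derivative_eq_intros)
      moreover have "(G has_vector_derivative f (s * x, q)) (at (s * x) within (\<lambda>s. s * x) ` {0..1})"
        using has_vector_derivative_within_subset[OF G img] s img by blast
      ultimately show ?thesis
        using vector_diff_chain_within[of "\<lambda>s. s * x"] by (fastforce simp: o_def)
    qed
    from fundamental_theorem_of_calculus[OF _ this]
    have "((\<lambda>s. x *\<^sub>R f (s * x, q)) has_integral G x - G 0) {0..1}" by simp
    then have "integral {0..1} (\<lambda>s. x *\<^sub>R f (s * x, q)) = G x - G 0" by (rule integral_unique)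
    then show ?thesis by (simp add: time_integral_def)
  qed
  have "(G has_vector_derivative f (\<tau>, q)) (at \<tau> within {-b<..<b})"
    using G[of \<tau>] b by (auto intro: has_vector_derivative_within_subset)
  then have "(G has_real_derivative f (\<tau>, q)) (at \<tau>)"
    using at_within_open[of \<tau> "{-b<..<b}"] b
    by (simp add: has_real_derivative_iff_has_vector_derivative)
  then have "((\<lambda>x. G x - G 0) has_real_derivative f (\<tau>, q)) (at \<tau>)"
    by (auto intro!: derivative_eq_intros)
  then show ?thesis
    by (rule has_field_derivative_transform_within_open[where S = "{-b<..<b}"]) (use b eq in auto)
qed

lemma Ck_on_time_integral:
  fixes f :: "real \<times> 'a::euclidean_space \<Rightarrow> real"
  assumes "Ck_on k ({-\<epsilon><..<\<epsilon>} \<times> N) f" "open N"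
  shows "Ck_on k ({-\<epsilon><..<\<epsilon>} \<times> N) (time_integral f)"
proof -
  let ?I = "{-\<epsilon><..<\<epsilon>}"
  let ?h = "\<lambda>w::(real \<times> 'a) \<times> real. (snd w * fst (fst w), snd (fst w))"
  let ?P = "?h -` (?I \<times> N)"
  have oI: "open (?I \<times> N)" using assms(2) by (intro open_Times) auto
  have oP: "open ?P"
    using oI by (intro open_vimage continuous_intros) auto
  have "Ck_on k ?P (\<lambda>w. f (?h w))"
    by (rule Ck_on_compose[OF assms(1)]) (use oP in \<open>auto intro!: Ck_intros\<close>)
  moreover have "(?I \<times> N) \<times> {0..1} \<subseteq> ?P"
    using scaled_time_in_interval by auto
  ultimately have "Ck_on k (?I \<times> N) (\<lambda>z. integral {0..1} (\<lambda>s. f (?h (z, s))))"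
    using Ck_on_integral oI by blast
  then have "Ck_on k (?I \<times> N) (\<lambda>z. fst z * integral {0..1} (\<lambda>s. f (?h (z, s))))"
    using oI by (intro Ck_intros)
  then show ?thesis by (simp add: time_integral_def case_prod_beta')
qed

section \<open>The flow of a vector field on the line\<close>

text \<open>The Picard operator acts on functions of the time and of the initial value together, so its
  fixed point is continuous in both.\<close>

lemma Picard_fixed_point:
  fixes D :: "real \<Rightarrow> real"
  assumes L: "\<And>x y. \<bar>D x - D y\<bar> \<le> L * \<bar>x - y\<bar>" and M: "\<And>x. \<bar>D x\<bar> \<le> M"
    and \<epsilon>: "0 < \<epsilon>" "\<epsilon> * L \<le> 1 / 2" and L0: "0 \<le> L"
  shows "\<exists>T. continuous_on UNIV T \<and> (\<forall>\<tau> s. \<bar>T (\<tau>, s) - s\<bar> \<le> \<epsilon> * M) \<and>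
    (\<forall>\<tau>\<in>{-\<epsilon><..<\<epsilon>}. \<forall>s. T (\<tau>, s) = s + time_integral (\<lambda>z. D (T z)) (\<tau>, s))"
proof -
  \<comment> \<open>Freezing the time outside of \<open>[-\<epsilon>, \<epsilon>]\<close> lets the operator act on bounded functions on the whole plane.\<close>
  define cl where "cl \<tau> = max (-\<epsilon>) (min \<tau> \<epsilon>)" for \<tau>
  have cl: "\<bar>cl \<tau>\<bar> \<le> \<epsilon>" for \<tau> using \<epsilon> by (auto simp: cl_def)
  have cl_id: "cl \<tau> = \<tau>" if "\<bar>\<tau>\<bar> \<le> \<epsilon>" for \<tau> using that by (auto simp: cl_def)
  have ccl: "continuous_on X cl" for X unfolding cl_def by (intro continuous_intros)
  have "L-lipschitz_on UNIV D" using L L0 by (auto simp: lipschitz_on_def dist_real_def)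
  then have cD: "continuous_on X D" for X
    using lipschitz_on_continuous_on continuous_on_subset by blast
  define J where "J \<psi> = (\<lambda>z. integral {0..1} (\<lambda>s. D (snd z + apply_bcontfun \<psi> (s * cl (fst z), snd z))))"
    for \<psi> :: "(real \<times> real) \<Rightarrow>\<^sub>C real"
  have cint: "continuous_on {0..1} (\<lambda>s. D (snd z + apply_bcontfun \<psi> (s * cl (fst z), snd z)))" for \<psi> z
    by (intro continuous_intros continuous_on_compose2[OF cD]
        continuous_on_compose2[OF continuous_on_apply_bcontfun]) auto
  have J_bound: "\<bar>J \<psi> z\<bar> \<le> M" for \<psi> z
    using integral_bound[OF _ cint[of z \<psi>], where B = M] M by (simp add: J_def)
  have J_diff: "\<bar>J \<psi> z - J \<psi>' z\<bar> \<le> L * dist \<psi> \<psi>'" for \<psi> \<psi>' z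
  proof -
    let ?d = "\<lambda>s. D (snd z + apply_bcontfun \<psi> (s * cl (fst z), snd z))
        - D (snd z + apply_bcontfun \<psi>' (s * cl (fst z), snd z))"
    have "J \<psi> z - J \<psi>' z = integral {0..1} ?d"
      unfolding J_def
      by (rule integral_diff[symmetric]) (rule integrable_continuous_interval[OF cint])+
    moreover have "norm (?d s) \<le> L * dist \<psi> \<psi>'" for s
    proof -
      let ?p = "(s * cl (fst z), snd z)"
      have "\<bar>?d s\<bar> \<le> L * \<bar>apply_bcontfun \<psi> ?p - apply_bcontfun \<psi>' ?p\<bar>"
        using L[of "snd z + apply_bcontfun \<psi> ?p" "snd z + apply_bcontfun \<psi>' ?p"] by simp
      also have "\<dots> \<le> L * dist \<psi> \<psi>'"
        using dist_bounded[of \<psi> ?p \<psi>'] L0 by (intro mult_left_mono) (auto simp: dist_real_def)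
      finally show ?thesis by simp
    qed
    ultimately show ?thesis
      using integral_bound[of 0 1 ?d "L * dist \<psi> \<psi>'"] continuous_on_diff[OF cint cint] by simp
  qed
  have cJ: "continuous_on UNIV (J \<psi>)" for \<psi>
  proof -
    have "continuous_on (UNIV \<times> cbox 0 1)
      (\<lambda>(z, s). D (snd z + apply_bcontfun \<psi> (s * cl (fst z), snd z)))"
      unfolding case_prod_beta
      by (intro continuous_intros continuous_on_compose2[OF cD] continuous_on_compose2[OF ccl]
          continuous_on_compose2[OF continuous_on_apply_bcontfun]) auto
    from integral_continuous_on_param[OF this] show ?thesis by (simp add: J_def)
  qed
  define P where "P \<psi> = Bcontfun (\<lambda>z. cl (fst z) * J \<psi> z)" for \<psi>
  have bound: "\<bar>cl (fst z) * J \<psi> z\<bar> \<le> \<epsilon> * M" for \<psi> z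
    unfolding abs_mult using cl J_bound \<epsilon> by (intro mult_mono) auto
  have P: "apply_bcontfun (P \<psi>) z = cl (fst z) * J \<psi> z" for \<psi> z
  proof -
    have "bounded (range (\<lambda>z. cl (fst z) * J \<psi> z))" using bound by (intro boundedI[where B = "\<epsilon> * M"]) auto
    moreover have "continuous_on UNIV (\<lambda>z. cl (fst z) * J \<psi> z)"
      by (intro continuous_intros continuous_on_compose2[OF ccl] cJ) auto
    ultimately have "(\<lambda>z. cl (fst z) * J \<psi> z) \<in> bcontfun" by (simp add: bcontfun_def)
    then show ?thesis unfolding P_def by (simp add: Bcontfun_inverse)
  qed
  have contr: "dist (P \<psi>) (P \<psi>') \<le> 1 / 2 * dist \<psi> \<psi>'" for \<psi> \<psi>'
  proof (rule dist_bound)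
    fix z
    have "dist (apply_bcontfun (P \<psi>) z) (apply_bcontfun (P \<psi>') z) = \<bar>cl (fst z)\<bar> * \<bar>J \<psi> z - J \<psi>' z\<bar>"
      by (simp add: P dist_real_def abs_mult flip: right_diff_distrib)
    also have "\<dots> \<le> \<epsilon> * (L * dist \<psi> \<psi>')" using cl J_diff \<epsilon> by (intro mult_mono) auto
    also have "\<dots> = (\<epsilon> * L) * dist \<psi> \<psi>'" by simp
    also have "\<dots> \<le> 1 / 2 * dist \<psi> \<psi>'" using \<epsilon> by (intro mult_right_mono) auto
    finally show "dist (apply_bcontfun (P \<psi>) z) (apply_bcontfun (P \<psi>') z) \<le> 1 / 2 * dist \<psi> \<psi>'" .
  qed
  have "\<exists>!\<psi>. P \<psi> = \<psi>"
    by (rule banach_fix_type[of "1 / 2"]) (use contr in auto)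
  then obtain \<psi> where \<psi>: "P \<psi> = \<psi>" by blast
  define T where "T z = snd z + apply_bcontfun \<psi> z" for z
  have "continuous_on UNIV T"
    unfolding T_def by (intro continuous_intros continuous_on_apply_bcontfun)
  moreover have "\<bar>T (\<tau>, s) - s\<bar> \<le> \<epsilon> * M" for \<tau> s
    using P[of \<psi> "(\<tau>, s)"] bound[of "(\<tau>, s)" \<psi>] by (simp add: T_def \<psi>)
  moreover have "T (\<tau>, s) = s + time_integral (\<lambda>z. D (T z)) (\<tau>, s)" if "\<tau> \<in> {-\<epsilon><..<\<epsilon>}" for \<tau> s
    using P[of \<psi> "(\<tau>, s)"] cl_id[of \<tau>] that by (simp add: abs_le_iff \<psi> T_def J_def time_integral_def)
  ultimately show ?thesis by blast
qed

text \<open>The difference quotient of \<open>d\<close>, extended by \<open>d'\<close> to the diagonal.\<close>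

definition mean_slope :: "(real \<Rightarrow> real) \<Rightarrow> real \<times> real \<Rightarrow> real" where
  "mean_slope d' = (\<lambda>(x, y). integral {0..1} (\<lambda>\<theta>. d' (x + \<theta> * (y - x))))"

lemma mean_slope_diag [simp]: "mean_slope d' (x, x) = d' x"
  by (simp add: mean_slope_def)

lemma segment_in_interval:
  fixes x y \<theta> :: real
  assumes "x \<in> {a<..<b}" "y \<in> {a<..<b}" "\<theta> \<in> {0..1}"
  shows "x + \<theta> * (y - x) \<in> {a<..<b}"
proof -
  have "(1 - \<theta>) *\<^sub>R x + \<theta> *\<^sub>R y \<in> {a<..<b}"
    using convexD_alt[OF convex_real_interval(8)] assms by auto
  then show ?thesis by (simp add: algebra_simps)
qed

lemma mean_slope:
  assumes d: "\<And>x. x \<in> {a<..<b} \<Longrightarrow> (d has_real_derivative d' x) (at x)"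
    and xy: "x \<in> {a<..<b}" "y \<in> {a<..<b}"
  shows "d y - d x = (y - x) * mean_slope d' (x, y)"
proof -
  have "((\<lambda>\<theta>. d (x + \<theta> * (y - x))) has_vector_derivative (y - x) * d' (x + \<theta> * (y - x)))
      (at \<theta> within {0..1})" if "\<theta> \<in> {0..1}" for \<theta>
  proof -
    have "((\<lambda>\<theta>. d (x + \<theta> * (y - x))) has_real_derivative d' (x + \<theta> * (y - x)) * (y - x)) (at \<theta>)"
      by (rule DERIV_chain2[where f = d and g = "\<lambda>\<theta>. x + \<theta> * (y - x)", OF d[OF segment_in_interval[OF xy that]]])
        (auto intro!: derivative_eq_intros)
    then show ?thesis
      by (simp add: has_real_derivative_iff_has_vector_derivative mult.commute
          has_vector_derivative_at_within)
  qed
  from fundamental_theorem_of_calculus[OF _ this]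
  have "((\<lambda>\<theta>. (y - x) * d' (x + \<theta> * (y - x))) has_integral d y - d x) {0..1}" by simp
  from integral_unique[OF this] show ?thesis by (simp add: mean_slope_def)
qed

lemma continuous_on_mean_slope:
  assumes "continuous_on {a<..<b} d'"
  shows "continuous_on ({a<..<b} \<times> {a<..<b}) (mean_slope d')"
proof -
  have "continuous_on (({a<..<b} \<times> {a<..<b}) \<times> cbox 0 1)
      (\<lambda>(z, \<theta>). d' (fst z + \<theta> * (snd z - fst z)))"
    unfolding case_prod_beta
    by (intro continuous_on_compose2[OF assms] continuous_intros) (use segment_in_interval in fastforce)
  from integral_continuous_on_param[OF this] show ?thesis
    by (simp add: mean_slope_def case_prod_beta')
qed

text \<open>In dimension one the difference of two integral curves solves a scalar linear equation, whose
  solution is an explicit exponential; this replaces the variational equation.\<close>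

lemma flow_difference:
  fixes T :: "real \<times> real \<Rightarrow> real"
  assumes T: "\<And>\<tau> s. \<tau> \<in> {-\<epsilon><..<\<epsilon>} \<Longrightarrow> s \<in> B \<Longrightarrow>
      T (\<tau>, s) \<in> {a<..<b} \<and> ((\<lambda>\<tau>. T (\<tau>, s)) has_real_derivative d (T (\<tau>, s))) (at \<tau>)"
    and T0: "\<And>s. s \<in> B \<Longrightarrow> T (0, s) = s"
    and d: "\<And>x. x \<in> {a<..<b} \<Longrightarrow> (d has_real_derivative d' x) (at x)"
    and cd: "continuous_on {a<..<b} d'"
    and s: "s \<in> B" "s' \<in> B" and \<tau>: "\<tau> \<in> {-\<epsilon><..<\<epsilon>}"
  shows "T (\<tau>, s') - T (\<tau>, s) = (s' - s) *
    exp (time_integral (\<lambda>(\<sigma>, _). mean_slope d' (T (\<sigma>, s), T (\<sigma>, s'))) (\<tau>, ()))"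
proof -
  let ?I = "{-\<epsilon><..<\<epsilon>}"
  let ?q = "\<lambda>\<sigma>. mean_slope d' (T (\<sigma>, s), T (\<sigma>, s'))"
  let ?E = "\<lambda>\<sigma>. time_integral (\<lambda>(\<sigma>, _). ?q \<sigma>) (\<sigma>, ())"
  let ?h = "\<lambda>\<sigma>. (T (\<sigma>, s') - T (\<sigma>, s)) * exp (- ?E \<sigma>)"
  have cT: "continuous_on ?I (\<lambda>\<sigma>. T (\<sigma>, s))" if "s \<in> B" for s
    using T[OF _ that] by (meson DERIV_isCont continuous_at_imp_continuous_on)
  have "continuous_on ?I ?q"
    by (rule continuous_on_compose2[OF continuous_on_mean_slope[OF cd]])
      (use T s in \<open>auto intro!: continuous_intros cT\<close>)
  then have E: "(?E has_real_derivative ?q \<sigma>) (at \<sigma>)" if "\<sigma> \<in> ?I" for \<sigma>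
    using time_integral_DERIV[of \<epsilon> "\<lambda>(\<sigma>, _). ?q \<sigma>" "()" \<sigma>] that by simp
  have "(?h has_real_derivative 0) (at \<sigma>)" if "\<sigma> \<in> ?I" for \<sigma>
  proof -
    have "d (T (\<sigma>, s')) - d (T (\<sigma>, s)) = (T (\<sigma>, s') - T (\<sigma>, s)) * ?q \<sigma>"
      by (rule mean_slope[OF d]) (use T s that in auto)
    then have "(d (T (\<sigma>, s')) - d (T (\<sigma>, s))) * exp (- ?E \<sigma>)
        + (exp (- ?E \<sigma>) * (- ?q \<sigma>)) * (T (\<sigma>, s') - T (\<sigma>, s)) = 0"
      by simp
    moreover have "(?h has_real_derivative (d (T (\<sigma>, s')) - d (T (\<sigma>, s))) * exp (- ?E \<sigma>)
        + (exp (- ?E \<sigma>) * (- ?q \<sigma>)) * (T (\<sigma>, s') - T (\<sigma>, s))) (at \<sigma>)"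
      by (intro DERIV_mult DERIV_diff DERIV_fun_exp DERIV_minus T[THEN conjunct2] E that s)
    ultimately show ?thesis by simp
  qed
  then obtain c where c: "\<And>\<sigma>. \<sigma> \<in> ?I \<Longrightarrow> ?h \<sigma> = c"
    using has_field_derivative_zero_constant[of ?I ?h]
    by (metis (no_types, lifting) has_field_derivative_at_within convex_real_interval(8))
  have "0 \<in> ?I" using \<tau> by auto
  then have "?h \<tau> = s' - s" using c[of 0] c[OF \<tau>] T0 s by simp
  then show ?thesis by (simp add: exp_minus field_simps)
qed

text \<open>The field is cut off outside a compact interval to become bounded and Lipschitz. Smoothness is obtained by
  bootstrapping: both partial derivatives of the flow, \<open>d \<circ> T\<close> and the exponential of the time integral
  of \<open>d' \<circ> T\<close>, are as smooth as \<open>T\<close> is.\<close>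

lemma scalar_flow:
  fixes d :: "real \<Rightarrow> real"
  assumes "open S" "smooth_on S d" "s0 \<in> S"
  obtains \<epsilon> r T where "\<epsilon> > 0" "r > 0" "smooth_on ({-\<epsilon><..<\<epsilon>} \<times> {s0-r<..<s0+r}) T"
    "\<And>s. s \<in> {s0-r<..<s0+r} \<Longrightarrow> T (0, s) = s"
    "\<And>\<tau> s. \<tau> \<in> {-\<epsilon><..<\<epsilon>} \<Longrightarrow> s \<in> {s0-r<..<s0+r} \<Longrightarrow> T (\<tau>, s) \<in> S"
    "\<And>\<tau> s. \<tau> \<in> {-\<epsilon><..<\<epsilon>} \<Longrightarrow> s \<in> {s0-r<..<s0+r} \<Longrightarrow>
      ((\<lambda>\<tau>. T (\<tau>, s)) has_real_derivative d (T (\<tau>, s))) (at \<tau>)"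
    "\<And>\<tau> s. \<tau> \<in> {-\<epsilon><..<\<epsilon>} \<Longrightarrow> s \<in> {s0-r<..<s0+r} \<Longrightarrow>
      ((\<lambda>s. T (\<tau>, s)) has_real_derivative
        exp (time_integral (\<lambda>z. dderiv d (T z) 1) (\<tau>, s))) (at s)"
proof -
  let ?d' = "\<lambda>x. dderiv d x 1"
  have d: "(d has_real_derivative ?d' x) (at x)" if "x \<in> S" for x
  proof -
    have D: "(d has_derivative dderiv d x) (at x)"
      using smooth_on_has_derivative[OF assms(2) that] .
    have "dderiv d x v = ?d' x * v" for v
      using linear_scale[OF has_derivative_linear[OF D], of v 1] by simp
    then show ?thesis
      unfolding has_field_derivative_def by (intro has_derivative_eq_rhs[OF D] ext)
  qed
  have sd': "smooth_on S ?d'" by (rule smooth_on_dderiv) fact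
  have cd: "continuous_on S d" "continuous_on S ?d'"
    using smooth_on_continuous_on assms(2) sd' by blast+
  obtain R0 where R0: "R0 > 0" "ball s0 R0 \<subseteq> S" using assms openE by blast
  define R where "R = R0 / 2"
  let ?C = "{s0 - R..s0 + R}"
  have R: "R > 0" "?C \<subseteq> S" using R0 by (auto simp: R_def dist_real_def subset_eq)
  have "compact (d ` ?C)" "compact (?d' ` ?C)"
    by (rule compact_continuous_image[OF continuous_on_subset[OF _ R(2)]], fact cd, simp)+
  then have "bounded (d ` ?C)" "bounded (?d' ` ?C)" by (auto intro: compact_imp_bounded)
  then obtain M0 L0 where "\<forall>y\<in>d ` ?C. norm y \<le> M0" "\<forall>y\<in>?d' ` ?C. norm y \<le> L0"
    unfolding bounded_iff by blast
  then have bd0: "\<And>x. x \<in> ?C \<Longrightarrow> \<bar>d x\<bar> \<le> M0" "\<And>x. x \<in> ?C \<Longrightarrow> \<bar>?d' x\<bar> \<le> L0"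
    by auto
  define M where "M = max M0 1"
  define L where "L = max L0 1"
  have bds: "\<And>x. x \<in> ?C \<Longrightarrow> \<bar>d x\<bar> \<le> M" "\<And>x. x \<in> ?C \<Longrightarrow> \<bar>?d' x\<bar> \<le> L" "M > 0" "L > 0"
    using bd0 by (auto simp: M_def L_def le_max_iff_disj)
  define cl where "cl x = max (s0 - R) (min x (s0 + R))" for x
  have cl: "cl x \<in> ?C" "\<bar>cl x - cl y\<bar> \<le> \<bar>x - y\<bar>" for x y using R by (auto simp: cl_def)
  have cl_id: "cl x = x" if "x \<in> ?C" for x using that by (auto simp: cl_def)
  define D where "D x = d (cl x)" for x
  have Lip: "\<bar>D x - D y\<bar> \<le> L * \<bar>x - y\<bar>" for x y
  proof -
    have "norm (d (cl x) - d (cl y)) \<le> L * norm (cl x - cl y)"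
    proof (rule field_differentiable_bound[where S = ?C and f' = ?d'])
      show "(d has_field_derivative ?d' z) (at z within ?C)" if "z \<in> ?C" for z
        using d that R has_field_derivative_at_within by blast
    qed (use bds cl in auto)
    also have "\<dots> \<le> L * \<bar>x - y\<bar>" using cl bds by (intro mult_left_mono) auto
    finally show ?thesis by (simp add: D_def)
  qed
  have Mb: "\<bar>D x\<bar> \<le> M" for x using bds cl by (simp add: D_def)
  \<comment> \<open>The first bound makes the Picard operator a contraction, the second keeps curves that start in the
    inner half of the interval away from the region where the field was cut off.\<close>
  define \<epsilon> where "\<epsilon> = min (1 / (2 * L)) (R / (4 * M))"
  have \<epsilon>: "\<epsilon> > 0" using bds R by (simp add: \<epsilon>_def)
  have \<epsilon>L: "\<epsilon> * L \<le> 1 / 2"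
  proof -
    have "\<epsilon> * L \<le> 1 / (2 * L) * L" using bds by (intro mult_right_mono) (auto simp: \<epsilon>_def)
    then show ?thesis using bds by simp
  qed
  have \<epsilon>M: "\<epsilon> * M \<le> R / 4"
  proof -
    have "\<epsilon> * M \<le> R / (4 * M) * M" using bds by (intro mult_right_mono) (auto simp: \<epsilon>_def)
    then show ?thesis using bds by simp
  qed
  obtain T where cT: "continuous_on UNIV T" and Tb: "\<And>\<tau> s. \<bar>T (\<tau>, s) - s\<bar> \<le> \<epsilon> * M"
    and Teq: "\<And>\<tau> s. \<tau> \<in> {-\<epsilon><..<\<epsilon>} \<Longrightarrow> T (\<tau>, s) = s + time_integral (\<lambda>z. D (T z)) (\<tau>, s)"
    using Picard_fixed_point[OF Lip Mb \<epsilon> \<epsilon>L] bds by auto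
  let ?I = "{-\<epsilon><..<\<epsilon>}" and ?B = "{s0-R/2<..<s0+R/2}" and ?J = "{s0-R<..<s0+R}"
  have TJ: "T (\<tau>, s) \<in> ?J" if "s \<in> ?B" for \<tau> s
    using Tb[of \<tau> s] \<epsilon>M that R by (auto simp: abs_le_iff)
  have JS: "?J \<subseteq> S" using R by auto
  have DT: "D (T (\<tau>, s)) = d (T (\<tau>, s))" if "s \<in> ?B" for \<tau> s
    using TJ[OF that, of \<tau>] cl_id by (simp add: D_def)
  have T0: "T (0, s) = s" for s using Teq[of 0 s] \<epsilon> by simp
  have "continuous_on UNIV D"
  proof (rule lipschitz_on_continuous_on)
    show "L-lipschitz_on UNIV D" using Lip bds(4) by (simp add: lipschitz_on_def dist_real_def)
  qed
  then have "continuous_on UNIV (\<lambda>z. D (T z))"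
    by (rule continuous_on_compose2[OF _ cT]) simp
  then have cDT: "continuous_on ?I (\<lambda>\<tau>. D (T (\<tau>, s)))" for s
    by (rule continuous_on_compose2[where f = "\<lambda>\<tau>. (\<tau>, s)"]) (auto intro!: continuous_intros)
  have Tt: "((\<lambda>\<tau>. T (\<tau>, s)) has_real_derivative d (T (\<tau>, s))) (at \<tau>)"
    if "\<tau> \<in> ?I" "s \<in> ?B" for \<tau> s
  proof -
    have "((\<lambda>\<tau>. s + time_integral (\<lambda>z. D (T z)) (\<tau>, s)) has_real_derivative 0 + D (T (\<tau>, s))) (at \<tau>)"
      by (intro DERIV_add DERIV_const time_integral_DERIV[where \<epsilon> = \<epsilon>] cDT that)
    then have "((\<lambda>\<tau>. T (\<tau>, s)) has_real_derivative 0 + D (T (\<tau>, s))) (at \<tau>)"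
      by (rule has_field_derivative_transform_within_open[where S = ?I]) (use that Teq in auto)
    then show ?thesis using DT that by simp
  qed
  have dJ: "(d has_real_derivative ?d' x) (at x)" if "x \<in> ?J" for x using d that JS by blast
  have cd'J: "continuous_on ?J ?d'" using cd JS continuous_on_subset by blast
  let ?e = "\<lambda>\<tau> s s'. exp (time_integral (\<lambda>(\<sigma>, _). mean_slope ?d' (T (\<sigma>, s), T (\<sigma>, s'))) (\<tau>, ()))"
  have diff: "T (\<tau>, s') - T (\<tau>, s) = (s' - s) * ?e \<tau> s s'"
    if "\<tau> \<in> ?I" "s \<in> ?B" "s' \<in> ?B" for \<tau> s s'
    by (rule flow_difference[where B = ?B and d = d]) (use TJ Tt T0 dJ cd'J that in auto)
  have Ts: "((\<lambda>s. T (\<tau>, s)) has_real_derivative exp (time_integral (\<lambda>z. ?d' (T z)) (\<tau>, s))) (at s)"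
    if \<tau>: "\<tau> \<in> ?I" and s: "s \<in> ?B" for \<tau> s
  proof -
    have "continuous_on (?B \<times> cbox 0 1)
        (\<lambda>(s', \<theta>). mean_slope ?d' (T (\<theta> * \<tau>, s), T (\<theta> * \<tau>, s')))"
      unfolding case_prod_beta
      by (intro continuous_on_compose2[OF continuous_on_mean_slope[OF cd'J]]
          continuous_on_compose2[OF cT] continuous_intros) (use TJ s in auto)
    from integral_continuous_on_param[OF this]
    have "continuous_on ?B (?e \<tau> s)"
      by (simp add: time_integral_def) (intro continuous_intros)
    then have "isCont (?e \<tau> s) s"
      using s continuous_on_eq_continuous_at[OF open_greaterThanLessThan] by blast
    then have lim: "(?e \<tau> s) \<midarrow>s\<rightarrow> ?e \<tau> s s" by (simp add: isCont_def)
    have "(\<lambda>s'. (T (\<tau>, s') - T (\<tau>, s)) / (s' - s)) \<midarrow>s\<rightarrow> ?e \<tau> s s"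
      by (rule Lim_transform_within_open[OF lim open_greaterThanLessThan s])
        (use diff \<tau> s in auto)
    then show ?thesis
      by (simp add: has_field_derivative_iff time_integral_def)
  qed
  have "Ck_on k (?I \<times> ?B) T" for k
  proof (induction k)
    case 0
    show ?case using cT continuous_on_subset by auto
  next
    case (Suc k)
    have o: "open (?I \<times> ?B)" by (intro open_Times) auto
    have TS: "T z \<in> S" if "z \<in> ?I \<times> ?B" for z using TJ JS that by (cases z) blast
    show ?case
    proof (rule Ck_on_Suc_partials[where fx = "\<lambda>z v. v * d (T z)"
          and fy = "\<lambda>z v. v * exp (time_integral (\<lambda>z. ?d' (T z)) z)"])
      show "((\<lambda>\<tau>. T (\<tau>, s)) has_derivative (\<lambda>v. v * d (T (\<tau>, s)))) (at \<tau>)"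
        "((\<lambda>s. T (\<tau>, s)) has_derivative
          (\<lambda>v. v * exp (time_integral (\<lambda>z. ?d' (T z)) (\<tau>, s)))) (at s)"
        if "(\<tau>, s) \<in> ?I \<times> ?B" for \<tau> s
        using Tt[of \<tau> s] Ts[of \<tau> s] that by (auto simp: has_field_derivative_def mult_commute_abs)
      have "Ck_on k (?I \<times> ?B) (\<lambda>z. d (T z))" "Ck_on k (?I \<times> ?B) (\<lambda>z. ?d' (T z))"
        using Ck_on_compose[OF smooth_onD[OF assms(2)] Suc] Ck_on_compose[OF smooth_onD[OF sd'] Suc] TS o
        by blast+
      then show "Ck_on k (?I \<times> ?B) (\<lambda>z. v * d (T z))"
        "Ck_on k (?I \<times> ?B) (\<lambda>z. v * exp (time_integral (\<lambda>z. ?d' (T z)) z))" for v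
        using o by (auto intro!: Ck_intros Ck_on_time_integral)
    qed fact
  qed
  then have "smooth_on (?I \<times> ?B) T" by (rule smooth_onI)
  moreover have "T (\<tau>, s) \<in> S" if "s \<in> ?B" for \<tau> s using TJ[OF that] JS by blast
  ultimately show ?thesis
    by (intro that[of \<epsilon> "R / 2" T]) (use \<epsilon> R T0 Tt Ts in simp_all)
qed

section \<open>The determining equations of the shape-preserving vector fields\<close>

definition pt :: "real \<Rightarrow> real \<Rightarrow> real \<Rightarrow> base" where
  "pt t x y = t *\<^sub>R axis 1 1 + x *\<^sub>R axis 2 1 + y *\<^sub>R axis 3 1"

lemma axis3_nth [simp]:
  "(axis 1 c :: base) $ 1 = c" "(axis 1 c :: base) $ 2 = 0" "(axis 1 c :: base) $ 3 = 0"
  "(axis 2 c :: base) $ 1 = 0" "(axis 2 c :: base) $ 2 = c" "(axis 2 c :: base) $ 3 = 0"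
  "(axis 3 c :: base) $ 1 = 0" "(axis 3 c :: base) $ 2 = 0" "(axis 3 c :: base) $ 3 = c"
  by (simp_all add: axis_def)

lemma pt_nth [simp]: "pt t x y $ 1 = t" "pt t x y $ 2 = x" "pt t x y $ 3 = y"
  by (simp_all add: pt_def)

lemma pt_eta [simp]: "pt (p $ 1) (p $ 2) (p $ 3) = p"
  by (simp add: vec_eq_iff forall_3)

lemma Ck_on_pt [Ck_intros]:
  assumes "Ck_on k S f" "Ck_on k S g" "Ck_on k S h" "open S"
  shows "Ck_on k S (\<lambda>z. pt (f z) (g z) (h z))"
  unfolding pt_def using assms by (intro Ck_on_add Ck_on_scaleR Ck_on_const)

lemma partial_eqI:
  assumes "f differentiable (at p)"
    "((\<lambda>s. f (p + s *\<^sub>R axis i 1)) has_real_derivative D) (at 0)"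
  shows "partial i f p = D"
proof -
  have "(f has_derivative dderiv f p) (at (p + 0 *\<^sub>R axis i 1))"
    using frechet_derivative_works[THEN iffD1, OF assms(1)] by simp
  moreover have "((\<lambda>s. p + s *\<^sub>R axis i 1) has_derivative (\<lambda>s. s *\<^sub>R axis i 1)) (at 0)"
    by (auto intro!: derivative_eq_intros)
  ultimately have "((\<lambda>s. f (p + s *\<^sub>R axis i 1)) has_derivative (\<lambda>s. dderiv f p (s *\<^sub>R axis i 1))) (at 0)"
    by (rule has_derivative_compose[rotated])
  then have "((\<lambda>s. f (p + s *\<^sub>R axis i 1)) has_real_derivative partial i f p) (at 0)"
    by (simp add: has_field_derivative_def partial_def dderiv_scale[OF assms(1)] mult_commute_abs)
  then show ?thesis using assms(2) DERIV_unique by blast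
qed

lemma smooth_on_partial: "smooth_on U f \<Longrightarrow> smooth_on U (partial i f)"
  unfolding partial_def[abs_def] by (rule smooth_on_dderiv)

lemma partial_commute:
  "open U \<Longrightarrow> smooth_on U f \<Longrightarrow> p \<in> U \<Longrightarrow> partial i (partial j f) p = partial j (partial i f) p"
  unfolding partial_def[abs_def] by (rule second_derivative_symmetric)

lemma partial_cong:
  "open U \<Longrightarrow> p \<in> U \<Longrightarrow> (\<And>q. q \<in> U \<Longrightarrow> f q = g q) \<Longrightarrow> partial i f p = partial i g p"
  unfolding partial_def using dderiv_cong by metis

lemma partial_const [simp]: "partial i (\<lambda>p. c) p = 0"
  unfolding partial_def by (simp add: dderivI[OF has_derivative_const])

lemma partial_eq_0:
  "open U \<Longrightarrow> p \<in> U \<Longrightarrow> (\<And>q. q \<in> U \<Longrightarrow> f q = c) \<Longrightarrow> partial i f p = 0"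
  using partial_cong[of U p f "\<lambda>_. c"] by simp

lemma partial_diff:
  "f differentiable (at p) \<Longrightarrow> g differentiable (at p) \<Longrightarrow>
    partial i (\<lambda>p. f p - g p) p = partial i f p - partial i g p"
  unfolding partial_def
  by (subst dderivI[OF has_derivative_diff]) (auto simp: frechet_derivative_works)

lemma partial_cmult:
  "f differentiable (at p) \<Longrightarrow> partial i (\<lambda>p. c * f p) p = c * partial i f p"
  unfolding partial_def
  by (subst dderivI[OF has_derivative_mult_right]) (auto simp: frechet_derivative_works)

abbreviation jac :: "(base \<Rightarrow> base) \<Rightarrow> 3 \<Rightarrow> 3 \<Rightarrow> base \<Rightarrow> real" where
  "jac X i k \<equiv> partial i (\<lambda>p. X p $ k)"

lemma base_expand: "(w :: base) = (\<Sum>i\<in>UNIV. w $ i *\<^sub>R axis i 1)"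
  by (simp add: vec_eq_iff forall_3 sum_3)

lemma dderiv_partials:
  assumes "f differentiable (at p)"
  shows "dderiv f p w = (\<Sum>i\<in>UNIV. w $ i * partial i f p)"
proof -
  have "dderiv f p w = dderiv f p (\<Sum>i\<in>UNIV. w $ i *\<^sub>R axis i 1)" using base_expand by metis
  then show ?thesis by (simp add: dderiv_sum[OF assms] dderiv_scale[OF assms] partial_def)
qed

lemma DERIV_pt:
  assumes "smooth_on U f" "pt t x y \<in> U"
  shows "((\<lambda>s. f (pt s x y)) has_real_derivative partial 1 f (pt t x y)) (at t)"
    "((\<lambda>s. f (pt t s y)) has_real_derivative partial 2 f (pt t x y)) (at x)"
    "((\<lambda>s. f (pt t x s)) has_real_derivative partial 3 f (pt t x y)) (at y)"
proof -
  note D = smooth_on_differentiable[OF assms]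
  note d = D[unfolded frechet_derivative_works]
  have "((\<lambda>s. pt s x y) has_derivative (\<lambda>s. s *\<^sub>R axis 1 1)) (at t)"
    "((\<lambda>s. pt t s y) has_derivative (\<lambda>s. s *\<^sub>R axis 2 1)) (at x)"
    "((\<lambda>s. pt t x s) has_derivative (\<lambda>s. s *\<^sub>R axis 3 1)) (at y)"
    unfolding pt_def by (auto intro!: derivative_eq_intros)
  from this[THEN has_derivative_compose, OF d]
  show "((\<lambda>s. f (pt s x y)) has_real_derivative partial 1 f (pt t x y)) (at t)"
    "((\<lambda>s. f (pt t s y)) has_real_derivative partial 2 f (pt t x y)) (at x)"
    "((\<lambda>s. f (pt t x s)) has_real_derivative partial 3 f (pt t x y)) (at y)"
    by (simp_all add: has_field_derivative_def partial_def dderiv_scale[OF D] mult_commute_abs)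
qed

text \<open>Infinitesimal form of the shape-preserving fields \<open>X = T \<partial>\<^sub>t + \<xi> \<partial>\<^sub>x + \<eta> \<partial>\<^sub>y\<close>. On a box these
  equations integrate to the explicit family of \<open>shape_system_normal_form\<close>, but unlike that family they make
  sense on an arbitrary open set.\<close>

definition shape_system :: "base set \<Rightarrow> (base \<Rightarrow> base) \<Rightarrow> bool" where
  "shape_system U X \<longleftrightarrow> smooth_on U X \<and> (\<forall>p\<in>U.
     jac X 2 1 p = 0 \<and> jac X 3 1 p = 0 \<and>
     jac X 2 3 p = 0 \<and>
     jac X 2 2 p = 2 * jac X 3 3 p - jac X 1 1 p \<and>
     partial 3 (jac X 3 3) p = 0 \<and>
     partial 3 (jac X 3 2) p = partial 1 (jac X 2 2) p)"

lemma smooth_on_nth: "smooth_on U X \<Longrightarrow> open U \<Longrightarrow> smooth_on U (\<lambda>p. X p $ i)"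
  unfolding smooth_on_def using Ck_on_nth by blast

text \<open>Differentiating the equations once more: \<open>T\<^sub>t\<close>, \<open>\<xi>\<^sub>x\<close> and \<open>\<eta>\<^sub>y\<close> depend on \<open>t\<close> alone.\<close>

lemma shape_system_consequences:
  assumes S: "shape_system U X" and "open U" "p \<in> U"
  shows "partial 2 (jac X 2 2) p = 0" "partial 3 (jac X 2 2) p = 0"
    "partial i (jac X 2 2) p
      = 2 * partial i (jac X 3 3) p - partial i (jac X 1 1) p"
    "i \<noteq> 1 \<Longrightarrow> partial i (jac X 1 1) p = 0"
    "i \<noteq> 1 \<Longrightarrow> partial i (jac X 3 3) p = 0"
proof -
  have sm: "smooth_on U (\<lambda>p. X p $ j)" for j
    using S assms(2) by (intro smooth_on_nth) (auto simp: shape_system_def)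
  note [simp] = smooth_on_differentiable[OF sm] smooth_on_differentiable[OF smooth_on_partial[OF sm]]
  note eqs = S[unfolded shape_system_def, THEN conjunct2, rule_format]
  have zero: "partial j (partial i f) p = 0 \<and> partial i (partial j f) p = 0"
    if "smooth_on U f" "\<And>q. q \<in> U \<Longrightarrow> partial i f q = 0" for i j f
    using partial_eq_0[OF assms(2,3) that(2), where i = j] partial_commute[OF assms(2) that(1) assms(3), of i j]
    by simp
  have T: "partial i (jac X 1 1) p = 0" if "i \<noteq> 1" for i
    using zero[OF sm[of 1], of 2 1] zero[OF sm[of 1], of 3 1] eqs exhaust_3[of i] that by blast
  then show "i \<noteq> 1 \<Longrightarrow> partial i (jac X 1 1) p = 0" .
  have H: "partial i (jac X 3 3) p = 0" if "i \<noteq> 1" for i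
    using zero[OF sm[of 3], of 2 3] eqs assms(3) exhaust_3[of i] that by blast
  then show "i \<noteq> 1 \<Longrightarrow> partial i (jac X 3 3) p = 0" .
  have "partial i (jac X 2 2) p
      = partial i (\<lambda>p. 2 * jac X 3 3 p - jac X 1 1 p) p" for i
    using eqs by (intro partial_cong[OF assms(2,3)]) blast
  also have "\<dots> i = 2 * partial i (jac X 3 3) p - partial i (jac X 1 1) p" for i
    using assms(3) by (simp add: partial_diff partial_cmult)
  finally have X: "partial i (jac X 2 2) p
      = 2 * partial i (jac X 3 3) p - partial i (jac X 1 1) p" for i .
  then show "partial i (jac X 2 2) p
      = 2 * partial i (jac X 3 3) p - partial i (jac X 1 1) p" .
  show "partial 2 (jac X 2 2) p = 0" "partial 3 (jac X 2 2) p = 0"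
    using X[of 2] X[of 3] T[of 2] T[of 3] H[of 2] H[of 3] by auto
qed

subsection \<open>The normal form on a box\<close>

lemma coordinate_box:
  assumes "open U" "p0 \<in> U"
  obtains r where "r > 0" "\<And>p. (\<forall>i. p $ i \<in> {p0 $ i - r<..<p0 $ i + r}) \<Longrightarrow> (p :: base) \<in> U"
proof -
  obtain e where e: "e > 0" "ball p0 e \<subseteq> U" using assms openE by blast
  show ?thesis
  proof (rule that[of "e / 3"])
    fix p :: base assume p: "\<forall>i. p $ i \<in> {p0 $ i - e / 3<..<p0 $ i + e / 3}"
    have i: "\<bar>(p - p0) $ i\<bar> < e / 3" for i
      using spec[OF p, of i] unfolding abs_less_iff greaterThanLessThan_iff vector_minus_component
      by linarith
    have "norm (p - p0) \<le> (\<Sum>i\<in>UNIV. \<bar>(p - p0) $ i\<bar>)" by (rule norm_le_l1_cart)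
    also have "\<dots> < e / 3 + e / 3 + e / 3"
      unfolding sum_3 by (intro add_strict_mono i)
    finally show "p \<in> U" using e by (auto simp: dist_norm norm_minus_commute)
  qed (use e in auto)
qed

lemma DERIV_0_interval:
  fixes f :: "real \<Rightarrow> real"
  assumes "\<And>x. x \<in> {a<..<b} \<Longrightarrow> (f has_real_derivative 0) (at x)" "x \<in> {a<..<b}" "y \<in> {a<..<b}"
  shows "f x = f y"
  using has_field_derivative_zero_constant[of "{a<..<b}" f] assms
  by (metis (no_types, lifting) has_field_derivative_at_within convex_real_interval(8))

text \<open>Since \<open>T\<close>, \<open>e = \<xi>\<^sub>x\<close> and \<open>\<eta>\<^sub>y = (T\<^sub>t + \<xi>\<^sub>x) / 2\<close> depend on \<open>t\<close> alone, \<open>\<eta>\<close> is affine in \<open>y\<close>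
  and \<open>\<xi>\<close> is affine in \<open>x\<close>; and \<open>\<xi>\<^sub>y\<^sub>y = e'\<close> makes \<open>\<xi>\<close> quadratic in \<open>y\<close>. Expanding around the given point
  instead of the origin makes every coefficient the value of a derivative of \<open>X\<close> on the line through that
  point in direction \<open>t\<close>.\<close>

lemma shape_system_normal_form:
  assumes S: "shape_system U X" and U: "open U" and p0: "p0 \<in> U"
  obtains r a b c d e e' where "r > 0"
    "\<And>p. (\<forall>i. p $ i \<in> {p0 $ i - r<..<p0 $ i + r}) \<Longrightarrow> p \<in> U"
    "\<And>f. f \<in> {a, b, c, d, e, e'} \<Longrightarrow> smooth_on {p0 $ 1 - r<..<p0 $ 1 + r} f"
    "\<And>t. t \<in> {p0 $ 1 - r<..<p0 $ 1 + r} \<Longrightarrow> (e has_real_derivative e' t) (at t)"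
    "\<And>p. (\<forall>i. p $ i \<in> {p0 $ i - r<..<p0 $ i + r}) \<Longrightarrow> X p = pt (d (p $ 1))
      (a (p $ 1) + (p $ 3 - p0 $ 3) * c (p $ 1) + (p $ 2 - p0 $ 2) * e (p $ 1)
        + (p $ 3 - p0 $ 3)\<^sup>2 * e' (p $ 1) / 2)
      (b (p $ 1) + (p $ 3 - p0 $ 3) * (dderiv d (p $ 1) 1 + e (p $ 1)) / 2)"
proof -
  obtain r where r: "r > 0" "\<And>p. (\<forall>i. p $ i \<in> {p0 $ i - r<..<p0 $ i + r}) \<Longrightarrow> p \<in> U"
    using coordinate_box[OF U p0] by blast
  define It Ix Iy where I: "It = {p0 $ 1 - r<..<p0 $ 1 + r}" "Ix = {p0 $ 2 - r<..<p0 $ 2 + r}"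
    "Iy = {p0 $ 3 - r<..<p0 $ 3 + r}"
  let ?x = "p0 $ 2" and ?y = "p0 $ 3"
  have inU: "pt t x y \<in> U" if "t \<in> It" "x \<in> Ix" "y \<in> Iy" for t x y
    using that r(2)[of "pt t x y"] by (simp add: forall_3 I)
  have xy: "?x \<in> Ix" "?y \<in> Iy" using r by (auto simp: I)
  have sm: "smooth_on U (\<lambda>p. X p $ j)" for j
    using S U by (intro smooth_on_nth) (auto simp: shape_system_def)
  note sm1 = smooth_on_partial[OF sm]
  note eqs = S[unfolded shape_system_def, THEN conjunct2, rule_format]
  note con = shape_system_consequences[OF S U]
  define d where "d t = X (pt t ?x ?y) $ 1" for t
  define a where "a t = X (pt t ?x ?y) $ 2" for t
  define b where "b t = X (pt t ?x ?y) $ 3" for t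
  define c where "c t = jac X 3 2 (pt t ?x ?y)" for t
  define e where "e t = jac X 2 2 (pt t ?x ?y)" for t
  define e' where "e' t = partial 1 (jac X 2 2) (pt t ?x ?y)" for t
  have indep: "f (pt t x y) = f (pt t ?x ?y)"
    if f: "smooth_on U f" "\<And>p. p \<in> U \<Longrightarrow> partial 2 f p = 0" "\<And>p. p \<in> U \<Longrightarrow> partial 3 f p = 0"
      and t: "t \<in> It" "x \<in> Ix" "y \<in> Iy" for f t x y
  proof -
    have "f (pt t x y) = f (pt t ?x y)"
      by (rule DERIV_0_interval[of "?x - r" "?x + r" "\<lambda>x. f (pt t x y)"])
        (use DERIV_pt(2)[OF f(1)] f(2) inU t xy in \<open>auto simp flip: I\<close>)
    also have "\<dots> = f (pt t ?x ?y)"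
      by (rule DERIV_0_interval[of "?y - r" "?y + r" "\<lambda>y. f (pt t ?x y)"])
        (use DERIV_pt(3)[OF f(1)] f(3) inU t xy in \<open>auto simp flip: I\<close>)
    finally show ?thesis .
  qed
  have X1: "X (pt t x y) $ 1 = d t" if "t \<in> It" "x \<in> Ix" "y \<in> Iy" for t x y
    using indep[OF sm, of 1] eqs that by (simp add: d_def)
  have e: "jac X 2 2 (pt t x y) = e t" if "t \<in> It" "x \<in> Ix" "y \<in> Iy" for t x y
    using indep[OF sm1, of 2 2] con(1,2) that by (simp add: e_def)
  have Dd: "(d has_real_derivative jac X 1 1 (pt t ?x ?y)) (at t)"
    and De: "(e has_real_derivative e' t) (at t)" if "t \<in> It" for t
    using DERIV_pt(1)[OF sm, of t ?x ?y 1] DERIV_pt(1)[OF sm1, of t ?x ?y 2 2] inU[OF that xy]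
    by (simp_all add: d_def[abs_def] e_def[abs_def] e'_def)
  have dd: "dderiv d t 1 = jac X 1 1 (pt t ?x ?y)" if "t \<in> It" for t
    using dderivI[OF Dd[OF that, unfolded has_field_derivative_def]] by simp
  have X3y: "jac X 3 3 (pt t x y) = (dderiv d t 1 + e t) / 2"
    if "t \<in> It" "x \<in> Ix" "y \<in> Iy" for t x y
    using eqs[OF inU[OF that]] e[OF that] dd[OF that(1)]
      indep[OF sm1, of 1 1] con(4) that by simp
  have X3: "X (pt t x y) $ 3 = b t + (y - ?y) * (dderiv d t 1 + e t) / 2"
    if t: "t \<in> It" "x \<in> Ix" "y \<in> Iy" for t x y
  proof -
    let ?h = "\<lambda>s. X (pt t ?x s) $ 3 - (s - ?y) * ((dderiv d t 1 + e t) / 2)"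
    have "X (pt t x y) $ 3 = X (pt t ?x y) $ 3"
      by (rule DERIV_0_interval[of "?x - r" "?x + r" "\<lambda>x. X (pt t x y) $ 3"])
        (use DERIV_pt(2)[OF sm[of 3]] eqs inU t xy in \<open>auto simp flip: I\<close>)
    moreover have "?h y = ?h ?y"
    proof (rule DERIV_0_interval[of "?y - r" "?y + r" ?h])
      fix s assume "s \<in> {?y - r<..<?y + r}"
      then have s: "s \<in> Iy" by (simp add: I)
      show "(?h has_real_derivative 0) (at s)"
        using DERIV_pt(3)[OF sm[of 3] inU[OF t(1) xy(1) s]] X3y[OF t(1) xy(1) s]
        by (auto intro!: derivative_eq_intros)
    qed (use t xy in \<open>auto simp flip: I\<close>)
    ultimately show ?thesis by (simp add: b_def)
  qed
  have X2: "X (pt t x y) $ 2 = a t + (y - ?y) * c t + (x - ?x) * e t + (y - ?y)\<^sup>2 * e' t / 2"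
    if t: "t \<in> It" "x \<in> Ix" "y \<in> Iy" for t x y
  proof -
    let ?f = "\<lambda>s. X (pt t s y) $ 2 - (s - ?x) * e t"
    let ?g = "\<lambda>s. jac X 3 2 (pt t ?x s) - (s - ?y) * e' t"
    let ?h = "\<lambda>s. X (pt t ?x s) $ 2 - (s - ?y) * c t - (s - ?y)\<^sup>2 * e' t / 2"
    have "?f x = ?f ?x"
    proof (rule DERIV_0_interval[of "?x - r" "?x + r" ?f])
      fix s assume "s \<in> {?x - r<..<?x + r}"
      then have s: "s \<in> Ix" by (simp add: I)
      show "(?f has_real_derivative 0) (at s)"
        using DERIV_pt(2)[OF sm[of 2] inU[OF t(1) s t(3)]] e[OF t(1) s t(3)]
        by (auto intro!: derivative_eq_intros)
    qed (use t xy in \<open>auto simp flip: I\<close>)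
    moreover have g: "jac X 3 2 (pt t ?x z) = c t + (z - ?y) * e' t" if z: "z \<in> Iy" for z
    proof -
      have "?g z = ?g ?y"
      proof (rule DERIV_0_interval[of "?y - r" "?y + r" ?g])
        fix s assume "s \<in> {?y - r<..<?y + r}"
        then have s: "s \<in> Iy" by (simp add: I)
        have "((\<lambda>t. jac X 2 2 (pt t ?x s)) has_real_derivative
            partial 1 (jac X 2 2) (pt t ?x s)) (at t)"
          by (rule DERIV_pt(1)[OF sm1 inU[OF t(1) xy(1) s]])
        then have "(e has_real_derivative partial 1 (jac X 2 2) (pt t ?x s)) (at t)"
          by (rule has_field_derivative_transform_within_open[where S = It])
            (use e xy s t in \<open>auto simp: I\<close>)
        then have "partial 1 (jac X 2 2) (pt t ?x s) = e' t"
          using De[OF t(1)] DERIV_unique by blast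
        then show "(?g has_real_derivative 0) (at s)"
          using DERIV_pt(3)[OF sm1[of 3 2] inU[OF t(1) xy(1) s]] eqs[OF inU[OF t(1) xy(1) s]]
          by (auto intro!: derivative_eq_intros)
      qed (use z xy in \<open>auto simp flip: I\<close>)
      then show ?thesis by (simp add: c_def)
    qed
    moreover have "?h y = ?h ?y"
    proof (rule DERIV_0_interval[of "?y - r" "?y + r" ?h])
      fix s assume "s \<in> {?y - r<..<?y + r}"
      then have s: "s \<in> Iy" by (simp add: I)
      show "(?h has_real_derivative 0) (at s)"
        using DERIV_pt(3)[OF sm[of 2] inU[OF t(1) xy(1) s]] g[OF s]
        by (auto intro!: derivative_eq_intros)
    qed (use t xy in \<open>auto simp flip: I\<close>)
    ultimately show ?thesis by (simp add: a_def)
  qed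
  have smI: "smooth_on It (\<lambda>t. f (pt t ?x ?y))" if "smooth_on U f" for f :: "base \<Rightarrow> real"
    by (rule smooth_on_compose[OF that])
      (use inU xy in \<open>auto simp: I intro!: smooth_onI Ck_intros\<close>)
  have sms: "smooth_on It a" "smooth_on It b" "smooth_on It c" "smooth_on It d" "smooth_on It e" "smooth_on It e'"
    unfolding a_def[abs_def] b_def[abs_def] c_def[abs_def] d_def[abs_def] e_def[abs_def] e'_def[abs_def]
    by (intro smI sm sm1 smooth_on_partial)+
  show ?thesis
  proof (rule that[OF r, of a b c d e e'])
    fix p :: base assume "\<forall>i. p $ i \<in> {p0 $ i - r<..<p0 $ i + r}"
    then have p: "p $ 1 \<in> It" "p $ 2 \<in> Ix" "p $ 3 \<in> Iy" by (auto simp: I)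
    show "X p = pt (d (p $ 1))
      (a (p $ 1) + (p $ 3 - p0 $ 3) * c (p $ 1) + (p $ 2 - p0 $ 2) * e (p $ 1)
        + (p $ 3 - p0 $ 3)\<^sup>2 * e' (p $ 1) / 2)
      (b (p $ 1) + (p $ 3 - p0 $ 3) * (dderiv d (p $ 1) 1 + e (p $ 1)) / 2)"
      using X1[OF p] X2[OF p] X3[OF p] by (simp add: vec_eq_iff forall_3)
  next
    show "smooth_on {p0 $ 1 - r<..<p0 $ 1 + r} f" if "f \<in> {a, b, c, d, e, e'}" for f
      using that sms by (auto simp: I)
  qed (use De in \<open>auto simp: I\<close>)
qed

section \<open>Integrating the determining equations to a flow\<close>

lemma time_integral_DERIV_parameter:
  fixes f :: "real \<times> real \<Rightarrow> real"
  assumes f: "\<And>\<sigma> t. \<sigma> \<in> {-\<epsilon><..<\<epsilon>} \<Longrightarrow> t \<in> {a<..<b} \<Longrightarrow>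
      ((\<lambda>t. f (\<sigma>, t)) has_real_derivative f' (\<sigma>, t)) (at t)"
    and cf: "continuous_on ({-\<epsilon><..<\<epsilon>} \<times> {a<..<b}) f"
    and cf': "continuous_on ({-\<epsilon><..<\<epsilon>} \<times> {a<..<b}) f'"
    and \<tau>: "\<tau> \<in> {-\<epsilon><..<\<epsilon>}" and t: "t \<in> {a<..<b}"
  shows "((\<lambda>t. time_integral f (\<tau>, t)) has_real_derivative time_integral f' (\<tau>, t)) (at t)"
proof -
  have "((\<lambda>t. integral (cbox 0 1) (\<lambda>s. f (s * \<tau>, t))) has_real_derivative
      integral (cbox 0 1) (\<lambda>s. f' (s * \<tau>, t))) (at t within {a<..<b})"
  proof (rule leibniz_rule_field_derivative)
    fix t s assume ts: "t \<in> {a<..<b}" "s \<in> cbox (0::real) 1"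
    then show "((\<lambda>t. f (s * \<tau>, t)) has_real_derivative f' (s * \<tau>, t)) (at t within {a<..<b})"
      using f scaled_time_in_interval[OF \<tau>] has_field_derivative_at_within
      by (metis box_real(2))
  next
    fix t assume "t \<in> {a<..<b}"
    then have "continuous_on (cbox 0 1) (\<lambda>s. f (s * \<tau>, t))"
      by (intro continuous_on_compose2[OF cf, where f = "\<lambda>s. (s * \<tau>, t)"] continuous_intros)
        (use scaled_time_in_interval[OF \<tau>] in auto)
    then show "(\<lambda>s. f (s * \<tau>, t)) integrable_on cbox 0 1" by (rule integrable_continuous)
  next
    show "continuous_on ({a<..<b} \<times> cbox 0 1) (\<lambda>(t, s). f' (s * \<tau>, t))"
      unfolding case_prod_beta
      by (intro continuous_on_compose2[OF cf', where f = "\<lambda>z. (snd z * \<tau>, fst z)"] continuous_intros)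
        (use scaled_time_in_interval[OF \<tau>] in auto)
  qed (use t in auto)
  then have "((\<lambda>t. integral {0..1} (\<lambda>s. f (s * \<tau>, t))) has_real_derivative
      integral {0..1} (\<lambda>s. f' (s * \<tau>, t))) (at t)"
    using at_within_open[OF t open_greaterThanLessThan] by simp
  then show ?thesis by (simp add: time_integral_def DERIV_cmult)
qed

lemma DERIV_snd_dderiv:
  fixes g :: "real \<times> real \<Rightarrow> real"
  assumes "g differentiable (at (\<tau>, t))"
  shows "((\<lambda>t. g (\<tau>, t)) has_real_derivative dderiv g (\<tau>, t) (0, 1)) (at t)"
proof -
  have d: "(g has_derivative dderiv g (\<tau>, t)) (at (\<tau>, t))"
    using assms frechet_derivative_works by blast
  have "((\<lambda>t. (\<tau>, t)) has_derivative (\<lambda>s. (0, s))) (at t)"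
    by (auto intro!: derivative_eq_intros)
  from has_derivative_compose[OF this d]
  have "((\<lambda>t. g (\<tau>, t)) has_derivative (\<lambda>s. dderiv g (\<tau>, t) (0, s))) (at t)" .
  moreover have "dderiv g (\<tau>, t) (0, s) = dderiv g (\<tau>, t) (0, 1) * s" for s
    using dderiv_scale[OF assms, of s "(0, 1)"] by simp
  ultimately show ?thesis
    unfolding has_field_derivative_def by (metis (no_types, lifting) has_derivative_eq_rhs ext)
qed

subsection \<open>Pulling back along maps of the pseudogroup\<close>

text \<open>For a map \<open>(t, x, y) \<mapsto> (T, \<Xi>, H)\<close> of the pseudogroup, \<open>m = \<Xi>\<^sub>x\<close>, \<open>K = H\<^sub>y\<close>, and \<open>\<xi>\<close>, \<open>j / 2\<close>, \<open>h\<close> stand for the quotients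
  \<open>\<Xi>\<^sub>t / \<Xi>\<^sub>x\<close>, \<open>\<Xi>\<^sub>y / \<Xi>\<^sub>x\<close>, \<open>H\<^sub>t / H\<^sub>y\<close>. The two hypotheses express \<open>T\<^sub>t \<Xi>\<^sub>x = H\<^sub>y\<^sup>2\<close> through \<open>\<rho> = K / m\<close>, which
  makes everything polynomial; under this relation the coefficients of \<open>dt dx\<close> and \<open>dy\<^sup>2\<close> scale by the
  same factor \<open>K\<^sup>2\<close>.\<close>

lemma g_form_pullback:
  assumes "K = \<rho> * m" "T = \<rho>\<^sup>2 * m"
  shows "g_form u v (pt (T * a $ 1) (m * (\<xi> * a $ 1 + a $ 2 + j / 2 * a $ 3)) (K * (h * a $ 1 + a $ 3)))
      (pt (T * b $ 1) (m * (\<xi> * b $ 1 + b $ 2 + j / 2 * b $ 3)) (K * (h * b $ 1 + b $ 3)))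
    = K\<^sup>2 * g_form (j + (\<rho> * u - h)) (\<rho>\<^sup>2 * v - \<xi> - j\<^sup>2 / 4 - j * (\<rho> * u - h) / 2) a b"
  unfolding g_form_def sym_prod_def assms by (simp add: power2_eq_square field_simps)

lemma has_derivative_pt:
  assumes "(f has_derivative f') F" "(g has_derivative g') F" "(h has_derivative h') F"
  shows "((\<lambda>z. pt (f z) (g z) (h z)) has_derivative (\<lambda>w. pt (f' w) (g' w) (h' w))) F"
  unfolding pt_def
  by (intro has_derivative_add has_derivative_scaleR_left assms)

lemma has_vector_derivative_pt:
  assumes "(f has_real_derivative f') (at s)" "(g has_real_derivative g') (at s)"
    "(h has_real_derivative h') (at s)"
  shows "((\<lambda>s. pt (f s) (g s) (h s)) has_vector_derivative pt f' g' h') (at s)"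
proof -
  have "((\<lambda>s. pt (f s) (g s) (h s)) has_derivative (\<lambda>w. pt (f' * w) (g' * w) (h' * w))) (at s)"
    by (rule has_derivative_pt) (use assms in \<open>simp_all add: has_field_derivative_def\<close>)
  moreover have "pt (f' * w) (g' * w) (h' * w) = w *\<^sub>R pt f' g' h'" for w
    by (simp add: vec_eq_iff forall_3)
  ultimately show ?thesis by (simp add: has_vector_derivative_def)
qed

lemma has_derivative_dt:
  assumes "(g has_real_derivative g') (at (q $ 1))"
  shows "((\<lambda>p :: base. g (p $ 1)) has_derivative (\<lambda>w. w $ 1 * g')) (at q)"
  by (rule DERIV_compose_FDERIV[where g = "\<lambda>p. p $ 1", OF assms])
    (rule bounded_linear.has_derivative[OF bounded_linear_vec_nth has_derivative_ident])

text \<open>The maps of the pseudogroup are affine in \<open>x\<close>, and \<open>e\<^sup>\<mu>\<close>, \<open>e\<^sup>\<kappa>\<close> are \<open>\<Xi>\<^sub>x\<close> and \<open>H\<^sub>y\<close>. The first hypothesis on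
  derivatives is \<open>T\<^sub>t \<Xi>\<^sub>x = H\<^sub>y\<^sup>2\<close>, the second is \<open>\<Xi>\<^sub>t\<^sub>x = \<Xi>\<^sub>y\<^sub>y\<close>. The first one governs the metric, and the second
  one cancels the terms that \<open>2 u\<^sub>y\<close> and \<open>4 v\<^sub>x\<close> contribute to the \<open>dt\<close>-component of \<open>\<omega>\<close> beyond the differential
  of the conformal factor.\<close>

lemma pseudogroup_pullback:
  fixes T \<mu> \<kappa> \<beta> Ia Ib Ic \<kappa>' \<beta>' Ia' Ib' Ic' :: "real \<Rightarrow> real" and u v u' v' f :: "base \<Rightarrow> real"
  assumes N: "open N" "q \<in> N"
    and D: "(T has_real_derivative exp (2 * \<kappa> (q $ 1) - \<mu> (q $ 1))) (at (q $ 1))"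
      "(\<mu> has_real_derivative 2 * Ic (q $ 1)) (at (q $ 1))"
      "(\<kappa> has_real_derivative \<kappa>' (q $ 1)) (at (q $ 1))"
      "(\<beta> has_real_derivative \<beta>' (q $ 1)) (at (q $ 1))"
      "(Ia has_real_derivative Ia' (q $ 1)) (at (q $ 1))"
      "(Ib has_real_derivative Ib' (q $ 1)) (at (q $ 1))"
      "(Ic has_real_derivative Ic' (q $ 1)) (at (q $ 1))"
    and \<phi>: "\<And>p. p \<in> N \<Longrightarrow> \<phi> p = pt (T (p $ 1))
      (xo + exp (\<mu> (p $ 1)) * ((p $ 2 - xo) + Ia (p $ 1) + (p $ 3 - yo) * Ib (p $ 1) + (p $ 3 - yo)\<^sup>2 * Ic (p $ 1)))
      (yo + exp (\<kappa> (p $ 1)) * ((p $ 3 - yo) + \<beta> (p $ 1)))"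
    and j: "\<And>p. p \<in> N \<Longrightarrow> j p = 2 * (Ib (p $ 1) + 2 * (p $ 3 - yo) * Ic (p $ 1))"
    and h: "\<And>p. p \<in> N \<Longrightarrow> h p = \<kappa>' (p $ 1) * ((p $ 3 - yo) + \<beta> (p $ 1)) + \<beta>' (p $ 1)"
    and \<xi>: "\<And>p. p \<in> N \<Longrightarrow> \<xi> p = 2 * Ic (p $ 1) * ((p $ 2 - xo) + Ia (p $ 1)
        + (p $ 3 - yo) * Ib (p $ 1) + (p $ 3 - yo)\<^sup>2 * Ic (p $ 1))
      + (Ia' (p $ 1) + (p $ 3 - yo) * Ib' (p $ 1) + (p $ 3 - yo)\<^sup>2 * Ic' (p $ 1))"
    and u': "\<And>p. p \<in> N \<Longrightarrow> u' p = j p + (exp (\<kappa> (p $ 1) - \<mu> (p $ 1)) * u (\<phi> p) - h p)"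
    and v': "\<And>p. p \<in> N \<Longrightarrow> v' p = (exp (\<kappa> (p $ 1) - \<mu> (p $ 1)))\<^sup>2 * v (\<phi> p) - \<xi> p - (j p)\<^sup>2 / 4
      - j p * (exp (\<kappa> (p $ 1) - \<mu> (p $ 1)) * u (\<phi> p) - h p) / 2"
    and f: "\<And>p. p \<in> N \<Longrightarrow> f p = exp (2 * \<kappa> (p $ 1))"
    and diff: "u differentiable (at (\<phi> q))" "v differentiable (at (\<phi> q))"
      "u' differentiable (at q)" "v' differentiable (at q)"
  shows "pullback2 \<phi> (metric u v) q a b = f q * metric u' v' q a b"
    "pullback1 \<phi> (weyl_form u v) q a
      = weyl_form u' v' q a + frechet_derivative (\<lambda>q'. ln (f q')) (at q) a"
proof -
  let ?t = "q $ 1" and ?Y = "q $ 3 - yo"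
  define K m \<rho> where Km: "K = exp (\<kappa> ?t)" "m = exp (\<mu> ?t)" "\<rho> = exp (\<kappa> ?t - \<mu> ?t)"
  define L where "L w = pt (\<rho>\<^sup>2 * m * w $ 1) (m * (\<xi> q * w $ 1 + w $ 2 + j q / 2 * w $ 3))
    (K * (h q * w $ 1 + w $ 3))" for w :: base
  have K: "K = \<rho> * m" unfolding Km by (simp add: exp_diff)
  have Tm: "exp (2 * \<kappa> ?t - \<mu> ?t) = \<rho>\<^sup>2 * m"
    unfolding Km power2_eq_square by (simp flip: exp_add)
  have coord: "((\<lambda>p :: base. p $ i - c) has_derivative (\<lambda>w. w $ i)) (at q)" for i c
    using has_derivative_diff[OF bounded_linear.has_derivative[OF bounded_linear_vec_nth has_derivative_ident]
        has_derivative_const[of c]] by simp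
  note Dq = D[THEN has_derivative_dt]
  have j2: "j q / 2 = Ib ?t + 2 * ?Y * Ic ?t" by (simp add: j[OF N(2)])
  have "((\<lambda>p :: base. pt (T (p $ 1))
      (xo + exp (\<mu> (p $ 1)) * ((p $ 2 - xo) + Ia (p $ 1) + (p $ 3 - yo) * Ib (p $ 1) + (p $ 3 - yo)\<^sup>2 * Ic (p $ 1)))
      (yo + exp (\<kappa> (p $ 1)) * ((p $ 3 - yo) + \<beta> (p $ 1)))) has_derivative L) (at q)"
    unfolding L_def Tm[symmetric]
    apply (rule has_derivative_pt)
      apply (rule has_derivative_eq_rhs, rule Dq(1), simp add: mult.commute)
     apply (rule has_derivative_eq_rhs, (rule coord Dq refl derivative_eq_intros)+)
     apply (rule ext, simp add: Km \<xi>[OF N(2)] j2 algebra_simps power2_eq_square)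
    apply (rule has_derivative_eq_rhs, (rule coord Dq refl derivative_eq_intros)+)
    apply (rule ext, simp add: Km h[OF N(2)] algebra_simps)
    done
  then have \<phi>L: "(\<phi> has_derivative L) (at q)"
    by (rule has_derivative_transform_within_open[OF _ N]) (simp add: \<phi>)
  note dL = dderivI[OF \<phi>L]
  show "pullback2 \<phi> (metric u v) q a b = f q * metric u' v' q a b"
    unfolding pullback2_def metric_def dL L_def g_form_pullback[OF K refl] u'[OF N(2)] v'[OF N(2)] f[OF N(2)]
    by (simp add: Km exp_double)
  have comp: "((\<lambda>s. g (\<phi> (q + s *\<^sub>R axis i 1))) has_real_derivative (\<Sum>k\<in>UNIV. L (axis i 1) $ k * partial k g (\<phi> q))) (at 0)"
    if "g differentiable (at (\<phi> q))" for g i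
  proof -
    have "((\<lambda>s. q + s *\<^sub>R axis i 1) has_derivative (\<lambda>s. s *\<^sub>R axis i 1)) (at 0)"
      by (auto intro!: derivative_eq_intros)
    from has_derivative_compose[OF this, of \<phi> L]
    have "((\<lambda>s. \<phi> (q + s *\<^sub>R axis i 1)) has_derivative (\<lambda>s. L (s *\<^sub>R axis i 1))) (at 0)"
      using \<phi>L by simp
    from has_derivative_compose[OF this, of g "dderiv g (\<phi> q)"]
    have "((\<lambda>s. g (\<phi> (q + s *\<^sub>R axis i 1))) has_derivative (\<lambda>s. dderiv g (\<phi> q) (L (s *\<^sub>R axis i 1)))) (at 0)"
      using frechet_derivative_works[THEN iffD1, OF that] by simp
    moreover have "dderiv g (\<phi> q) (L (s *\<^sub>R axis i 1))
        = (\<Sum>k\<in>UNIV. L (axis i 1) $ k * partial k g (\<phi> q)) * s" for s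
    proof -
      have "L (s *\<^sub>R axis i 1) = s *\<^sub>R L (axis i 1)"
        using linear_scale[OF has_derivative_linear[OF \<phi>L]] by blast
      then show ?thesis by (simp add: dderiv_partials[OF that] sum_distrib_right sum_distrib_left mult_ac)
    qed
    ultimately show ?thesis
      unfolding has_field_derivative_def by (metis (no_types, lifting) has_derivative_eq_rhs ext)
  qed
  have near: "\<exists>\<delta>>0. \<forall>s. \<bar>s\<bar> < \<delta> \<longrightarrow> q + s *\<^sub>R axis i 1 \<in> N" for i
  proof -
    obtain \<delta> where "\<delta> > 0" "ball q \<delta> \<subseteq> N" using N openE by blast
    then show ?thesis by (intro exI[of _ \<delta>]) (auto simp: dist_norm subset_eq norm_axis_1)
  qed
  have transf: "partial i F q = D" if F: "F differentiable (at q)"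
    and G: "\<And>s. q + s *\<^sub>R axis i 1 \<in> N \<Longrightarrow> F (q + s *\<^sub>R axis i 1) = G s"
    and DG: "(G has_real_derivative D) (at 0)" for F G D i
  proof (rule partial_eqI[OF F])
    obtain \<delta> where "\<delta> > 0" "\<And>s. \<bar>s\<bar> < \<delta> \<Longrightarrow> q + s *\<^sub>R axis i 1 \<in> N" using near by blast
    then show "((\<lambda>s. F (q + s *\<^sub>R axis i 1)) has_real_derivative D) (at 0)"
      by (intro has_field_derivative_transform_within_open[OF DG, of "{-\<delta><..<\<delta>}"]) (auto simp: G)
  qed
  let ?ux = "partial 2 u (\<phi> q)" and ?uy = "partial 3 u (\<phi> q)" and ?vx = "partial 2 v (\<phi> q)"
  have u2: "((\<lambda>s. u (\<phi> (q + s *\<^sub>R axis 2 1))) has_real_derivative m * ?ux) (at 0)"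
    and v2: "((\<lambda>s. v (\<phi> (q + s *\<^sub>R axis 2 1))) has_real_derivative m * ?vx) (at 0)"
    and u3: "((\<lambda>s. u (\<phi> (q + s *\<^sub>R axis 3 1))) has_real_derivative m * (j q / 2) * ?ux + K * ?uy) (at 0)"
    using comp[OF diff(1), of 2] comp[OF diff(2), of 2] comp[OF diff(1), of 3]
    by (simp_all add: L_def sum_3)
  have u'2: "partial 2 u' q = K * ?ux"
  proof (rule transf[OF diff(3)])
    show "u' (q + s *\<^sub>R axis 2 1) = j q + (\<rho> * u (\<phi> (q + s *\<^sub>R axis 2 1)) - h q)"
      if "q + s *\<^sub>R axis 2 1 \<in> N" for s
      using u'[OF that] j[OF that] h[OF that] j[OF N(2)] h[OF N(2)] by (simp add: Km)
    show "((\<lambda>s. j q + (\<rho> * u (\<phi> (q + s *\<^sub>R axis 2 1)) - h q)) has_real_derivative K * ?ux) (at 0)"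
      unfolding K by (rule derivative_eq_intros refl u2)+ simp
  qed
  have u'3: "partial 3 u' q = 2 * (2 * Ic ?t) + \<rho> * (?ux * (m * (j q / 2)) + ?uy * K) - \<kappa>' ?t"
  proof (rule transf[OF diff(3)])
    show "u' (q + s *\<^sub>R axis 3 1) = (j q + s * (4 * Ic ?t)) + (\<rho> * u (\<phi> (q + s *\<^sub>R axis 3 1)) - (h q + s * \<kappa>' ?t))"
      if "q + s *\<^sub>R axis 3 1 \<in> N" for s
      using u'[OF that] j[OF that] h[OF that] j[OF N(2)] h[OF N(2)] by (simp add: Km algebra_simps)
    show "((\<lambda>s. (j q + s * (4 * Ic ?t)) + (\<rho> * u (\<phi> (q + s *\<^sub>R axis 3 1)) - (h q + s * \<kappa>' ?t)))
        has_real_derivative 2 * (2 * Ic ?t) + \<rho> * (?ux * (m * (j q / 2)) + ?uy * K) - \<kappa>' ?t) (at 0)"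
      by (rule derivative_eq_intros refl u3)+ simp
  qed
  have v'2: "partial 2 v' q = \<rho>\<^sup>2 * (?vx * m) - 2 * Ic ?t - j q * (\<rho> * (?ux * m)) / 2"
  proof (rule transf[OF diff(4)])
    show "v' (q + s *\<^sub>R axis 2 1) = \<rho>\<^sup>2 * v (\<phi> (q + s *\<^sub>R axis 2 1)) - (\<xi> q + s * (2 * Ic ?t)) - (j q)\<^sup>2 / 4
        - j q * (\<rho> * u (\<phi> (q + s *\<^sub>R axis 2 1)) - h q) / 2"
      if "q + s *\<^sub>R axis 2 1 \<in> N" for s
    proof -
      have "j (q + s *\<^sub>R axis 2 1) = j q" "h (q + s *\<^sub>R axis 2 1) = h q"
        by (simp_all add: j[OF that] h[OF that] j[OF N(2)] h[OF N(2)])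
      moreover have "\<xi> (q + s *\<^sub>R axis 2 1) = \<xi> q + s * (2 * Ic ?t)"
        by (simp add: \<xi>[OF that] \<xi>[OF N(2)] algebra_simps)
      ultimately show ?thesis by (simp add: v'[OF that] Km)
    qed
    show "((\<lambda>s. \<rho>\<^sup>2 * v (\<phi> (q + s *\<^sub>R axis 2 1)) - (\<xi> q + s * (2 * Ic ?t)) - (j q)\<^sup>2 / 4
        - j q * (\<rho> * u (\<phi> (q + s *\<^sub>R axis 2 1)) - h q) / 2)
        has_real_derivative \<rho>\<^sup>2 * (?vx * m) - 2 * Ic ?t - j q * (\<rho> * (?ux * m)) / 2) (at 0)"
      by (auto intro!: derivative_eq_intros u2 v2 simp: algebra_simps)
  qed
  have "((\<lambda>p. ln (f p)) has_derivative (\<lambda>w. 2 * (w $ 1 * \<kappa>' ?t))) (at q)"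
    by (rule has_derivative_transform_within_open[OF has_derivative_mult_right[OF Dq(3)] N]) (simp add: f)
  note dln = dderivI[OF this]
  have "pullback1 \<phi> (weyl_form u v) q a
      = (u (\<phi> q) * ?ux + 2 * ?uy + 4 * ?vx) * (\<rho>\<^sup>2 * m * a $ 1) - ?ux * (K * (h q * a $ 1 + a $ 3))"
    by (simp add: pullback1_def weyl_form_def dL L_def)
  also have "\<dots> = weyl_form u' v' q a + frechet_derivative (\<lambda>q'. ln (f q')) (at q) a"
    unfolding weyl_form_def u'2 u'3 v'2 dln u'[OF N(2)] Km(3)[symmetric]
    by (simp add: K power2_eq_square algebra_simps)
  finally show "pullback1 \<phi> (weyl_form u v) q a
      = weyl_form u' v' q a + frechet_derivative (\<lambda>q'. ln (f q')) (at q) a" .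
qed

subsection \<open>The flow of a field in normal form\<close>

text \<open>The flow \<open>T\<close> of \<open>d \<partial>\<^sub>t\<close> being given, the other two components of the flow solve linear equations
  with coefficients depending on \<open>T\<close>, and are polynomials in \<open>x\<close> and \<open>y\<close> with coefficients given by quadratures.\<close>

locale shape_flow =
  fixes x0 y0 \<epsilon> t1 t2 :: real and a b c d e e' :: "real \<Rightarrow> real" and S :: "real set"
    and T :: "real \<times> real \<Rightarrow> real"
  assumes eps: "\<epsilon> > 0" and S: "open S"
    and coeff: "\<And>f. f \<in> {a, b, c, d, e, e'} \<Longrightarrow> smooth_on S f"
    and De: "\<And>t. t \<in> S \<Longrightarrow> (e has_real_derivative e' t) (at t)"
    and smT: "smooth_on ({-\<epsilon><..<\<epsilon>} \<times> {t1<..<t2}) T"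
    and T0: "\<And>t. t \<in> {t1<..<t2} \<Longrightarrow> T (0, t) = t"
    and TS: "\<And>\<tau> t. \<tau> \<in> {-\<epsilon><..<\<epsilon>} \<Longrightarrow> t \<in> {t1<..<t2} \<Longrightarrow> T (\<tau>, t) \<in> S"
    and T\<tau>: "\<And>\<tau> t. \<tau> \<in> {-\<epsilon><..<\<epsilon>} \<Longrightarrow> t \<in> {t1<..<t2} \<Longrightarrow>
      ((\<lambda>\<tau>. T (\<tau>, t)) has_real_derivative d (T (\<tau>, t))) (at \<tau>)"
    and Tt: "\<And>\<tau> t. \<tau> \<in> {-\<epsilon><..<\<epsilon>} \<Longrightarrow> t \<in> {t1<..<t2} \<Longrightarrow>
      ((\<lambda>t. T (\<tau>, t)) has_real_derivative
        exp (time_integral (\<lambda>z. dderiv d (T z) 1) (\<tau>, t))) (at t)"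
begin

abbreviation "I \<equiv> {-\<epsilon><..<\<epsilon>}"
abbreviation "J \<equiv> {t1<..<t2}"
abbreviation "\<Omega> \<equiv> I \<times> J"

text \<open>\<open>\<mu>\<close> and \<open>\<kappa>\<close> are the logarithms of the factors of \<open>x\<close> and \<open>y\<close> in the flow; the remaining four functions come
  from variation of constants, \<open>I2\<close>, \<open>I1\<close> and \<open>I0\<close> belonging to the powers of \<open>y\<close> in the \<open>x\<close>-component.\<close>

definition "\<mu> = time_integral (\<lambda>z. e (T z))"
definition "\<kappa> z = (time_integral (\<lambda>z. dderiv d (T z) 1) z + \<mu> z) / 2"
definition "\<beta> = time_integral (\<lambda>z. b (T z) * exp (- \<kappa> z))"
definition "I2 = time_integral (\<lambda>z. exp (2 * \<kappa> z - \<mu> z) * e' (T z) / 2)"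
definition "I1 = time_integral (\<lambda>z. exp (- \<mu> z) * (exp (\<kappa> z) * c (T z) + exp (2 * \<kappa> z) * \<beta> z * e' (T z)))"
definition "I0 = time_integral (\<lambda>z. exp (- \<mu> z) *
  (a (T z) + exp (\<kappa> z) * \<beta> z * c (T z) + exp (2 * \<kappa> z) * (\<beta> z)\<^sup>2 * e' (T z) / 2))"

lemma d'_integral: "time_integral (\<lambda>z. dderiv d (T z) 1) z = 2 * \<kappa> z - \<mu> z"
  by (simp add: \<kappa>_def add_divide_distrib)

lemma open_\<Omega>: "open \<Omega>" by (intro open_Times) auto

lemma Ck_T: "Ck_on k \<Omega> T" using smT by (rule smooth_onD)

lemma Ck_coeff: "f \<in> {a, b, c, d, e, e'} \<Longrightarrow> Ck_on k \<Omega> (\<lambda>z. f (T z))"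
  by (rule Ck_on_compose[OF smooth_onD[OF coeff] Ck_T]) (use TS open_\<Omega> in auto)

lemma Ck_d': "Ck_on k \<Omega> (\<lambda>z. dderiv d (T z) 1)"
  by (rule Ck_on_compose[OF smooth_onD[OF smooth_on_dderiv[OF coeff]] Ck_T])
    (use TS open_\<Omega> in auto)

lemma Ck_time_integral: "Ck_on k \<Omega> f \<Longrightarrow> Ck_on k \<Omega> (time_integral f)"
  by (rule Ck_on_time_integral) auto

lemma Ck_\<mu>: "Ck_on k \<Omega> \<mu>"
  unfolding \<mu>_def by (intro Ck_time_integral Ck_coeff) auto

lemma Ck_\<kappa>: "Ck_on k \<Omega> \<kappa>"
  unfolding \<kappa>_def[abs_def] by (intro Ck_on_divide Ck_on_add Ck_time_integral Ck_d' Ck_\<mu> open_\<Omega> Ck_on_const) auto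

lemma Ck_exp_\<kappa>: "Ck_on k \<Omega> (\<lambda>z. exp (\<kappa> z))" "Ck_on k \<Omega> (\<lambda>z. exp (- \<kappa> z))"
    "Ck_on k \<Omega> (\<lambda>z. exp (2 * \<kappa> z))" "Ck_on k \<Omega> (\<lambda>z. exp (2 * \<kappa> z - \<mu> z))" "Ck_on k \<Omega> (\<lambda>z. exp (- \<mu> z))"
    "Ck_on k \<Omega> (\<lambda>z. exp (\<mu> z))" "Ck_on k \<Omega> (\<lambda>z. exp (\<kappa> z - \<mu> z))"
  by (intro Ck_on_exp Ck_on_minus Ck_on_mult Ck_on_diff Ck_\<kappa> Ck_\<mu> Ck_on_const open_\<Omega>)+

lemma Ck_integrand_\<beta>: "Ck_on k \<Omega> (\<lambda>z. b (T z) * exp (- \<kappa> z))"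
  by (intro Ck_on_mult Ck_coeff Ck_exp_\<kappa> open_\<Omega>) auto

lemma Ck_\<beta>: "Ck_on k \<Omega> \<beta>"
  unfolding \<beta>_def by (rule Ck_time_integral[OF Ck_integrand_\<beta>])

lemma Ck_integrand_I2: "Ck_on k \<Omega> (\<lambda>z. exp (2 * \<kappa> z - \<mu> z) * e' (T z) / 2)"
  by (intro Ck_on_divide Ck_on_mult Ck_coeff Ck_exp_\<kappa> Ck_on_const open_\<Omega>) auto

lemma Ck_integrand_I1:
  "Ck_on k \<Omega> (\<lambda>z. exp (- \<mu> z) * (exp (\<kappa> z) * c (T z) + exp (2 * \<kappa> z) * \<beta> z * e' (T z)))"
  by (intro Ck_on_mult Ck_on_add Ck_coeff Ck_exp_\<kappa> Ck_\<beta> open_\<Omega>) auto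

lemma Ck_integrand_I0:
  "Ck_on k \<Omega> (\<lambda>z. exp (- \<mu> z) *
    (a (T z) + exp (\<kappa> z) * \<beta> z * c (T z) + exp (2 * \<kappa> z) * (\<beta> z)\<^sup>2 * e' (T z) / 2))"
  by (intro Ck_on_mult Ck_on_add Ck_on_divide Ck_on_power Ck_coeff Ck_exp_\<kappa> Ck_\<beta> Ck_on_const open_\<Omega>) auto

lemma Ck_I: "Ck_on k \<Omega> I0" "Ck_on k \<Omega> I1" "Ck_on k \<Omega> I2"
  unfolding I0_def I1_def I2_def
  by (rule Ck_time_integral[OF Ck_integrand_I0] Ck_time_integral[OF Ck_integrand_I1] Ck_time_integral[OF Ck_integrand_I2])+

lemma DERIV_time_integral:
  assumes "Ck_on 0 \<Omega> f" "\<tau> \<in> I" "t \<in> J"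
  shows "((\<lambda>\<tau>. time_integral f (\<tau>, t)) has_real_derivative f (\<tau>, t)) (at \<tau>)"
proof (rule time_integral_DERIV[OF _ assms(2)])
  show "continuous_on I (\<lambda>\<tau>. f (\<tau>, t))"
    by (rule continuous_on_compose2[where f = "\<lambda>\<tau>. (\<tau>, t)" and t = \<Omega>])
      (use assms in \<open>auto intro!: continuous_intros\<close>)
qed

lemma coefficient_ODEs:
  assumes "\<tau> \<in> I" "t \<in> J"
  shows "((\<lambda>\<tau>. \<mu> (\<tau>, t)) has_real_derivative e (T (\<tau>, t))) (at \<tau>)"
    "((\<lambda>\<tau>. \<kappa> (\<tau>, t)) has_real_derivative (dderiv d (T (\<tau>, t)) 1 + e (T (\<tau>, t))) / 2) (at \<tau>)"
    "((\<lambda>\<tau>. \<beta> (\<tau>, t)) has_real_derivative b (T (\<tau>, t)) * exp (- \<kappa> (\<tau>, t))) (at \<tau>)"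
    "((\<lambda>\<tau>. I2 (\<tau>, t)) has_real_derivative exp (2 * \<kappa> (\<tau>, t) - \<mu> (\<tau>, t)) * e' (T (\<tau>, t)) / 2) (at \<tau>)"
    "((\<lambda>\<tau>. I1 (\<tau>, t)) has_real_derivative exp (- \<mu> (\<tau>, t)) * (exp (\<kappa> (\<tau>, t)) * c (T (\<tau>, t))
      + exp (2 * \<kappa> (\<tau>, t)) * \<beta> (\<tau>, t) * e' (T (\<tau>, t)))) (at \<tau>)"
    "((\<lambda>\<tau>. I0 (\<tau>, t)) has_real_derivative exp (- \<mu> (\<tau>, t)) * (a (T (\<tau>, t))
      + exp (\<kappa> (\<tau>, t)) * \<beta> (\<tau>, t) * c (T (\<tau>, t))
      + exp (2 * \<kappa> (\<tau>, t)) * (\<beta> (\<tau>, t))\<^sup>2 * e' (T (\<tau>, t)) / 2)) (at \<tau>)"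
proof -
  have e: "Ck_on 0 \<Omega> (\<lambda>z. e (T z))" by (rule Ck_coeff) simp
  show \<mu>: "((\<lambda>\<tau>. \<mu> (\<tau>, t)) has_real_derivative e (T (\<tau>, t))) (at \<tau>)"
    unfolding \<mu>_def by (rule DERIV_time_integral[OF e assms])
  show "((\<lambda>\<tau>. \<kappa> (\<tau>, t)) has_real_derivative (dderiv d (T (\<tau>, t)) 1 + e (T (\<tau>, t))) / 2) (at \<tau>)"
    unfolding \<kappa>_def by (intro DERIV_cdivide DERIV_add \<mu> DERIV_time_integral[OF Ck_d' assms])
  show "((\<lambda>\<tau>. \<beta> (\<tau>, t)) has_real_derivative b (T (\<tau>, t)) * exp (- \<kappa> (\<tau>, t))) (at \<tau>)"
    unfolding \<beta>_def by (rule DERIV_time_integral[OF Ck_integrand_\<beta> assms])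
  show "((\<lambda>\<tau>. I2 (\<tau>, t)) has_real_derivative exp (2 * \<kappa> (\<tau>, t) - \<mu> (\<tau>, t)) * e' (T (\<tau>, t)) / 2) (at \<tau>)"
    unfolding I2_def by (rule DERIV_time_integral[OF Ck_integrand_I2 assms])
  show "((\<lambda>\<tau>. I1 (\<tau>, t)) has_real_derivative exp (- \<mu> (\<tau>, t)) * (exp (\<kappa> (\<tau>, t)) * c (T (\<tau>, t))
      + exp (2 * \<kappa> (\<tau>, t)) * \<beta> (\<tau>, t) * e' (T (\<tau>, t)))) (at \<tau>)"
    unfolding I1_def by (rule DERIV_time_integral[OF Ck_integrand_I1 assms])
  show "((\<lambda>\<tau>. I0 (\<tau>, t)) has_real_derivative exp (- \<mu> (\<tau>, t)) * (a (T (\<tau>, t))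
      + exp (\<kappa> (\<tau>, t)) * \<beta> (\<tau>, t) * c (T (\<tau>, t))
      + exp (2 * \<kappa> (\<tau>, t)) * (\<beta> (\<tau>, t))\<^sup>2 * e' (T (\<tau>, t)) / 2)) (at \<tau>)"
    unfolding I0_def by (rule DERIV_time_integral[OF Ck_integrand_I0 assms])
qed

text \<open>The equation \<open>\<Xi>\<^sub>t\<^sub>x = \<Xi>\<^sub>y\<^sub>y\<close> for the flow: differentiating the exponent \<open>\<mu>\<close> with respect to the initial time
  produces the factor \<open>T\<^sub>t = e\<^bsup>2\<kappa> - \<mu>\<^esup>\<close>, which is the one in the definition of \<open>I2\<close>.\<close>

lemma \<mu>_t:
  assumes "\<tau> \<in> I" "t \<in> J"
  shows "((\<lambda>t. \<mu> (\<tau>, t)) has_real_derivative 2 * I2 (\<tau>, t)) (at t)"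
proof -
  have "((\<lambda>t. \<mu> (\<tau>, t)) has_real_derivative
      time_integral (\<lambda>z. exp (2 * \<kappa> z - \<mu> z) * e' (T z)) (\<tau>, t)) (at t)"
    unfolding \<mu>_def
  proof (rule time_integral_DERIV_parameter[where \<epsilon> = \<epsilon> and a = t1 and b = t2])
    fix \<sigma> s assume \<sigma>s: "\<sigma> \<in> I" "s \<in> J"
    show "((\<lambda>t. e (T (\<sigma>, t))) has_real_derivative
        exp (2 * \<kappa> (\<sigma>, s) - time_integral (\<lambda>z. e (T z)) (\<sigma>, s)) * e' (T (\<sigma>, s))) (at s)"
      using DERIV_chain2[where f = e and g = "\<lambda>t. T (\<sigma>, t)", OF De[OF TS[OF \<sigma>s]] Tt[OF \<sigma>s]]
      by (simp add: d'_integral mult.commute flip: \<mu>_def)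
  next
    show "continuous_on \<Omega> (\<lambda>z. e (T z))"
      using Ck_coeff[of e 0] by simp
    have "Ck_on 0 \<Omega> (\<lambda>z. exp (2 * \<kappa> z - \<mu> z) * e' (T z))"
      by (intro Ck_on_mult Ck_coeff Ck_exp_\<kappa> open_\<Omega>) auto
    then show "continuous_on \<Omega> (\<lambda>z. exp (2 * \<kappa> z - time_integral (\<lambda>z. e (T z)) z) * e' (T z))"
      by (simp add: \<mu>_def)
  qed (use assms in auto)
  moreover have "time_integral (\<lambda>z. exp (2 * \<kappa> z - \<mu> z) * e' (T z)) (\<tau>, t) = 2 * I2 (\<tau>, t)"
    by (simp add: I2_def time_integral_def)
  ultimately show ?thesis by simp
qed

lemma T_t: "\<tau> \<in> I \<Longrightarrow> t \<in> J \<Longrightarrow>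
    ((\<lambda>t. T (\<tau>, t)) has_real_derivative exp (2 * \<kappa> (\<tau>, t) - \<mu> (\<tau>, t))) (at t)"
  using Tt[of \<tau> t] by (simp add: d'_integral)

definition "flow \<tau> q = pt (T (\<tau>, q $ 1))
  (x0 + exp (\<mu> (\<tau>, q $ 1)) * ((q $ 2 - x0) + I0 (\<tau>, q $ 1) + (q $ 3 - y0) * I1 (\<tau>, q $ 1)
    + (q $ 3 - y0)\<^sup>2 * I2 (\<tau>, q $ 1)))
  (y0 + exp (\<kappa> (\<tau>, q $ 1)) * ((q $ 3 - y0) + \<beta> (\<tau>, q $ 1)))"

definition "normal_form p = pt (d (p $ 1))
  (a (p $ 1) + (p $ 3 - y0) * c (p $ 1) + (p $ 2 - x0) * e (p $ 1) + (p $ 3 - y0)\<^sup>2 * e' (p $ 1) / 2)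
  (b (p $ 1) + (p $ 3 - y0) * (dderiv d (p $ 1) 1 + e (p $ 1)) / 2)"

lemma flow_ODE:
  assumes "\<tau> \<in> I" "q $ 1 \<in> J"
  shows "((\<lambda>\<tau>. flow \<tau> q) has_vector_derivative normal_form (flow \<tau> q)) (at \<tau>)"
  unfolding flow_def normal_form_def pt_nth
proof (rule has_vector_derivative_pt)
  let ?z = "(\<tau>, q $ 1)" and ?Y = "q $ 3 - y0" and ?X = "q $ 2 - x0"
  note D = coefficient_ODEs[OF assms]
  show "((\<lambda>\<tau>. T (\<tau>, q $ 1)) has_real_derivative d (T ?z)) (at \<tau>)" by (rule T\<tau>[OF assms])
  show "((\<lambda>\<tau>. y0 + exp (\<kappa> (\<tau>, q $ 1)) * (?Y + \<beta> (\<tau>, q $ 1))) has_real_derivative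
      b (T ?z) + (y0 + exp (\<kappa> ?z) * (?Y + \<beta> ?z) - y0) * (dderiv d (T ?z) 1 + e (T ?z)) / 2) (at \<tau>)"
    by (rule derivative_eq_intros refl D)+ (simp add: algebra_simps exp_minus)
  have K2: "exp (2 * \<kappa> ?z) = (exp (\<kappa> ?z))\<^sup>2" by (simp add: exp_double)
  show "((\<lambda>\<tau>. x0 + exp (\<mu> (\<tau>, q $ 1)) * (?X + I0 (\<tau>, q $ 1) + ?Y * I1 (\<tau>, q $ 1)
      + ?Y\<^sup>2 * I2 (\<tau>, q $ 1))) has_real_derivative
      a (T ?z) + (y0 + exp (\<kappa> ?z) * (?Y + \<beta> ?z) - y0) * c (T ?z)
      + (x0 + exp (\<mu> ?z) * (?X + I0 ?z + ?Y * I1 ?z + ?Y\<^sup>2 * I2 ?z) - x0) * e (T ?z)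
      + (y0 + exp (\<kappa> ?z) * (?Y + \<beta> ?z) - y0)\<^sup>2 * e' (T ?z) / 2) (at \<tau>)"
    by (rule derivative_eq_intros refl D)+
      (simp add: exp_minus exp_diff K2 power2_eq_square field_simps)
qed

lemma flow_0: "q $ 1 \<in> J \<Longrightarrow> flow 0 q = q"
  by (simp add: flow_def \<mu>_def \<kappa>_def \<beta>_def I0_def I1_def I2_def T0)

lemma open_slab: "open (I \<times> {q :: base. q $ 1 \<in> J})"
proof -
  have "{q :: base. q $ 1 \<in> J} = (\<lambda>q. q $ 1) -` J" by auto
  moreover have "open \<dots>" by (intro open_vimage continuous_intros)
  ultimately show ?thesis by (simp add: open_Times)
qed

abbreviation "slab \<equiv> I \<times> {q :: base. q $ 1 \<in> J}"

lemma Ck_slab: "Ck_on k \<Omega> g \<Longrightarrow> Ck_on k slab (\<lambda>z. g (fst z, snd z $ 1))"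
  by (rule Ck_on_compose[where T = \<Omega>]) (use open_slab in \<open>auto intro!: Ck_intros\<close>)

lemma Ck_coord: "Ck_on k slab (\<lambda>z. snd z $ i)"
  by (intro Ck_intros open_slab)

lemma Ck_flow: "Ck_on k slab (\<lambda>z. flow (fst z) (snd z))"
  unfolding flow_def
  by (intro Ck_on_pt Ck_on_add Ck_on_mult Ck_on_diff Ck_on_power Ck_on_const Ck_coord open_slab
      Ck_slab[OF Ck_T] Ck_slab[OF Ck_I(1)] Ck_slab[OF Ck_I(2)] Ck_slab[OF Ck_I(3)]
      Ck_slab[OF Ck_exp_\<kappa>(1)] Ck_slab[OF Ck_exp_\<kappa>(6)] Ck_slab[OF Ck_\<beta>])

abbreviation "D\<^sub>t g z \<equiv> dderiv g z (0, 1)"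

text \<open>With \<open>(T, \<Xi>, H)\<close> the components of the flow, these are \<open>2 \<Xi>\<^sub>y / \<Xi>\<^sub>x\<close>, \<open>H\<^sub>t / H\<^sub>y\<close> and \<open>\<Xi>\<^sub>t / \<Xi>\<^sub>x\<close>, the
  parameters \<open>j\<close>, \<open>h\<close>, \<open>\<xi>\<close> of the pullback formula.\<close>

definition "x_shear z = 2 * (I1 (fst z, snd z $ 1) + 2 * (snd z $ 3 - y0) * I2 (fst z, snd z $ 1))"
definition "y_drift z = D\<^sub>t \<kappa> (fst z, snd z $ 1) * ((snd z $ 3 - y0) + \<beta> (fst z, snd z $ 1)) + D\<^sub>t \<beta> (fst z, snd z $ 1)"
definition "x_drift z = 2 * I2 (fst z, snd z $ 1) * ((snd z $ 2 - x0) + I0 (fst z, snd z $ 1)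
    + (snd z $ 3 - y0) * I1 (fst z, snd z $ 1) + (snd z $ 3 - y0)\<^sup>2 * I2 (fst z, snd z $ 1))
  + (D\<^sub>t I0 (fst z, snd z $ 1) + (snd z $ 3 - y0) * D\<^sub>t I1 (fst z, snd z $ 1)
    + (snd z $ 3 - y0)\<^sup>2 * D\<^sub>t I2 (fst z, snd z $ 1))"

lemma Ck_Dt: "(\<And>k. Ck_on k \<Omega> g) \<Longrightarrow> Ck_on k \<Omega> (D\<^sub>t g)"
  using smooth_onD[OF smooth_on_dderiv[OF smooth_onI]] by blast

lemma Ck_x_shear: "Ck_on k slab x_shear"
  unfolding x_shear_def[abs_def]
  by (intro Ck_on_add Ck_on_mult Ck_on_diff Ck_on_const Ck_coord open_slab
      Ck_slab[OF Ck_I(2)] Ck_slab[OF Ck_I(3)])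

lemma Ck_y_drift: "Ck_on k slab y_drift"
  unfolding y_drift_def[abs_def]
  by (intro Ck_on_add Ck_on_mult Ck_on_diff Ck_on_const Ck_coord open_slab
      Ck_slab[OF Ck_\<beta>] Ck_slab[OF Ck_Dt[OF Ck_\<beta>]] Ck_slab[OF Ck_Dt[OF Ck_\<kappa>]])

lemma Ck_x_drift: "Ck_on k slab x_drift"
  unfolding x_drift_def[abs_def]
  by (intro Ck_on_add Ck_on_mult Ck_on_diff Ck_on_power Ck_on_const Ck_coord open_slab
      Ck_slab[OF Ck_I(1)] Ck_slab[OF Ck_I(2)] Ck_slab[OF Ck_I(3)]
      Ck_slab[OF Ck_Dt[OF Ck_I(1)]] Ck_slab[OF Ck_Dt[OF Ck_I(2)]] Ck_slab[OF Ck_Dt[OF Ck_I(3)]])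

lemma Dt_0:
  fixes g :: "real \<times> real \<Rightarrow> real"
  assumes "\<And>k. Ck_on k \<Omega> g" "\<And>t. g (0, t) = 0" "t \<in> J"
  shows "D\<^sub>t g (0, t) = 0"
proof -
  have "g differentiable (at (0, t))"
    using smooth_on_differentiable[OF smooth_onI[OF assms(1)]] assms(3) eps by auto
  from DERIV_snd_dderiv[OF this] have "((\<lambda>t. 0) has_real_derivative D\<^sub>t g (0, t)) (at t)"
    using assms(2) by simp
  then show ?thesis using DERIV_unique[OF DERIV_const] by metis
qed

lemma at_time_0:
  assumes "q $ 1 \<in> J"
  shows "x_shear (0, q) = 0" "y_drift (0, q) = 0" "x_drift (0, q) = 0" "\<kappa> (0, q $ 1) = 0" "\<mu> (0, q $ 1) = 0"
proof -
  have z: "\<And>t. \<kappa> (0, t) = 0" "\<And>t. \<mu> (0, t) = 0" "\<And>t. \<beta> (0, t) = 0" "\<And>t. I0 (0, t) = 0" "\<And>t. I1 (0, t) = 0" "\<And>t. I2 (0, t) = 0"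
    by (simp_all add: \<kappa>_def \<mu>_def \<beta>_def I0_def I1_def I2_def)
  show "\<kappa> (0, q $ 1) = 0" "\<mu> (0, q $ 1) = 0" "x_shear (0, q) = 0" by (simp_all add: z x_shear_def)
  show "y_drift (0, q) = 0" "x_drift (0, q) = 0"
    using Dt_0[OF Ck_\<kappa> z(1) assms] Dt_0[OF Ck_\<beta> z(3) assms] Dt_0[OF Ck_I(1) z(4) assms]
      Dt_0[OF Ck_I(2) z(5) assms] Dt_0[OF Ck_I(3) z(6) assms]
    by (simp_all add: z y_drift_def x_drift_def)
qed

lemma DERIV_Dt:
  fixes g :: "real \<times> real \<Rightarrow> real"
  assumes "\<And>k. Ck_on k \<Omega> g" "\<tau> \<in> I" "t \<in> J"
  shows "((\<lambda>t. g (\<tau>, t)) has_real_derivative D\<^sub>t g (\<tau>, t)) (at t)"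
  by (rule DERIV_snd_dderiv, rule smooth_on_differentiable[OF smooth_onI[OF assms(1)]])
    (use assms in auto)

lemma flow_preserves_shape:
  assumes N: "open N" "\<And>q. q \<in> N \<Longrightarrow> q $ 1 \<in> J"
    and \<delta>: "0 < \<delta>" "\<delta> \<le> \<epsilon>"
    and U: "open U" "\<And>\<tau> q. \<tau> \<in> {-\<delta><..<\<delta>} \<Longrightarrow> q \<in> N \<Longrightarrow> flow \<tau> q \<in> U"
  shows "flow_preserves_shape U N \<delta> flow"
  unfolding flow_preserves_shape_def
proof (intro allI impI)
  fix u v :: "base \<Rightarrow> real" assume uv: "smooth_on U u" "smooth_on U v"
  let ?P = "{-\<delta><..<\<delta>} \<times> N"
  have sub: "?P \<subseteq> slab" using N \<delta> by auto
  have oP: "open ?P" using N by (simp add: open_Times)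
  define \<rho> where "\<rho> z = exp (\<kappa> (fst z, snd z $ 1) - \<mu> (fst z, snd z $ 1))" for z :: "real \<times> base"
  define s where "s z = \<rho> z * u (flow (fst z) (snd z)) - y_drift z" for z
  define f where "f \<tau> q = exp (2 * \<kappa> (\<tau>, q $ 1))" for \<tau> and q :: base
  define u' where "u' \<tau> q = x_shear (\<tau>, q) + s (\<tau>, q)" for \<tau> q
  define v' where "v' \<tau> q = (\<rho> (\<tau>, q))\<^sup>2 * v (flow \<tau> q) - x_drift (\<tau>, q) - (x_shear (\<tau>, q))\<^sup>2 / 4
    - x_shear (\<tau>, q) * s (\<tau>, q) / 2" for \<tau> q
  have C\<rho>: "Ck_on k ?P \<rho>" for k
    unfolding \<rho>_def[abs_def] by (rule Ck_on_subset[OF Ck_slab[OF Ck_exp_\<kappa>(7)] sub])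
  have Cuv: "Ck_on k ?P (\<lambda>z. g (flow (fst z) (snd z)))" if "smooth_on U g" for g :: "base \<Rightarrow> real" and k
    by (rule Ck_on_compose[OF smooth_onD[OF that] Ck_on_subset[OF Ck_flow sub]])
      (use U(2) oP in auto)
  note Cs = Ck_on_subset[OF Ck_x_shear sub] Ck_on_subset[OF Ck_y_drift sub] Ck_on_subset[OF Ck_x_drift sub]
  have Css: "Ck_on k ?P s" for k
    unfolding s_def[abs_def] by (intro Ck_on_diff Ck_on_mult C\<rho> Cuv uv Cs oP)
  have sf: "smooth_on ?P (\<lambda>(\<tau>, q). f \<tau> q)"
    unfolding f_def case_prod_beta
    by (rule smooth_onI, rule Ck_on_subset[OF Ck_slab[OF Ck_exp_\<kappa>(3)] sub])
  have su: "smooth_on ?P (\<lambda>(\<tau>, q). u' \<tau> q)"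
    unfolding u'_def case_prod_beta prod.collapse by (rule smooth_onI) (intro Ck_on_add Cs Css oP)
  have sv: "smooth_on ?P (\<lambda>(\<tau>, q). v' \<tau> q)"
    unfolding v'_def case_prod_beta prod.collapse
    by (rule smooth_onI)
      (intro Ck_on_diff Ck_on_mult Ck_on_power Ck_on_divide Ck_on_const C\<rho> Cuv uv Cs Css oP, simp_all)
  have slice: "g \<tau> differentiable (at q)" if "smooth_on ?P (\<lambda>(\<tau>, q). g \<tau> q)" "\<tau> \<in> {-\<delta><..<\<delta>}" "q \<in> N"
    for g :: "real \<Rightarrow> base \<Rightarrow> real" and \<tau> q
    using smooth_slice_differentiable[OF that(1), of \<tau> q] that(2,3) by simp
  have main: "pullback2 (flow \<tau>) (metric u v) q a b = f \<tau> q * metric (u' \<tau>) (v' \<tau>) q a b \<and>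
      pullback1 (flow \<tau>) (weyl_form u v) q a = weyl_form (u' \<tau>) (v' \<tau>) q a
        + frechet_derivative (\<lambda>q'. ln (f \<tau> q')) (at q) a"
    if \<tau>: "\<tau> \<in> {-\<delta><..<\<delta>}" and q: "q \<in> N" for \<tau> q a b
  proof (intro conjI)
    have \<tau>I: "\<tau> \<in> I" and qJ: "q $ 1 \<in> J" using \<tau> q \<delta> N by auto
    note D = T_t[OF \<tau>I qJ] \<mu>_t[OF \<tau>I qJ] DERIV_Dt[OF Ck_\<kappa> \<tau>I qJ] DERIV_Dt[OF Ck_\<beta> \<tau>I qJ]
      DERIV_Dt[OF Ck_I(1) \<tau>I qJ] DERIV_Dt[OF Ck_I(2) \<tau>I qJ] DERIV_Dt[OF Ck_I(3) \<tau>I qJ]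
    note fl = U(2)[OF \<tau> q]
    note diff = smooth_on_differentiable[OF uv(1) fl] smooth_on_differentiable[OF uv(2) fl]
      slice[OF su \<tau> q] slice[OF sv \<tau> q]
    note pb = pseudogroup_pullback[where T = "\<lambda>t. T (\<tau>, t)" and \<mu> = "\<lambda>t. \<mu> (\<tau>, t)"
        and \<kappa> = "\<lambda>t. \<kappa> (\<tau>, t)" and \<beta> = "\<lambda>t. \<beta> (\<tau>, t)" and Ia = "\<lambda>t. I0 (\<tau>, t)"
        and Ib = "\<lambda>t. I1 (\<tau>, t)" and Ic = "\<lambda>t. I2 (\<tau>, t)"
        and \<kappa>' = "\<lambda>t. D\<^sub>t \<kappa> (\<tau>, t)" and \<beta>' = "\<lambda>t. D\<^sub>t \<beta> (\<tau>, t)"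
        and Ia' = "\<lambda>t. D\<^sub>t I0 (\<tau>, t)" and Ib' = "\<lambda>t. D\<^sub>t I1 (\<tau>, t)"
        and Ic' = "\<lambda>t. D\<^sub>t I2 (\<tau>, t)" and j = "\<lambda>q. x_shear (\<tau>, q)" and h = "\<lambda>q. y_drift (\<tau>, q)"
        and \<xi> = "\<lambda>q. x_drift (\<tau>, q)" and u' = "u' \<tau>" and v' = "v' \<tau>" and u = u and v = v
        and f = "f \<tau>" and \<phi> = "flow \<tau>" and xo = x0 and yo = y0, OF N(1) q D]
    show "pullback2 (flow \<tau>) (metric u v) q a b = f \<tau> q * metric (u' \<tau>) (v' \<tau>) q a b"
      by (rule pb(1)[OF _ _ _ _ _ _ _ diff])
        (simp_all add: flow_def x_shear_def y_drift_def x_drift_def u'_def v'_def s_def \<rho>_def f_def)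
    show "pullback1 (flow \<tau>) (weyl_form u v) q a = weyl_form (u' \<tau>) (v' \<tau>) q a
        + frechet_derivative (\<lambda>q'. ln (f \<tau> q')) (at q) a"
      by (rule pb(2)[OF _ _ _ _ _ _ _ diff])
        (simp_all add: flow_def x_shear_def y_drift_def x_drift_def u'_def v'_def s_def \<rho>_def f_def)
  qed
  have init: "f 0 q = 1 \<and> u' 0 q = u q \<and> v' 0 q = v q" if "q \<in> N" for q
    using at_time_0[OF N(2)[OF that]] flow_0[OF N(2)[OF that]]
    by (simp add: f_def u'_def v'_def s_def \<rho>_def)
  show "\<exists>f u' v'.
    smooth_on ?P (\<lambda>(\<tau>, q). f \<tau> q) \<and> smooth_on ?P (\<lambda>(\<tau>, q). u' \<tau> q) \<and> smooth_on ?P (\<lambda>(\<tau>, q). v' \<tau> q) \<and>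
    (\<forall>q\<in>N. f 0 q = 1 \<and> u' 0 q = u q \<and> v' 0 q = v q) \<and>
    (\<forall>\<tau>\<in>{-\<delta><..<\<delta>}. \<forall>q\<in>N. f \<tau> q > 0 \<and>
      (\<forall>a b. pullback2 (flow \<tau>) (metric u v) q a b = f \<tau> q * metric (u' \<tau>) (v' \<tau>) q a b) \<and>
      (\<forall>a. pullback1 (flow \<tau>) (weyl_form u v) q a
        = weyl_form (u' \<tau>) (v' \<tau>) q a + frechet_derivative (\<lambda>q'. ln (f \<tau> q')) (at q) a))"
    using sf su sv init main by (intro exI[of _ f] exI[of _ u'] exI[of _ v']) (auto simp: f_def)
qed

end

text \<open>The normal form is valid on a box only; by continuity, the flow stays in it for short times and nearby
  initial points.\<close>

theorem shape_system_imp_shape_fields: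
  assumes S: "shape_system U X" and U: "open U"
  shows "X \<in> shape_fields U"
  unfolding shape_fields_def
proof (intro CollectI conjI ballI)
  show "smooth_on U X" using S by (simp add: shape_system_def)
  fix p assume p: "p \<in> U"
  obtain r a b c d e e' where r: "r > 0"
    and rU: "\<And>q. (\<forall>i. q $ i \<in> {p $ i - r<..<p $ i + r}) \<Longrightarrow> q \<in> U"
    and coeff: "\<And>f. f \<in> {a, b, c, d, e, e'} \<Longrightarrow> smooth_on {p $ 1 - r<..<p $ 1 + r} f"
    and De: "\<And>t. t \<in> {p $ 1 - r<..<p $ 1 + r} \<Longrightarrow> (e has_real_derivative e' t) (at t)"
    and X: "\<And>q. (\<forall>i. q $ i \<in> {p $ i - r<..<p $ i + r}) \<Longrightarrow> X q = pt (d (q $ 1))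
      (a (q $ 1) + (q $ 3 - p $ 3) * c (q $ 1) + (q $ 2 - p $ 2) * e (q $ 1)
        + (q $ 3 - p $ 3)\<^sup>2 * e' (q $ 1) / 2)
      (b (q $ 1) + (q $ 3 - p $ 3) * (dderiv d (q $ 1) 1 + e (q $ 1)) / 2)"
    by (rule shape_system_normal_form[OF S U p]) blast
  let ?S = "{p $ 1 - r<..<p $ 1 + r}"
  have dS: "smooth_on ?S d" "p $ 1 \<in> ?S" using coeff r by auto
  obtain \<epsilon> r1 T where \<epsilon>: "\<epsilon> > 0" "r1 > 0" "smooth_on ({-\<epsilon><..<\<epsilon>} \<times> {p $ 1 - r1<..<p $ 1 + r1}) T"
    "\<And>s. s \<in> {p $ 1 - r1<..<p $ 1 + r1} \<Longrightarrow> T (0, s) = s"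
    "\<And>\<tau> s. \<tau> \<in> {-\<epsilon><..<\<epsilon>} \<Longrightarrow> s \<in> {p $ 1 - r1<..<p $ 1 + r1} \<Longrightarrow> T (\<tau>, s) \<in> ?S"
    "\<And>\<tau> s. \<tau> \<in> {-\<epsilon><..<\<epsilon>} \<Longrightarrow> s \<in> {p $ 1 - r1<..<p $ 1 + r1} \<Longrightarrow>
      ((\<lambda>\<tau>. T (\<tau>, s)) has_real_derivative d (T (\<tau>, s))) (at \<tau>)"
    "\<And>\<tau> s. \<tau> \<in> {-\<epsilon><..<\<epsilon>} \<Longrightarrow> s \<in> {p $ 1 - r1<..<p $ 1 + r1} \<Longrightarrow>
      ((\<lambda>s. T (\<tau>, s)) has_real_derivative
        exp (time_integral (\<lambda>z. dderiv d (T z) 1) (\<tau>, s))) (at s)"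
    using scalar_flow[OF open_greaterThanLessThan dS] by blast
  interpret shape_flow "p $ 2" "p $ 3" \<epsilon> "p $ 1 - r1" "p $ 1 + r1" a b c d e e' ?S T
    by unfold_locales (use \<epsilon> coeff De in auto)
  let ?box = "{q. \<forall>i. q $ i \<in> {p $ i - r<..<p $ i + r}}"
  have obox: "open ?box"
  proof -
    have "?box = box (\<chi> i. p $ i - r) (\<chi> i. p $ i + r)" by (auto simp: mem_box_cart)
    then show ?thesis by (simp add: open_box)
  qed
  define V where "V = slab \<inter> (\<lambda>z. flow (fst z) (snd z)) -` ?box"
  have "continuous_on slab (\<lambda>z. flow (fst z) (snd z))" using Ck_flow[of 0] by simp
  then have oV: "open V" unfolding V_def using open_slab obox by (rule continuous_open_preimage)
  have 0: "(0, p) \<in> V" using \<epsilon> r flow_0[of p] by (auto simp: V_def)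
  obtain A N where "open A" "open N" "(0, p) \<in> A \<times> N" "A \<times> N \<subseteq> V"
    by (rule open_prod_elim[OF oV 0])
  then have AN: "open A" "open N" "0 \<in> A" "p \<in> N" "A \<times> N \<subseteq> V" by auto
  obtain \<delta> where \<delta>: "\<delta> > 0" "ball 0 \<delta> \<subseteq> A" using AN openE by blast
  define \<eta> where "\<eta> = min \<delta> \<epsilon>"
  have \<eta>: "\<eta> > 0" "\<eta> \<le> \<epsilon>" using \<delta> \<epsilon> by (auto simp: \<eta>_def)
  have "{-\<eta><..<\<eta>} \<subseteq> A" using \<delta> by (auto simp: \<eta>_def subset_eq abs_less_iff)
  then have fl: "(\<tau>, q) \<in> V" if "\<tau> \<in> {-\<eta><..<\<eta>}" "q \<in> N" for \<tau> q using that AN by blast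
  have NJ: "q $ 1 \<in> {p $ 1 - r1<..<p $ 1 + r1}" and N0: "q \<in> ?box" if "q \<in> N" for q
    using fl[of 0 q] that \<eta> flow_0[of q] by (auto simp: V_def)
  have flbox: "flow \<tau> q \<in> ?box" if "\<tau> \<in> {-\<eta><..<\<eta>}" "q \<in> N" for \<tau> q
    using fl[OF that] by (auto simp: V_def)
  show "\<exists>N \<epsilon> \<phi>. open N \<and> p \<in> N \<and> N \<subseteq> U \<and> \<epsilon> > 0 \<and> local_flow X U N \<epsilon> \<phi> \<and> flow_preserves_shape U N \<epsilon> \<phi>"
  proof (intro exI conjI)
    show "N \<subseteq> U" using N0 rU by blast
    show "local_flow X U N \<eta> flow"
      unfolding local_flow_def
    proof (intro conjI ballI)
      have "{-\<eta><..<\<eta>} \<times> N \<subseteq> slab" using NJ \<eta> by auto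
      then show "smooth_on ({-\<eta><..<\<eta>} \<times> N) (\<lambda>(\<tau>, q). flow \<tau> q)"
        unfolding case_prod_beta using smooth_on_subset[OF smooth_onI[OF Ck_flow]] by blast
      show "flow 0 q = q" if "q \<in> N" for q using flow_0[OF NJ[OF that]] .
      show "flow \<tau> q \<in> U" if "\<tau> \<in> {-\<eta><..<\<eta>}" "q \<in> N" for \<tau> q
        using flbox[OF that] rU by blast
      show "((\<lambda>\<sigma>. flow \<sigma> q) has_vector_derivative X (flow \<tau> q)) (at \<tau>)"
        if "\<tau> \<in> {-\<eta><..<\<eta>}" "q \<in> N" for \<tau> q
        using flow_ODE[OF _ NJ[OF that(2)], of \<tau>] X[of "flow \<tau> q"] flbox[OF that] that(1) \<eta>
        by (simp add: normal_form_def)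
    qed
    show "flow_preserves_shape U N \<eta> flow"
      by (rule flow_preserves_shape[OF AN(2) NJ \<eta> U]) (use flbox rU in blast)+
  qed (use AN \<eta> in auto)
qed

section \<open>Differentiating a shape-preserving flow\<close>

lemma smooth_slice:
  fixes G :: "real \<times> base \<Rightarrow> real"
  assumes "smooth_on P G" "(\<tau>, q) \<in> P"
  shows "partial i (\<lambda>q. G (\<tau>, q)) q = dderiv G (\<tau>, q) (0, axis i 1)"
    "((\<lambda>\<tau>. G (\<tau>, q)) has_real_derivative dderiv G (\<tau>, q) (1, 0)) (at \<tau>)"
proof -
  note df = smooth_on_differentiable[OF assms]
  note d = smooth_on_has_derivative[OF assms]
  have "((\<lambda>q. (\<tau>, q)) has_derivative (\<lambda>w. (0, w))) (at q)"
    by (auto intro!: derivative_eq_intros)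
  from has_derivative_compose[OF this d]
  have D: "((\<lambda>q. G (\<tau>, q)) has_derivative (\<lambda>w. dderiv G (\<tau>, q) (0, w))) (at q)" .
  show "partial i (\<lambda>q. G (\<tau>, q)) q = dderiv G (\<tau>, q) (0, axis i 1)"
    unfolding partial_def dderivI[OF D] ..
  have "((\<lambda>\<tau>. (\<tau>, q)) has_derivative (\<lambda>s. (s, 0))) (at \<tau>)"
    by (auto intro!: derivative_eq_intros)
  from has_derivative_compose[OF this d]
  have "((\<lambda>\<tau>. G (\<tau>, q)) has_derivative (\<lambda>s. dderiv G (\<tau>, q) (s, 0))) (at \<tau>)" .
  moreover have "dderiv G (\<tau>, q) (s, 0) = dderiv G (\<tau>, q) (1, 0) * s" for s
    using dderiv_scale[OF df, of s "(1, 0)"] by simp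
  ultimately show "((\<lambda>\<tau>. G (\<tau>, q)) has_real_derivative dderiv G (\<tau>, q) (1, 0)) (at \<tau>)"
    unfolding has_field_derivative_def by (metis (no_types, lifting) has_derivative_eq_rhs ext)
qed

text \<open>At time zero, the spatial derivatives of a family evolve by those of its velocity \<open>\<gamma>\<close>.\<close>

lemma mixed_time_derivative:
  fixes G :: "real \<times> base \<Rightarrow> real"
  assumes G: "smooth_on ({-\<epsilon><..<\<epsilon>} \<times> N) G" and N: "open N" "q \<in> N" and \<epsilon>: "\<epsilon> > 0"
    and \<gamma>: "\<And>p. p \<in> N \<Longrightarrow> ((\<lambda>\<tau>. G (\<tau>, p)) has_real_derivative \<gamma> p) (at 0)"
  shows "((\<lambda>\<tau>. partial i (\<lambda>q. G (\<tau>, q)) q) has_real_derivative partial i \<gamma> q) (at 0)"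
proof -
  let ?P = "{-\<epsilon><..<\<epsilon>} \<times> N"
  have P: "open ?P" "(0, q) \<in> ?P" using N \<epsilon> by (auto simp: open_Times)
  have "((\<lambda>\<tau>. dderiv G (\<tau>, q) (0, axis i 1)) has_real_derivative
      dderiv (\<lambda>z. dderiv G z (0, axis i 1)) (0, q) (1, 0)) (at 0)"
    by (rule smooth_slice(2)[OF smooth_on_dderiv[OF G] P(2)])
  then have "((\<lambda>\<tau>. partial i (\<lambda>q. G (\<tau>, q)) q) has_real_derivative
      dderiv (\<lambda>z. dderiv G z (0, axis i 1)) (0, q) (1, 0)) (at 0)"
    by (rule has_field_derivative_transform_within_open[where S = "{-\<epsilon><..<\<epsilon>}"])
      (use smooth_slice(1)[OF G] N \<epsilon> in auto)
  moreover have "dderiv (\<lambda>z. dderiv G z (0, axis i 1)) (0, q) (1, 0)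
      = dderiv (\<lambda>z. dderiv G z (1, 0)) (0, q) (0, axis i 1)"
    by (rule second_derivative_symmetric[OF P(1) G P(2)])
  moreover have "\<dots> = partial i (\<lambda>q. dderiv G (0, q) (1, 0)) q"
    by (rule smooth_slice(1)[OF smooth_on_dderiv[OF G] P(2), symmetric])
  moreover have "\<dots> = partial i \<gamma> q"
    by (rule partial_cong[OF N]) (use DERIV_unique[OF smooth_slice(2)[OF G] \<gamma>] \<epsilon> in auto)
  ultimately show ?thesis by simp
qed

text \<open>The components of a metric of the given shape satisfy three relations: those of \<open>dx\<^sup>2\<close> and \<open>dx dy\<close> vanish, and those
  of \<open>dt dx\<close> and \<open>dy\<^sup>2\<close> are in a fixed ratio. The other two components are free and encode \<open>u\<close> and \<open>v\<close>.\<close>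

lemma g_form_axis:
  "g_form u v (axis 1 1) (axis 1 1) = - (u\<^sup>2 + 4 * v)" "g_form u v (axis 1 1) (axis 2 1) = 2"
  "g_form u v (axis 1 1) (axis 3 1) = u" "g_form u v (axis 2 1) (axis 2 1) = 0"
  "g_form u v (axis 2 1) (axis 3 1) = 0" "g_form u v (axis 3 1) (axis 3 1) = -1"
  by (simp_all add: g_form_def sym_prod_def)

locale shape_preserving_flow =
  fixes X :: "base \<Rightarrow> base" and U N :: "base set" and \<epsilon> :: real and \<phi> :: "real \<Rightarrow> base \<Rightarrow> base"
  assumes U: "open U" and X: "smooth_on U X" and N: "open N" "N \<subseteq> U" and eps: "\<epsilon> > 0"
    and flow: "local_flow X U N \<epsilon> \<phi>" and pres: "flow_preserves_shape U N \<epsilon> \<phi>"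
begin

abbreviation "I \<equiv> {-\<epsilon><..<\<epsilon>}"

definition "P \<tau> q i k = dderiv (\<phi> \<tau>) q (axis i 1) $ k"

lemma smooth_flow: "smooth_on (I \<times> N) (\<lambda>z. \<phi> (fst z) (snd z))"
  using flow by (simp add: local_flow_def case_prod_beta')

lemma smooth_comp: "smooth_on (I \<times> N) (\<lambda>z. \<phi> (fst z) (snd z) $ k)"
  by (rule smooth_on_nth[OF smooth_flow]) (use N in \<open>simp add: open_Times\<close>)

lemma P_partial:
  assumes "\<tau> \<in> I" "q \<in> N"
  shows "P \<tau> q i k = partial i (\<lambda>q. \<phi> \<tau> q $ k) q"
proof -
  have "\<phi> \<tau> differentiable (at q)"
    using smooth_slice_differentiable[OF smooth_flow, of \<tau> q] assms by simp
  then have "(\<phi> \<tau> has_derivative dderiv (\<phi> \<tau>) q) (at q)"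
    using frechet_derivative_works by blast
  from bounded_linear.has_derivative[OF bounded_linear_vec_nth this]
  have "((\<lambda>q. \<phi> \<tau> q $ k) has_derivative (\<lambda>w. dderiv (\<phi> \<tau>) q w $ k)) (at q)" .
  from dderivI[OF this] show ?thesis by (simp add: P_def partial_def)
qed

lemma P_0: "q \<in> N \<Longrightarrow> P 0 q i k = axis i 1 $ k"
proof -
  assume q: "q \<in> N"
  have "dderiv (\<phi> 0) q = dderiv (\<lambda>q. q) q"
    by (rule dderiv_cong[OF N(1) q]) (use flow in \<open>simp add: local_flow_def\<close>)
  then show ?thesis by (simp add: P_def dderivI[OF has_derivative_ident])
qed

lemma DERIV_P:
  assumes "q \<in> N"
  shows "((\<lambda>\<tau>. P \<tau> q i k) has_real_derivative jac X i k q) (at 0)"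
proof -
  have "((\<lambda>\<tau>. \<phi> \<tau> p $ k) has_real_derivative X p $ k) (at 0)" if "p \<in> N" for p
  proof -
    have "((\<lambda>\<tau>. \<phi> \<tau> p) has_vector_derivative X (\<phi> 0 p)) (at 0)" "\<phi> 0 p = p"
      using flow that eps unfolding local_flow_def by (metis greaterThanLessThan_iff neg_less_0_iff_less)+
    then have "((\<lambda>\<tau>. \<phi> \<tau> p) has_vector_derivative X p) (at 0)" by simp
    from bounded_linear.has_vector_derivative[OF bounded_linear_vec_nth this]
    show ?thesis by (simp add: has_real_derivative_iff_has_vector_derivative)
  qed
  then have "((\<lambda>\<tau>. partial i (\<lambda>q. \<phi> \<tau> q $ k) q) has_real_derivative jac X i k q) (at 0)"
    using mixed_time_derivative[OF smooth_comp N(1) assms eps, of k "\<lambda>p. X p $ k"] by simp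
  then show ?thesis
    by (rule has_field_derivative_transform_within_open[where S = I])
      (use P_partial assms eps in auto)
qed

text \<open>The components of \<open>\<phi>\<^sub>\<tau>\<^sup>*g\<close> for the constant functions \<open>u = c\<close> and \<open>v = 0\<close>.\<close>

definition "G c \<tau> q i j = 2 * (P \<tau> q i 1 * P \<tau> q j 2 + P \<tau> q i 2 * P \<tau> q j 1)
  + c * (P \<tau> q i 1 * P \<tau> q j 3 + P \<tau> q i 3 * P \<tau> q j 1) - c\<^sup>2 * P \<tau> q i 1 * P \<tau> q j 1
  - P \<tau> q i 3 * P \<tau> q j 3"

lemma G_pullback: "pullback2 (\<phi> \<tau>) (metric (\<lambda>_. c) (\<lambda>_. 0)) q (axis i 1) (axis j 1) = G c \<tau> q i j"
  by (simp add: pullback2_def metric_def g_form_def sym_prod_def G_def P_def field_simps)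

lemma DERIV_G:
  assumes "q \<in> N"
  shows "((\<lambda>\<tau>. G c \<tau> q i j) has_real_derivative
    2 * (jac X i 1 q * axis j 1 $ 2 + jac X j 2 q * axis i 1 $ 1
      + (jac X i 2 q * axis j 1 $ 1 + jac X j 1 q * axis i 1 $ 2))
    + c * (jac X i 1 q * axis j 1 $ 3 + jac X j 3 q * axis i 1 $ 1
      + (jac X i 3 q * axis j 1 $ 1 + jac X j 1 q * axis i 1 $ 3))
    - c\<^sup>2 * (jac X i 1 q * axis j 1 $ 1 + jac X j 1 q * axis i 1 $ 1)
    - (jac X i 3 q * axis j 1 $ 3 + jac X j 3 q * axis i 1 $ 3)) (at 0)"
  unfolding G_def
  by (rule derivative_eq_intros refl DERIV_P[OF assms])+
    (simp add: P_0[OF assms] algebra_simps)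

text \<open>For constant \<open>u\<close> and \<open>v\<close> the form \<open>\<omega>\<close> vanishes, and its transformation law becomes \<open>\<omega>\<^sup>\<tau> + d log f\<^sup>\<tau> = 0\<close>.\<close>

lemma test_functions:
  obtains f u' v' :: "real \<Rightarrow> base \<Rightarrow> real" where
    "smooth_on (I \<times> N) (\<lambda>(\<tau>, q). f \<tau> q)" "smooth_on (I \<times> N) (\<lambda>(\<tau>, q). u' \<tau> q)"
    "smooth_on (I \<times> N) (\<lambda>(\<tau>, q). v' \<tau> q)"
    "\<And>q. q \<in> N \<Longrightarrow> f 0 q = 1 \<and> u' 0 q = c \<and> v' 0 q = 0"
    "\<And>\<tau> q. \<tau> \<in> I \<Longrightarrow> q \<in> N \<Longrightarrow> f \<tau> q > 0"
    "\<And>\<tau> q i j. \<tau> \<in> I \<Longrightarrow> q \<in> N \<Longrightarrow> G c \<tau> q i j = f \<tau> q * g_form (u' \<tau> q) (v' \<tau> q) (axis i 1) (axis j 1)"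
    "\<And>\<tau> q a. \<tau> \<in> I \<Longrightarrow> q \<in> N \<Longrightarrow>
      weyl_form (u' \<tau>) (v' \<tau>) q a + frechet_derivative (\<lambda>q'. ln (f \<tau> q')) (at q) a = 0"
proof -
  have sm: "smooth_on U (\<lambda>_. c)" "smooth_on U (\<lambda>_. 0 :: real)" by (intro smooth_onI Ck_on_const)+
  have w: "pullback1 (\<phi> \<tau>) (weyl_form (\<lambda>_. c) (\<lambda>_. 0)) q a = 0" for \<tau> q a
    by (simp add: pullback1_def weyl_form_def)
  from pres[unfolded flow_preserves_shape_def, rule_format, OF sm]
  obtain f u' v' where *: "smooth_on (I \<times> N) (\<lambda>(\<tau>, q). f \<tau> q)"
    "smooth_on (I \<times> N) (\<lambda>(\<tau>, q). u' \<tau> q)" "smooth_on (I \<times> N) (\<lambda>(\<tau>, q). v' \<tau> q)"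
    "\<forall>q\<in>N. f 0 q = 1 \<and> u' 0 q = c \<and> v' 0 q = 0"
    "\<forall>\<tau>\<in>I. \<forall>q\<in>N. f \<tau> q > 0 \<and>
       (\<forall>a b. pullback2 (\<phi> \<tau>) (metric (\<lambda>_. c) (\<lambda>_. 0)) q a b = f \<tau> q * metric (u' \<tau>) (v' \<tau>) q a b) \<and>
       (\<forall>a. pullback1 (\<phi> \<tau>) (weyl_form (\<lambda>_. c) (\<lambda>_. 0)) q a
          = weyl_form (u' \<tau>) (v' \<tau>) q a + frechet_derivative (\<lambda>q'. ln (f \<tau> q')) (at q) a)"
    by blast
  show thesis
  proof (rule that[OF *(1-3)])
    show "G c \<tau> q i j = f \<tau> q * g_form (u' \<tau> q) (v' \<tau> q) (axis i 1) (axis j 1)"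
      if "\<tau> \<in> I" "q \<in> N" for \<tau> q i j
      using *(5) that unfolding G_pullback[symmetric] by (auto simp: metric_def)
    show "weyl_form (u' \<tau>) (v' \<tau>) q a + frechet_derivative (\<lambda>q'. ln (f \<tau> q')) (at q) a = 0"
      if "\<tau> \<in> I" "q \<in> N" for \<tau> q a
      using *(5) that w by metis
  qed (use * in auto)
qed

lemma DERIV_at_0_unique:
  assumes "(f has_real_derivative D) (at 0)" "(g has_real_derivative E) (at 0)"
    "\<And>\<tau>. \<tau> \<in> I \<Longrightarrow> f \<tau> = g \<tau>"
  shows "D = E"
proof -
  have "(g has_real_derivative D) (at 0)"
    by (rule has_field_derivative_transform_within_open[OF assms(1), where S = I])
      (use eps assms(3) in auto)
  then show ?thesis using assms(2) DERIV_unique by blast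
qed

text \<open>The three relations between the metric components, differentiated at time zero. The dependence on \<open>c\<close>
  separates \<open>T\<^sub>y\<close> from the other terms.\<close>

lemma first_order:
  assumes q: "q \<in> N"
  shows "jac X 2 1 q = 0" "jac X 3 1 q = 0" "jac X 2 3 q = 0"
    "jac X 2 2 q = 2 * jac X 3 3 q - jac X 1 1 q"
proof -
  have eqs: "G c \<tau> q 2 2 = 0 \<and> G c \<tau> q 2 3 = 0 \<and> G c \<tau> q 1 2 + 2 * G c \<tau> q 3 3 = 0"
    if "\<tau> \<in> I" for c \<tau>
  proof -
    obtain f u' v' :: "real \<Rightarrow> base \<Rightarrow> real" where
      "\<And>\<tau> q i j. \<tau> \<in> I \<Longrightarrow> q \<in> N \<Longrightarrow> G c \<tau> q i j = f \<tau> q * g_form (u' \<tau> q) (v' \<tau> q) (axis i 1) (axis j 1)"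
      by (rule test_functions[of c]) blast
    from this[OF that q] show ?thesis by (simp add: g_form_axis)
  qed
  have 1: "4 * jac X 2 1 q = 0"
    using DERIV_at_0_unique[OF DERIV_G[OF q, of 0 2 2] DERIV_const[of 0]] eqs[of _ 0] by simp
  have 2: "2 * jac X 3 1 q = jac X 2 3 q"
    using DERIV_at_0_unique[OF DERIV_G[OF q, of 0 2 3] DERIV_const[of 0]] eqs[of _ 0] by simp
  have 3: "2 * (jac X 1 1 q + jac X 2 2 q) + c * jac X 2 3 q
      - c\<^sup>2 * jac X 2 1 q + 2 * (2 * c * jac X 3 1 q - 2 * jac X 3 3 q) = 0" for c
    using DERIV_at_0_unique[OF DERIV_add[OF DERIV_G[OF q, of c 1 2] DERIV_cmult[OF DERIV_G[OF q, of c 3 3], of 2]] DERIV_const[of 0]]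
      eqs[of _ c] by (simp add: algebra_simps)
  show "jac X 2 1 q = 0" "jac X 3 1 q = 0" "jac X 2 3 q = 0"
    "jac X 2 2 q = 2 * jac X 3 3 q - jac X 1 1 q"
    using 1 2 3[of 0] 3[of 1] by simp_all
qed

text \<open>For \<open>u = v = 0\<close> the metric determines the velocities of \<open>f\<^sup>\<tau>\<close>, \<open>u\<^sup>\<tau>\<close>, \<open>v\<^sup>\<tau>\<close> at time zero as \<open>2 \<eta>\<^sub>y\<close>,
  \<open>2 \<xi>\<^sub>y - \<eta>\<^sub>t\<close> and \<open>- \<xi>\<^sub>t\<close>. The two components of \<open>\<omega>\<^sup>\<tau> + d log f\<^sup>\<tau> = 0\<close> then give one equation each.\<close>

lemma second_order:
  assumes q: "q \<in> N"
  shows "partial 3 (jac X 3 3) q = 0"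
    "partial 3 (jac X 3 2) q = partial 1 (jac X 2 2) q"
proof -
  have sm: "smooth_on N (\<lambda>p. X p $ k)" for k
    using smooth_on_subset[OF X N(2)] N(1) by (rule smooth_on_nth)
  note sm1 = smooth_on_partial[OF sm]
  note [simp] = smooth_on_differentiable[OF sm1]
  obtain f u' v' where f: "smooth_on (I \<times> N) (\<lambda>(\<tau>, q). f \<tau> q)"
    and u': "smooth_on (I \<times> N) (\<lambda>(\<tau>, q). u' \<tau> q)" and v': "smooth_on (I \<times> N) (\<lambda>(\<tau>, q). v' \<tau> q)"
    and init: "\<And>q. q \<in> N \<Longrightarrow> f 0 q = 1 \<and> u' 0 q = 0 \<and> v' 0 q = 0"
    and pos: "\<And>\<tau> q. \<tau> \<in> I \<Longrightarrow> q \<in> N \<Longrightarrow> f \<tau> q > 0"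
    and G: "\<And>\<tau> q i j. \<tau> \<in> I \<Longrightarrow> q \<in> N \<Longrightarrow> G 0 \<tau> q i j = f \<tau> q * g_form (u' \<tau> q) (v' \<tau> q) (axis i 1) (axis j 1)"
    and weyl: "\<And>\<tau> q a. \<tau> \<in> I \<Longrightarrow> q \<in> N \<Longrightarrow>
      weyl_form (u' \<tau>) (v' \<tau>) q a + frechet_derivative (\<lambda>q'. ln (f \<tau> q')) (at q) a = 0"
    by (rule test_functions[of 0]) blast
  have I0: "0 \<in> I" using eps by simp
  have \<tau>: "((\<lambda>\<tau>. h \<tau> p) has_real_derivative dderiv (\<lambda>(\<tau>, q). h \<tau> q) (0, p) (1, 0)) (at 0)"
    if "smooth_on (I \<times> N) (\<lambda>(\<tau>, q). h \<tau> q)" "p \<in> N" for h p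
    using smooth_slice(2)[OF that(1), of 0 p] that(2) I0 by simp
  have f\<tau>: "((\<lambda>\<tau>. f \<tau> p) has_real_derivative 2 * jac X 3 3 p) (at 0)" if p: "p \<in> N" for p
  proof -
    have "dderiv (\<lambda>(\<tau>, q). f \<tau> q) (0, p) (1, 0) = 2 * jac X 3 3 p"
      using DERIV_at_0_unique[OF \<tau>[OF f p] DERIV_minus[OF DERIV_G[OF p, of 0 3 3]]] G[OF _ p]
      by (simp add: g_form_axis)
    then show ?thesis using \<tau>[OF f p] by simp
  qed
  have u'\<tau>: "((\<lambda>\<tau>. u' \<tau> p) has_real_derivative 2 * jac X 3 2 p - jac X 1 3 p) (at 0)"
    if p: "p \<in> N" for p
  proof -
    have "dderiv (\<lambda>(\<tau>, q). u' \<tau> q) (0, p) (1, 0) = 2 * jac X 3 2 p - jac X 1 3 p"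
      using DERIV_at_0_unique[OF DERIV_mult[OF \<tau>[OF f p] \<tau>[OF u' p]] DERIV_G[OF p, of 0 1 3]] G[OF _ p] init[OF p]
      by (simp add: g_form_axis)
    then show ?thesis using \<tau>[OF u' p] by simp
  qed
  have v'\<tau>: "((\<lambda>\<tau>. v' \<tau> p) has_real_derivative (- 1) * jac X 1 2 p) (at 0)"
    if p: "p \<in> N" for p
  proof -
    have "((\<lambda>\<tau>. f \<tau> p * (u' \<tau> p * u' \<tau> p + 4 * v' \<tau> p)) has_real_derivative
        4 * dderiv (\<lambda>(\<tau>, q). v' \<tau> q) (0, p) (1, 0)) (at 0)"
      by (rule derivative_eq_intros refl \<tau>[OF f p] \<tau>[OF u' p] \<tau>[OF v' p])+ (simp add: init[OF p])
    from DERIV_at_0_unique[OF this DERIV_minus[OF DERIV_G[OF p, of 0 1 1]]] G[OF _ p]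
    have "dderiv (\<lambda>(\<tau>, q). v' \<tau> q) (0, p) (1, 0) = - jac X 1 2 p"
      by (simp add: g_form_axis power2_eq_square algebra_simps)
    then show ?thesis using \<tau>[OF v' p] by simp
  qed
  have mixed: "((\<lambda>\<tau>. partial i (h \<tau>) q) has_real_derivative partial i \<gamma> q) (at 0)"
    if "smooth_on (I \<times> N) (\<lambda>(\<tau>, q). h \<tau> q)"
      "\<And>p. p \<in> N \<Longrightarrow> ((\<lambda>\<tau>. h \<tau> p) has_real_derivative \<gamma> p) (at 0)" for h \<gamma> i
    using mixed_time_derivative[OF that(1) N(1) q eps, of \<gamma> i] that(2) by simp
  have ln: "frechet_derivative (\<lambda>q'. ln (f \<tau> q')) (at q) (axis i 1) = partial i (f \<tau>) q / f \<tau> q"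
    if "\<tau> \<in> I" for \<tau> i
  proof -
    have "f \<tau> differentiable (at q)"
      using smooth_slice_differentiable[OF f, of \<tau> q] that q by simp
    then have "(f \<tau> has_derivative dderiv (f \<tau>) q) (at q)" using frechet_derivative_works by blast
    from has_derivative_ln[OF pos[OF that q] this]
    have "((\<lambda>q'. ln (f \<tau> q')) has_derivative (\<lambda>w. dderiv (f \<tau>) q w * (1 / f \<tau> q))) (at q)"
      by (simp add: divide_inverse)
    from dderivI[OF this] show ?thesis by (simp add: partial_def)
  qed
  have u'0: "partial i (u' 0) q = 0" "partial i (v' 0) q = 0" "partial i (f 0) q = 0" for i
    using partial_eq_0[OF N(1) q] init by blast+
  have 3: "f \<tau> q * partial 2 (u' \<tau>) q - partial 3 (f \<tau>) q = 0"
    and 1: "f \<tau> q * (u' \<tau> q * partial 2 (u' \<tau>) q + 2 * partial 3 (u' \<tau>) q + 4 * partial 2 (v' \<tau>) q)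
      + partial 1 (f \<tau>) q = 0" if "\<tau> \<in> I" for \<tau>
    using weyl[OF that q, of "axis 3 1"] weyl[OF that q, of "axis 1 1"] pos[OF that q]
    by (simp_all add: weyl_form_def ln[OF that] field_simps)
  note Du = mixed[OF u' u'\<tau>] and Dv = mixed[OF v' v'\<tau>] and Df = mixed[OF f f\<tau>]
  note comm = partial_commute[OF N(1) sm q]
  have p: "partial i (\<lambda>p. 2 * jac X 3 2 p - jac X 1 3 p) q
      = 2 * partial i (jac X 3 2) q - partial i (jac X 1 3) q"
    "partial i (\<lambda>p. 2 * jac X 3 3 p) q = 2 * partial i (jac X 3 3) q"
    "partial i (\<lambda>p. (- 1) * jac X 1 2 p) q = (- 1) * partial i (jac X 1 2) q" for i
    using q by (simp_all only: partial_diff partial_cmult smooth_on_differentiable[OF sm1]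
        differentiable_mult differentiable_const)
  have A: "2 * partial 2 (jac X 3 2) q - partial 2 (jac X 1 3) q
      - 2 * partial 3 (jac X 3 3) q = 0"
    using DERIV_at_0_unique[OF DERIV_diff[OF DERIV_mult[OF f\<tau>[OF q] Du[of 2]] Df[of 3]] DERIV_const 3] init[OF q]
    by (simp only: u'0 p mult_zero_right mult_1_right add_0_left)
  have "partial 3 (jac X 2 2) q
      = partial 3 (\<lambda>p. 2 * jac X 3 3 p - jac X 1 1 p) q"
    by (rule partial_cong[OF N(1) q first_order(4)])
  also have "\<dots> = 2 * partial 3 (jac X 3 3) q - partial 3 (jac X 1 1) q"
    using q by (simp add: partial_diff partial_cmult)
  also have "partial 3 (jac X 1 1) q = 0"
    using comm[of 3 1 1] partial_eq_0[OF N(1) q first_order(2)] by simp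
  finally have "partial 2 (jac X 3 2) q = 2 * partial 3 (jac X 3 3) q"
    using comm[of 2 3 2] by simp
  moreover have "partial 2 (jac X 1 3) q = 0"
    using comm[of 2 1 3] partial_eq_0[OF N(1) q first_order(3)] by simp
  ultimately show "partial 3 (jac X 3 3) q = 0" using A by simp
  have "2 * (2 * partial 3 (jac X 3 2) q - partial 3 (jac X 1 3) q)
      + 4 * ((- 1) * partial 2 (jac X 1 2) q) + 2 * partial 1 (jac X 3 3) q = 0"
    using DERIV_at_0_unique[OF DERIV_add[OF DERIV_mult[OF f\<tau>[OF q] DERIV_add[OF DERIV_add[OF
        DERIV_mult[OF u'\<tau>[OF q] Du[of 2]] DERIV_cmult[OF Du[of 3], of 2]] DERIV_cmult[OF Dv[of 2], of 4]]]
        Df[of 1]] DERIV_const 1] init[OF q]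
    by (simp only: u'0 p mult_zero_right mult_1_right add_0_left add_0_right)
  then
  show "partial 3 (jac X 3 2) q = partial 1 (jac X 2 2) q"
    using comm[of 2 1 2] comm[of 3 1 3] by simp
qed

end

theorem shape_fields_imp_shape_system:
  assumes "X \<in> shape_fields U" "open U"
  shows "shape_system U X"
  unfolding shape_system_def
proof (intro conjI ballI)
  show X: "smooth_on U X" using assms by (simp add: shape_fields_def)
  fix p assume "p \<in> U"
  then obtain N \<epsilon> \<phi> where nb: "open N" "p \<in> N" "N \<subseteq> U" "\<epsilon> > 0" "local_flow X U N \<epsilon> \<phi>"
    "flow_preserves_shape U N \<epsilon> \<phi>"
    using assms(1) unfolding shape_fields_def by blast
  interpret shape_preserving_flow X U N \<epsilon> \<phi>
    by unfold_locales (use nb X assms in auto)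
  note first_order[OF nb(2)] second_order[OF nb(2)]
  then show "jac X 2 1 p = 0" "jac X 3 1 p = 0" "jac X 2 3 p = 0"
    "jac X 2 2 p = 2 * jac X 3 3 p - jac X 1 1 p"
    "partial 3 (jac X 3 3) p = 0"
    "partial 3 (jac X 3 2) p = partial 1 (jac X 2 2) p" .
qed

section \<open>The lift\<close>

text \<open>The coefficients \<open>A\<close> and \<open>B\<close> of the lift \<open>X + A \<partial>\<^sub>u + B \<partial>\<^sub>v\<close>.\<close>

definition lift_u :: "(base \<Rightarrow> base) \<Rightarrow> total \<Rightarrow> real" where
  "lift_u X z = (jac X 3 3 (fst z) - jac X 1 1 (fst z)) * snd z $ 1
    + (jac X 1 3 (fst z) - 2 * jac X 3 2 (fst z))"

definition lift_v :: "(base \<Rightarrow> base) \<Rightarrow> total \<Rightarrow> real" where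
  "lift_v X z = 2 * (jac X 3 3 (fst z) - jac X 1 1 (fst z)) * snd z $ 2
    + jac X 3 2 (fst z) * snd z $ 1 + jac X 1 2 (fst z)"

lemma open_fst_image: "open (W :: ('a::topological_space \<times> 'b::topological_space) set) \<Longrightarrow> open (fst ` W)"
  by (rule open_image_fst)

lemma dderiv_base_field:
  assumes W: "open W" "z \<in> W" and Y: "smooth_on W Y" and X: "smooth_on (fst ` W) X"
    and YX: "\<And>z. z \<in> W \<Longrightarrow> fst (Y z) = X (fst z)"
  shows "fst (dderiv Y z a) $ k = (\<Sum>i\<in>UNIV. fst a $ i * jac X i k (fst z))"
proof -
  have p: "fst z \<in> fst ` W" using W by blast
  have "((\<lambda>z. fst (Y z)) has_derivative (\<lambda>a. fst (dderiv Y z a))) (at z)"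
    by (rule bounded_linear.has_derivative[OF bounded_linear_fst smooth_on_has_derivative[OF Y W(2)]])
  then have "((\<lambda>z. X (fst z)) has_derivative (\<lambda>a. fst (dderiv Y z a))) (at z)"
    by (rule has_derivative_transform_within_open[OF _ W]) (simp add: YX)
  moreover have "((\<lambda>z. X (fst z)) has_derivative (\<lambda>a. dderiv X (fst z) (fst a))) (at z)"
    by (rule has_derivative_compose[OF bounded_linear.has_derivative[OF bounded_linear_fst has_derivative_ident]
          smooth_on_has_derivative[OF X p]])
  ultimately have "fst (dderiv Y z a) = dderiv X (fst z) (fst a)"
    using has_derivative_unique by metis
  moreover have "dderiv X (fst z) (fst a) $ k = dderiv (\<lambda>p. X p $ k) (fst z) (fst a)"
    using dderivI[OF bounded_linear.has_derivative[OF bounded_linear_vec_nth smooth_on_has_derivative[OF X p]]]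
    by simp
  moreover have "(\<lambda>p. X p $ k) differentiable (at (fst z))"
    using bounded_linear.has_derivative[OF bounded_linear_vec_nth smooth_on_has_derivative[OF X p]]
    unfolding differentiable_def by blast
  ultimately show ?thesis by (simp add: dderiv_partials)
qed

lemma lie_deriv_g_hat:
  "lie_deriv Y g_hat z a b =
    2 * (snd (Y z) $ 1) * sym_prod dt dy (fst a) (fst b)
    - (2 * (snd z $ 1) * (snd (Y z) $ 1) + 4 * (snd (Y z) $ 2)) * sym_prod dt dt (fst a) (fst b)
    + g_form (snd z $ 1) (snd z $ 2) (fst (dderiv Y z a)) (fst b)
    + g_form (snd z $ 1) (snd z $ 2) (fst a) (fst (dderiv Y z b))"
proof -
  have c: "((\<lambda>z' :: total. snd z' $ k) has_derivative (\<lambda>w. snd w $ k)) (at z)" for k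
    by (intro bounded_linear.has_derivative[OF bounded_linear_vec_nth]
        bounded_linear.has_derivative[OF bounded_linear_snd has_derivative_ident])
  have "((\<lambda>z'. g_hat z' a b) has_derivative (\<lambda>w. 2 * (snd w $ 1) * sym_prod dt dy (fst a) (fst b)
    - (2 * (snd z $ 1) * (snd w $ 1) + 4 * (snd w $ 2)) * sym_prod dt dt (fst a) (fst b))) (at z)"
    unfolding g_hat_def g_form_def power2_eq_square
    by (rule has_derivative_eq_rhs, (rule c derivative_eq_intros refl)+) (simp add: fun_eq_iff algebra_simps)
  from dderivI[OF this] show ?thesis by (simp add: lie_deriv_def g_hat_def)
qed

text \<open>The component \<open>dy\<^sup>2\<close> of \<open>L\<^sub>Y g = \<chi> g\<close> gives \<open>\<chi> = 2 \<eta>\<^sub>y\<close>, then \<open>dt dy\<close> gives \<open>A\<close> and \<open>dt\<^sup>2\<close> gives \<open>B\<close>. The remaining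
  components hold because of the equations for \<open>X\<close>.\<close>

lemma lift_coefficients:
  assumes W: "open W" and Y: "smooth_on W Y" and X: "shape_system (fst ` W) X"
    and YX: "\<And>z. z \<in> W \<Longrightarrow> fst (Y z) = X (fst z)"
  shows "(\<exists>c::total \<Rightarrow> real. \<forall>z\<in>W. \<forall>a b. lie_deriv Y g_hat z a b = c z * g_hat z a b) \<longleftrightarrow>
    (\<forall>z\<in>W. snd (Y z) $ 1 = lift_u X z \<and> snd (Y z) $ 2 = lift_v X z)"
    (is "(\<exists>c. \<forall>z\<in>W. \<forall>a b. ?L z a b = _) \<longleftrightarrow> _")
proof -
  have smX: "smooth_on (fst ` W) X" using X by (simp add: shape_system_def)
  let ?P = "\<lambda>z i k. jac X i k (fst z)"
  have S: "?P z 2 1 = 0 \<and> ?P z 3 1 = 0 \<and> ?P z 2 3 = 0 \<and> ?P z 2 2 = 2 * ?P z 3 3 - ?P z 1 1"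
    if "z \<in> W" for z using X that by (auto simp: shape_system_def)
  have D: "fst (dderiv Y z a) $ 1 = fst a $ 1 * ?P z 1 1"
    "fst (dderiv Y z a) $ 2 = fst a $ 1 * ?P z 1 2 + fst a $ 2 * (2 * ?P z 3 3 - ?P z 1 1) + fst a $ 3 * ?P z 3 2"
    "fst (dderiv Y z a) $ 3 = fst a $ 1 * ?P z 1 3 + fst a $ 3 * ?P z 3 3"
    if "z \<in> W" for z a
    using dderiv_base_field[OF W that Y smX YX] S[OF that] by (simp_all add: sum_3)
  show ?thesis
  proof
    assume "\<exists>c. \<forall>z\<in>W. \<forall>a b. ?L z a b = c z * g_hat z a b"
    then obtain c where c: "\<And>z a b. z \<in> W \<Longrightarrow> ?L z a b = c z * g_hat z a b" by blast
    show "\<forall>z\<in>W. snd (Y z) $ 1 = lift_u X z \<and> snd (Y z) $ 2 = lift_v X z"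
    proof
      fix z assume z: "z \<in> W"
      note e = c[OF z, unfolded lie_deriv_g_hat g_hat_def g_form_def sym_prod_def]
      have cz: "c z = 2 * ?P z 3 3"
        using e[of "(axis 3 1, 0)" "(axis 3 1, 0)"] by (simp add: D[OF z])
      have A: "snd (Y z) $ 1 = lift_u X z"
        using e[of "(axis 1 1, 0)" "(axis 3 1, 0)"] by (simp add: D[OF z] cz lift_u_def algebra_simps)
      have "2 * (?P z 1 2 * 2 + ?P z 1 3 * snd z $ 1 - ((snd z $ 1)\<^sup>2 + 4 * snd z $ 2) * ?P z 1 1)
          - (2 * snd z $ 1 * snd (Y z) $ 1 + 4 * snd (Y z) $ 2)
          = - (2 * ?P z 3 3 * ((snd z $ 1)\<^sup>2 + 4 * snd z $ 2))"
        using e[of "(axis 1 1, 0)" "(axis 1 1, 0)"] by (simp add: D[OF z] cz algebra_simps)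
      then have "snd (Y z) $ 2 = lift_v X z"
        by (simp add: A lift_u_def lift_v_def power2_eq_square algebra_simps)
      then show "snd (Y z) $ 1 = lift_u X z \<and> snd (Y z) $ 2 = lift_v X z" using A by simp
    qed
  next
    assume AB: "\<forall>z\<in>W. snd (Y z) $ 1 = lift_u X z \<and> snd (Y z) $ 2 = lift_v X z"
    have "?L z a b = 2 * ?P z 3 3 * g_hat z a b" if z: "z \<in> W" for z a b
    proof -
      have A: "snd (Y z) $ 1 = lift_u X z" and B: "snd (Y z) $ 2 = lift_v X z" using AB z by auto
      show ?thesis
        unfolding lie_deriv_g_hat g_hat_def g_form_def sym_prod_def A B lift_u_def lift_v_def D[OF z]
        by (simp add: power2_eq_square field_simps)
    qed
    then show "\<exists>c. \<forall>z\<in>W. \<forall>a b. ?L z a b = c z * g_hat z a b"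
      by (intro exI[of _ "\<lambda>z. 2 * ?P z 3 3"]) blast
  qed
qed

section \<open>Tangency to the equation manifold\<close>

lemma has_derivative_jet_coords:
  "((\<lambda>j :: jet1. snd (fst j) $ a) has_derivative (\<lambda>w. snd (fst w) $ a)) F"
  "((\<lambda>j :: jet1. snd j $ a $ i) has_derivative (\<lambda>w. snd w $ a $ i)) F"
  by (intro bounded_linear.has_derivative[OF bounded_linear_vec_nth]
        bounded_linear.has_derivative[OF bounded_linear_snd] bounded_linear.has_derivative[OF bounded_linear_fst]
        has_derivative_ident)+

lemma F1_eq: "F1 ((z, q), r) = r $ 1 $ 1 $ 2 + q $ 1 $ 2 * q $ 1 $ 3 + snd z $ 1 * r $ 1 $ 3 $ 2
    + q $ 2 $ 2 * q $ 1 $ 2 + snd z $ 2 * r $ 1 $ 2 $ 2 - r $ 1 $ 3 $ 3"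
proof -
  have "((\<lambda>j. jet_ud 1 j + jet_u j * jet_ud 3 j + jet_v j * jet_ud 2 j) has_derivative
      (\<lambda>w. jet_ud 1 w + (snd z $ 1 * jet_ud 3 w + jet_u w * q $ 1 $ 3)
        + (snd z $ 2 * jet_ud 2 w + jet_v w * q $ 1 $ 2))) (at (z, q))"
    by (rule has_derivative_eq_rhs, (rule has_derivative_jet_coords derivative_eq_intros refl)+) simp
  from dderivI[OF this] dderivI[OF has_derivative_jet_coords(2)[of 1 3 "at (z, q)"]]
  show ?thesis by (simp add: F1_def total_deriv2_def)
qed

lemma F2_eq: "F2 ((z, q), r) = r $ 2 $ 1 $ 2 + q $ 2 $ 2 * q $ 2 $ 2 + snd z $ 2 * r $ 2 $ 2 $ 2
    - q $ 1 $ 2 * q $ 2 $ 3 - snd z $ 1 * r $ 2 $ 3 $ 2 - r $ 2 $ 3 $ 3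
    + 2 * (q $ 1 $ 3 * q $ 2 $ 2 + snd z $ 1 * r $ 2 $ 2 $ 3)"
proof -
  have "((\<lambda>j. jet_vd 1 j + jet_v j * jet_vd 2 j - jet_u j * jet_vd 3 j) has_derivative
      (\<lambda>w. jet_vd 1 w + (snd z $ 2 * jet_vd 2 w + jet_v w * q $ 2 $ 2)
        - (snd z $ 1 * jet_vd 3 w + jet_u w * q $ 2 $ 3))) (at (z, q))"
    by (rule has_derivative_eq_rhs, (rule has_derivative_jet_coords derivative_eq_intros refl)+) simp
  moreover have "((\<lambda>j. jet_vd 3 j - 2 * jet_u j * jet_vd 2 j) has_derivative
      (\<lambda>w. jet_vd 3 w - 2 * (snd z $ 1 * jet_vd 2 w + jet_u w * q $ 2 $ 2))) (at (z, q))"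
    by (rule has_derivative_eq_rhs, (rule has_derivative_jet_coords derivative_eq_intros refl)+)
      (simp add: algebra_simps)
  ultimately show ?thesis
    by (simp add: F2_def total_deriv2_def dderivI algebra_simps)
qed

text \<open>The differentials of \<open>F1\<close> and \<open>F2\<close>, and their quadratic parts.\<close>

definition dF1 :: "jet2 \<Rightarrow> jet2 \<Rightarrow> real" where
  "dF1 = (\<lambda>((z, q), r) ((zw, qw), rw). rw $ 1 $ 1 $ 2
    + (qw $ 1 $ 2 * q $ 1 $ 3 + q $ 1 $ 2 * qw $ 1 $ 3) + (snd zw $ 1 * r $ 1 $ 3 $ 2 + snd z $ 1 * rw $ 1 $ 3 $ 2)
    + (qw $ 2 $ 2 * q $ 1 $ 2 + q $ 2 $ 2 * qw $ 1 $ 2) + (snd zw $ 2 * r $ 1 $ 2 $ 2 + snd z $ 2 * rw $ 1 $ 2 $ 2)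
    - rw $ 1 $ 3 $ 3)"

definition dF2 :: "jet2 \<Rightarrow> jet2 \<Rightarrow> real" where
  "dF2 = (\<lambda>((z, q), r) ((zw, qw), rw). rw $ 2 $ 1 $ 2
    + (qw $ 2 $ 2 * q $ 2 $ 2 + q $ 2 $ 2 * qw $ 2 $ 2) + (snd zw $ 2 * r $ 2 $ 2 $ 2 + snd z $ 2 * rw $ 2 $ 2 $ 2)
    - (qw $ 1 $ 2 * q $ 2 $ 3 + q $ 1 $ 2 * qw $ 2 $ 3) - (snd zw $ 1 * r $ 2 $ 3 $ 2 + snd z $ 1 * rw $ 2 $ 3 $ 2)
    - rw $ 2 $ 3 $ 3 + 2 * (qw $ 1 $ 3 * q $ 2 $ 2 + q $ 1 $ 3 * qw $ 2 $ 2
      + (snd zw $ 1 * r $ 2 $ 2 $ 3 + snd z $ 1 * rw $ 2 $ 2 $ 3)))"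

definition quad1 :: "jet2 \<Rightarrow> real" where
  "quad1 = (\<lambda>((z, q), r). q $ 1 $ 2 * q $ 1 $ 3 + snd z $ 1 * r $ 1 $ 3 $ 2
    + q $ 2 $ 2 * q $ 1 $ 2 + snd z $ 2 * r $ 1 $ 2 $ 2)"

definition quad2 :: "jet2 \<Rightarrow> real" where
  "quad2 = (\<lambda>((z, q), r). q $ 2 $ 2 * q $ 2 $ 2 + snd z $ 2 * r $ 2 $ 2 $ 2
    - q $ 1 $ 2 * q $ 2 $ 3 - snd z $ 1 * r $ 2 $ 3 $ 2
    + 2 * (q $ 1 $ 3 * q $ 2 $ 2 + snd z $ 1 * r $ 2 $ 2 $ 3))"

text \<open>\<open>F1\<close> and \<open>F2\<close> are affine in \<open>u\<^sub>t\<^sub>x\<close> and \<open>v\<^sub>t\<^sub>x\<close> with coefficient one. Moving these two coordinates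
  corrects the second-order deviation of a straight line from \<open>E2\<close>.\<close>

definition tx_jet :: "real \<Rightarrow> real \<Rightarrow> jet2" where
  "tx_jet c d = (((0, 0), 0), \<chi> a i k. if (i = 1 \<and> k = 2) \<or> (i = 2 \<and> k = 1) then (if a = 1 then c else d) else 0)"

lemma F_along_parabola:
  "F1 (j + s *\<^sub>R w + s\<^sup>2 *\<^sub>R tx_jet c d) = F1 j + s * dF1 j w + s\<^sup>2 * (quad1 w + c)"
  "F2 (j + s *\<^sub>R w + s\<^sup>2 *\<^sub>R tx_jet c d) = F2 j + s * dF2 j w + s\<^sup>2 * (quad2 w + d)"
proof -
  obtain z q r where j: "j = ((z, q), r)" by (metis prod.collapse)
  obtain zw qw rw where w: "w = ((zw, qw), rw)" by (metis prod.collapse)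
  show "F1 (j + s *\<^sub>R w + s\<^sup>2 *\<^sub>R tx_jet c d) = F1 j + s * dF1 j w + s\<^sup>2 * (quad1 w + c)"
    "F2 (j + s *\<^sub>R w + s\<^sup>2 *\<^sub>R tx_jet c d) = F2 j + s * dF2 j w + s\<^sup>2 * (quad2 w + d)"
    unfolding j w
    by (simp_all add: F1_eq F2_eq dF1_def dF2_def quad1_def quad2_def tx_jet_def power2_eq_square algebra_simps)
qed

text \<open>As \<open>F1\<close> and \<open>F2\<close> have degree two, an explicit parabola inside \<open>E2\<close> realises every admissible velocity.\<close>

lemma tangent_to_E2:
  assumes j: "j \<in> E2"
  shows "tangent_to E2 j w \<Longrightarrow> dF1 j w = 0 \<and> dF2 j w = 0"
    and "w \<in> J2 \<Longrightarrow> dF1 j w = 0 \<Longrightarrow> dF2 j w = 0 \<Longrightarrow> tangent_to E2 j w"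
proof -
  assume "tangent_to E2 j w"
  then obtain \<epsilon> and \<gamma> :: "real \<Rightarrow> jet2" where \<epsilon>: "\<epsilon> > 0" and \<gamma>: "\<gamma> ` {-\<epsilon><..<\<epsilon>} \<subseteq> E2" "\<gamma> 0 = j"
    and d: "(\<gamma> has_vector_derivative w) (at 0)"
    unfolding tangent_to_def by blast
  have r: "((\<lambda>s. snd (\<gamma> s) $ a $ i $ k) has_real_derivative snd w $ a $ i $ k) (at 0)"
    and q: "((\<lambda>s. snd (fst (\<gamma> s)) $ a $ i) has_real_derivative snd (fst w) $ a $ i) (at 0)"
    and z: "((\<lambda>s. snd (fst (fst (\<gamma> s))) $ a) has_real_derivative snd (fst (fst w)) $ a) (at 0)" for a i k
    unfolding has_real_derivative_iff_has_vector_derivative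
    by (intro bounded_linear.has_vector_derivative[OF bounded_linear_vec_nth]
        bounded_linear.has_vector_derivative[OF bounded_linear_snd]
        bounded_linear.has_vector_derivative[OF bounded_linear_fst] d)+
  have F1': "F1 k = F1 ((fst (fst k), snd (fst k)), snd k)" and F2': "F2 k = F2 ((fst (fst k), snd (fst k)), snd k)"
    for k by simp_all
  have "((\<lambda>s. F1 (\<gamma> s)) has_real_derivative dF1 j w) (at 0)"
    unfolding F1'[of "\<gamma> _"] F1_eq
    by (rule DERIV_cong, (rule derivative_eq_intros refl r q z)+)
      (simp add: dF1_def case_prod_beta \<gamma> algebra_simps)
  moreover have "((\<lambda>s. F2 (\<gamma> s)) has_real_derivative dF2 j w) (at 0)"
    unfolding F2'[of "\<gamma> _"] F2_eq
    by (rule DERIV_cong, (rule derivative_eq_intros refl r q z)+)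
      (simp add: dF2_def case_prod_beta \<gamma> algebra_simps)
  moreover have zero: "F1 (\<gamma> s) = 0" "F2 (\<gamma> s) = 0" if "s \<in> {-\<epsilon><..<\<epsilon>}" for s
  proof -
    have "\<gamma> s \<in> E2" using \<gamma>(1) that by blast
    then show "F1 (\<gamma> s) = 0" "F2 (\<gamma> s) = 0" by (simp_all add: E2_def)
  qed
  moreover have "((\<lambda>s. 0) has_real_derivative D) (at 0)"
    if "(f has_real_derivative D) (at 0)" "\<And>s. s \<in> {-\<epsilon><..<\<epsilon>} \<Longrightarrow> f s = 0" for f D
    by (rule has_field_derivative_transform_within_open[OF that(1), where S = "{-\<epsilon><..<\<epsilon>}"]) (use \<epsilon> that in auto)
  ultimately show "dF1 j w = 0 \<and> dF2 j w = 0" using DERIV_unique[OF DERIV_const] by metis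
next
  assume w: "w \<in> J2" "dF1 j w = 0" "dF2 j w = 0"
  let ?\<gamma> = "\<lambda>s. j + s *\<^sub>R w + s\<^sup>2 *\<^sub>R tx_jet (- quad1 w) (- quad2 w)"
  have "?\<gamma> s \<in> J2" for s
    using w(1) j by (auto simp: E2_def J2_def tx_jet_def case_prod_beta)
  then have "?\<gamma> s \<in> E2" for s
    using j w by (simp add: E2_def F_along_parabola)
  moreover have "smooth_on {-1<..<1} ?\<gamma>"
    by (intro smooth_onI Ck_on_add Ck_on_scaleR Ck_on_power Ck_on_const Ck_on_id) auto
  moreover have "(?\<gamma> has_vector_derivative w) (at 0)"
    by (auto intro!: derivative_eq_intros simp: has_vector_derivative_def)
  ultimately show "tangent_to E2 j w"
    unfolding tangent_to_def by (intro exI[of _ 1] conjI exI[of _ ?\<gamma>]) auto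
qed

section \<open>Prolongation of fields that are affine in the fibre coordinates\<close>

lemma axis2_nth [simp]:
  "(axis 1 c :: real ^ 2) $ 1 = c" "(axis 1 c :: real ^ 2) $ 2 = 0"
  "(axis 2 c :: real ^ 2) $ 1 = 0" "(axis 2 c :: real ^ 2) $ 2 = c"
  by (simp_all add: axis_def)

lemma total_deriv1_cong:
  "open W \<Longrightarrow> z \<in> W \<Longrightarrow> (\<And>z. z \<in> W \<Longrightarrow> f z = g z) \<Longrightarrow> total_deriv1 i f (z, q) = total_deriv1 i g (z, q)"
  unfolding total_deriv1_def by (simp add: dderiv_cong[of W z f g])

lemma has_derivative_base:
  assumes "f differentiable (at (fst z))"
  shows "((\<lambda>z :: total. f (fst z)) has_derivative
    (\<lambda>w. fst w $ 1 * partial 1 f (fst z) + fst w $ 2 * partial 2 f (fst z) + fst w $ 3 * partial 3 f (fst z))) (at z)"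
proof -
  have "(f has_derivative dderiv f (fst z)) (at (fst z))"
    using assms frechet_derivative_works by blast
  from has_derivative_compose[OF bounded_linear.has_derivative[OF bounded_linear_fst has_derivative_ident] this]
  show ?thesis by (simp add: dderiv_partials[OF assms] sum_3)
qed

lemma has_derivative_fibre:
  "((\<lambda>z :: total. snd z $ b) has_derivative (\<lambda>w. snd w $ b)) F"
  by (intro bounded_linear.has_derivative[OF bounded_linear_vec_nth]
      bounded_linear.has_derivative[OF bounded_linear_snd has_derivative_ident])

lemma has_derivative_base_jet:
  assumes "f differentiable (at (fst z))"
  shows "((\<lambda>j :: jet1. f (fst (fst j))) has_derivative
    (\<lambda>w. fst (fst w) $ 1 * partial 1 f (fst z) + fst (fst w) $ 2 * partial 2 f (fst z)
      + fst (fst w) $ 3 * partial 3 f (fst z))) (at (z, q))"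
proof -
  have "((\<lambda>z :: total. f (fst z)) has_derivative
    (\<lambda>w. fst w $ 1 * partial 1 f (fst z) + fst w $ 2 * partial 2 f (fst z) + fst w $ 3 * partial 3 f (fst z)))
    (at (fst (z, q)))"
    using has_derivative_base[OF assms] by simp
  from has_derivative_compose[OF bounded_linear.has_derivative[OF bounded_linear_fst has_derivative_ident] this]
  show ?thesis .
qed

lemma axis3_mult:
  "(axis i 1 :: base) $ 1 * a 1 + (axis i 1 :: base) $ 2 * a 2 + (axis i 1 :: base) $ 3 * a 3 = (a i :: real)"
  using exhaust_3[of i] by auto

text \<open>The form that lifts have: affine in the fibre coordinates, with twice the same factor in front of \<open>v\<close> as
  in front of \<open>u\<close>. The coefficients are arbitrary here, since the prolongation is needed before the equations
  for \<open>X\<close> are known.\<close>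

locale affine_field =
  fixes W :: "total set" and Y :: "total \<Rightarrow> total" and X :: "base \<Rightarrow> base" and \<alpha> \<beta> \<gamma> \<delta> :: "base \<Rightarrow> real"
  assumes W: "open W" and X: "smooth_on (fst ` W) X"
    and coeffs: "smooth_on (fst ` W) \<alpha>" "smooth_on (fst ` W) \<beta>" "smooth_on (fst ` W) \<gamma>" "smooth_on (fst ` W) \<delta>"
    and YX: "\<And>z. z \<in> W \<Longrightarrow> fst (Y z) = X (fst z)"
    and Yu: "\<And>z. z \<in> W \<Longrightarrow> snd (Y z) $ 1 = \<alpha> (fst z) * snd z $ 1 + \<beta> (fst z)"
    and Yv: "\<And>z. z \<in> W \<Longrightarrow> snd (Y z) $ 2 = 2 * (\<alpha> (fst z) * snd z $ 2) + \<gamma> (fst z) * snd z $ 1 + \<delta> (fst z)"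
begin

lemma U: "open (fst ` W)" using W by (rule open_fst_image)

lemma XC: "smooth_on (fst ` W) (\<lambda>p. X p $ k)" by (rule smooth_on_nth[OF X U])

lemma total_deriv1_affine:
  assumes z: "z \<in> W"
  shows "total_deriv1 i (\<lambda>z. fst (Y z) $ k) (z, q) = jac X i k (fst z)"
    "total_deriv1 i (\<lambda>z. snd (Y z) $ 1) (z, q)
      = partial i \<alpha> (fst z) * snd z $ 1 + partial i \<beta> (fst z) + \<alpha> (fst z) * q $ 1 $ i"
    "total_deriv1 i (\<lambda>z. snd (Y z) $ 2) (z, q)
      = 2 * (partial i \<alpha> (fst z) * snd z $ 2) + partial i \<gamma> (fst z) * snd z $ 1 + partial i \<delta> (fst z)
        + \<gamma> (fst z) * q $ 1 $ i + 2 * (\<alpha> (fst z) * q $ 2 $ i)"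
proof -
  have p: "fst z \<in> fst ` W" using z by simp
  note hd = has_derivative_base[OF smooth_on_differentiable[OF _ p]]
  note hds = hd[OF coeffs(1)] hd[OF coeffs(2)] hd[OF coeffs(3)] hd[OF coeffs(4)] has_derivative_fibre
  note ax = axis3_mult[of i "\<lambda>i. partial i f (fst z)" for f]
  have "total_deriv1 i (\<lambda>z. fst (Y z) $ k) (z, q) = total_deriv1 i (\<lambda>z. X (fst z) $ k) (z, q)"
    by (rule total_deriv1_cong[OF W z]) (simp add: YX)
  then show "total_deriv1 i (\<lambda>z. fst (Y z) $ k) (z, q) = jac X i k (fst z)"
    by (simp add: total_deriv1_def dderivI[OF hd[OF XC]] ax)
  have "total_deriv1 i (\<lambda>z. snd (Y z) $ 1) (z, q)
      = total_deriv1 i (\<lambda>z. \<alpha> (fst z) * snd z $ 1 + \<beta> (fst z)) (z, q)"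
    by (rule total_deriv1_cong[OF W z]) (simp add: Yu)
  moreover have "((\<lambda>z. \<alpha> (fst z) * snd z $ 1 + \<beta> (fst z)) has_derivative
    (\<lambda>w. \<alpha> (fst z) * snd w $ 1 + (fst w $ 1 * partial 1 \<alpha> (fst z) + fst w $ 2 * partial 2 \<alpha> (fst z) + fst w $ 3 * partial 3 \<alpha> (fst z)) * snd z $ 1
      + (fst w $ 1 * partial 1 \<beta> (fst z) + fst w $ 2 * partial 2 \<beta> (fst z) + fst w $ 3 * partial 3 \<beta> (fst z)))) (at z)"
    by (intro has_derivative_add has_derivative_mult hds)
  ultimately show "total_deriv1 i (\<lambda>z. snd (Y z) $ 1) (z, q)
      = partial i \<alpha> (fst z) * snd z $ 1 + partial i \<beta> (fst z) + \<alpha> (fst z) * q $ 1 $ i"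
    by (simp add: total_deriv1_def dderivI ax)
  have "total_deriv1 i (\<lambda>z. snd (Y z) $ 2) (z, q)
      = total_deriv1 i (\<lambda>z. 2 * (\<alpha> (fst z) * snd z $ 2) + \<gamma> (fst z) * snd z $ 1 + \<delta> (fst z)) (z, q)"
    by (rule total_deriv1_cong[OF W z]) (simp add: Yv)
  moreover have "((\<lambda>z. 2 * (\<alpha> (fst z) * snd z $ 2) + \<gamma> (fst z) * snd z $ 1 + \<delta> (fst z)) has_derivative
    (\<lambda>w. 2 * (\<alpha> (fst z) * snd w $ 2 + (fst w $ 1 * partial 1 \<alpha> (fst z) + fst w $ 2 * partial 2 \<alpha> (fst z) + fst w $ 3 * partial 3 \<alpha> (fst z)) * snd z $ 2)
      + (\<gamma> (fst z) * snd w $ 1 + (fst w $ 1 * partial 1 \<gamma> (fst z) + fst w $ 2 * partial 2 \<gamma> (fst z) + fst w $ 3 * partial 3 \<gamma> (fst z)) * snd z $ 1)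
      + (fst w $ 1 * partial 1 \<delta> (fst z) + fst w $ 2 * partial 2 \<delta> (fst z) + fst w $ 3 * partial 3 \<delta> (fst z)))) (at z)"
    by (intro has_derivative_add has_derivative_mult has_derivative_mult_right hds)
  ultimately show "total_deriv1 i (\<lambda>z. snd (Y z) $ 2) (z, q)
      = 2 * (partial i \<alpha> (fst z) * snd z $ 2) + partial i \<gamma> (fst z) * snd z $ 1 + partial i \<delta> (fst z)
        + \<gamma> (fst z) * q $ 1 $ i + 2 * (\<alpha> (fst z) * q $ 2 $ i)"
    by (simp add: total_deriv1_def dderivI ax)
qed

lemma prolong1_affine:
  assumes z: "z \<in> W"
  shows "prolong_coeff1 Y 1 i (z, q)
      = partial i \<alpha> (fst z) * snd z $ 1 + partial i \<beta> (fst z) + \<alpha> (fst z) * q $ 1 $ i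
        - (jac X i 1 (fst z) * q $ 1 $ 1 + jac X i 2 (fst z) * q $ 1 $ 2
          + jac X i 3 (fst z) * q $ 1 $ 3)"
    "prolong_coeff1 Y 2 i (z, q)
      = 2 * (partial i \<alpha> (fst z) * snd z $ 2) + partial i \<gamma> (fst z) * snd z $ 1 + partial i \<delta> (fst z)
        + \<gamma> (fst z) * q $ 1 $ i + 2 * (\<alpha> (fst z) * q $ 2 $ i)
        - (jac X i 1 (fst z) * q $ 2 $ 1 + jac X i 2 (fst z) * q $ 2 $ 2
          + jac X i 3 (fst z) * q $ 2 $ 3)"
  unfolding prolong_coeff1_def by (simp_all add: total_deriv1_affine[OF z] sum_3)

lemma total_deriv2_cong:
  assumes "z \<in> W" "\<And>z q. z \<in> W \<Longrightarrow> f (z, q) = g (z, q)"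
  shows "total_deriv2 i f ((z, q), r) = total_deriv2 i g ((z, q), r)"
proof -
  have "open (W \<times> (UNIV :: (real ^ 3 ^ 2) set))" using W by (simp add: open_Times)
  from dderiv_cong[OF this, of "(z, q)" f g] show ?thesis
    using assms by (auto simp: total_deriv2_def)
qed

lemma prolong2_affine:
  assumes z: "z \<in> W"
  shows "prolong_coeff2 Y 1 i j ((z, q), r)
      = partial j (partial i \<alpha>) (fst z) * snd z $ 1 + partial j (partial i \<beta>) (fst z)
        + partial i \<alpha> (fst z) * q $ 1 $ j + partial j \<alpha> (fst z) * q $ 1 $ i + \<alpha> (fst z) * r $ 1 $ i $ j
        - (partial j (jac X i 1) (fst z) * q $ 1 $ 1 + partial j (jac X i 2) (fst z) * q $ 1 $ 2
          + partial j (jac X i 3) (fst z) * q $ 1 $ 3)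
        - (jac X i 1 (fst z) * r $ 1 $ 1 $ j + jac X i 2 (fst z) * r $ 1 $ 2 $ j
          + jac X i 3 (fst z) * r $ 1 $ 3 $ j)
        - (jac X j 1 (fst z) * r $ 1 $ i $ 1 + jac X j 2 (fst z) * r $ 1 $ i $ 2
          + jac X j 3 (fst z) * r $ 1 $ i $ 3)" (is ?A)
    "prolong_coeff2 Y 2 i j ((z, q), r)
      = 2 * (partial j (partial i \<alpha>) (fst z) * snd z $ 2) + partial j (partial i \<gamma>) (fst z) * snd z $ 1
        + partial j (partial i \<delta>) (fst z)
        + partial i \<gamma> (fst z) * q $ 1 $ j + partial j \<gamma> (fst z) * q $ 1 $ i + \<gamma> (fst z) * r $ 1 $ i $ j
        + 2 * (partial i \<alpha> (fst z) * q $ 2 $ j + partial j \<alpha> (fst z) * q $ 2 $ i + \<alpha> (fst z) * r $ 2 $ i $ j)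
        - (partial j (jac X i 1) (fst z) * q $ 2 $ 1 + partial j (jac X i 2) (fst z) * q $ 2 $ 2
          + partial j (jac X i 3) (fst z) * q $ 2 $ 3)
        - (jac X i 1 (fst z) * r $ 2 $ 1 $ j + jac X i 2 (fst z) * r $ 2 $ 2 $ j
          + jac X i 3 (fst z) * r $ 2 $ 3 $ j)
        - (jac X j 1 (fst z) * r $ 2 $ i $ 1 + jac X j 2 (fst z) * r $ 2 $ i $ 2
          + jac X j 3 (fst z) * r $ 2 $ i $ 3)" (is ?B)
proof -
  have p: "fst z \<in> fst ` W" using z by simp
  note hd = has_derivative_base_jet[OF smooth_on_differentiable[OF _ p], where q = q]
  note hds = hd[OF coeffs(1)] hd[OF coeffs(3)] hd[OF smooth_on_partial[OF coeffs(1)], of i]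
    hd[OF smooth_on_partial[OF coeffs(2)], of i] hd[OF smooth_on_partial[OF coeffs(3)], of i]
    hd[OF smooth_on_partial[OF coeffs(4)], of i] hd[OF smooth_on_partial[OF XC], of i]
    has_derivative_jet_coords
  have *: "dderiv f (z, q) w = D w" if "(f has_derivative D) (at (z, q))" for f :: "jet1 \<Rightarrow> real" and D w
    using dderivI[OF that] by simp
  let ?P = "\<lambda>k j. jac X i k (fst (fst j))"
  let ?f = "\<lambda>j :: jet1. partial i \<alpha> (fst (fst j)) * snd (fst j) $ 1 + partial i \<beta> (fst (fst j))
      + \<alpha> (fst (fst j)) * snd j $ 1 $ i
      - (?P 1 j * snd j $ 1 $ 1 + ?P 2 j * snd j $ 1 $ 2 + ?P 3 j * snd j $ 1 $ 3)"
  let ?g = "\<lambda>j :: jet1. 2 * (partial i \<alpha> (fst (fst j)) * snd (fst j) $ 2)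
      + partial i \<gamma> (fst (fst j)) * snd (fst j) $ 1 + partial i \<delta> (fst (fst j))
      + \<gamma> (fst (fst j)) * snd j $ 1 $ i + 2 * (\<alpha> (fst (fst j)) * snd j $ 2 $ i)
      - (?P 1 j * snd j $ 2 $ 1 + ?P 2 j * snd j $ 2 $ 2 + ?P 3 j * snd j $ 2 $ 3)"
  have 1: "total_deriv2 j (prolong_coeff1 Y 1 i) ((z, q), r) = total_deriv2 j ?f ((z, q), r)"
    by (rule total_deriv2_cong[OF z]) (simp add: prolong1_affine)
  have 2: "total_deriv2 j (prolong_coeff1 Y 2 i) ((z, q), r) = total_deriv2 j ?g ((z, q), r)"
    by (rule total_deriv2_cong[OF z]) (simp add: prolong1_affine)
  show ?A
    unfolding prolong_coeff2_def split_conv 1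
    unfolding total_deriv2_def split_conv
    by (subst *, (rule hds derivative_eq_intros refl)+)
      (use exhaust_3[of j] in \<open>auto simp: total_deriv1_affine[OF z] sum_3 algebra_simps\<close>)
  show ?B
    unfolding prolong_coeff2_def split_conv 2
    unfolding total_deriv2_def split_conv
    by (subst *, (rule hds derivative_eq_intros refl)+)
      (use exhaust_3[of j] in \<open>auto simp: total_deriv1_affine[OF z] sum_3 algebra_simps\<close>)
qed

lemma prolong2_in_J2:
  assumes "((z, q), r) \<in> J2" "z \<in> W"
  shows "prolong2 Y ((z, q), r) \<in> J2"
proof -
  have p: "fst z \<in> fst ` W" using assms by simp
  have r: "r $ a $ i $ k = r $ a $ k $ i" for a i k using assms(1) by (simp add: J2_def)
  note c = partial_commute[OF U _ p]
  have "prolong_coeff2 Y a i k ((z, q), r) = prolong_coeff2 Y a k i ((z, q), r)" for a i k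
  proof -
    have "prolong_coeff2 Y 1 i k ((z, q), r) = prolong_coeff2 Y 1 k i ((z, q), r)"
      "prolong_coeff2 Y 2 i k ((z, q), r) = prolong_coeff2 Y 2 k i ((z, q), r)"
      unfolding prolong2_affine[OF assms(2)] c[OF coeffs(1), of k i] c[OF coeffs(2), of k i] c[OF coeffs(3), of k i]
        c[OF coeffs(4), of k i] c[OF XC, of k i]
      by (simp_all add: r[of _ i k] r[of _ i 1] r[of _ i 2] r[of _ i 3] r[of _ k 1] r[of _ k 2] r[of _ k 3])
    then show ?thesis using exhaust_2[of a] by auto
  qed
  then show ?thesis by (simp add: prolong2_def J2_def)
qed

end

section \<open>Lifted fields are point symmetries\<close>

text \<open>The derivatives in directions \<open>x\<close> and \<open>y\<close> of the coefficients of a lift reduce to \<open>t\<close>-derivatives of \<open>\<alpha>\<close>,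
  \<open>\<gamma>\<close> and \<open>e = \<xi>\<^sub>x\<close>.\<close>

lemma lift_coefficient_derivatives:
  fixes X :: "base \<Rightarrow> base"
  defines "\<alpha> \<equiv> \<lambda>p. jac X 3 3 p - jac X 1 1 p"
    and "\<beta> \<equiv> \<lambda>p. jac X 1 3 p - 2 * jac X 3 2 p"
    and "\<gamma> \<equiv> jac X 3 2" and "\<delta> \<equiv> jac X 1 2"
    and "e \<equiv> jac X 2 2"
  assumes S: "shape_system U X" and U: "open U" and p: "p \<in> U"
  shows "smooth_on U \<alpha>" "smooth_on U \<beta>" "smooth_on U \<gamma>" "smooth_on U \<delta>" "smooth_on U e"
    "partial 1 e p = 2 * partial 1 (jac X 3 3) p - partial 1 (jac X 1 1) p"
    "partial 2 e p = 0" "partial 3 e p = 0"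
    "partial 1 \<alpha> p = partial 1 (jac X 3 3) p - partial 1 (jac X 1 1) p"
    "partial 2 \<alpha> p = 0" "partial 3 \<alpha> p = 0" "partial 2 \<beta> p = 0"
    "partial 3 \<beta> p = partial 1 (jac X 3 3) p - 2 * partial 1 e p"
    "partial 2 \<gamma> p = 0" "partial 3 \<gamma> p = partial 1 e p" "partial 2 \<delta> p = partial 1 e p"
    "partial 3 \<delta> p = partial 1 \<gamma> p"
proof -
  have sm: "smooth_on U (\<lambda>p. X p $ k)" for k
    using S U by (intro smooth_on_nth) (auto simp: shape_system_def)
  note sm1 = smooth_on_partial[OF sm]
  show "smooth_on U \<alpha>" "smooth_on U \<beta>" "smooth_on U \<gamma>" "smooth_on U \<delta>" "smooth_on U e"
    unfolding \<alpha>_def \<beta>_def \<gamma>_def \<delta>_def e_def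
    by (intro sm1 smooth_onI Ck_on_diff Ck_on_mult Ck_on_const smooth_onD[OF sm1] U)+
  note eqs = S[unfolded shape_system_def, THEN conjunct2, rule_format, OF p]
  note con = shape_system_consequences[OF S U p]
  note comm = partial_commute[OF U sm p]
  note [simp] = smooth_on_differentiable[OF sm1 p]
  have d: "partial i \<alpha> p = partial i (jac X 3 3) p - partial i (jac X 1 1) p"
    "partial i \<beta> p = partial i (jac X 1 3) p - 2 * partial i (jac X 3 2) p" for i
    unfolding \<alpha>_def \<beta>_def by (simp_all add: partial_diff partial_cmult)
  have e: "partial 1 e p = partial 3 (jac X 3 2) p" "partial 2 e p = 0" "partial 3 e p = 0"
    using eqs con(1,2) by (simp_all add: e_def)
  show "partial 2 e p = 0" "partial 3 e p = 0" by (rule e)+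
  show "partial 1 e p = 2 * partial 1 (jac X 3 3) p - partial 1 (jac X 1 1) p"
    unfolding e_def by (rule con(3))
  show "partial 1 \<alpha> p = partial 1 (jac X 3 3) p - partial 1 (jac X 1 1) p"
    by (rule d)
  show "partial 2 \<alpha> p = 0" "partial 3 \<alpha> p = 0" unfolding d by (simp_all add: con(4,5))
  show "partial 2 \<gamma> p = 0" "partial 3 \<gamma> p = partial 1 e p" "partial 2 \<delta> p = partial 1 e p"
    "partial 3 \<delta> p = partial 1 \<gamma> p"
    using comm[of 2 3 2] con(2) e(1) comm[of 2 1 2] comm[of 3 1 2] unfolding \<gamma>_def \<delta>_def e_def by simp_all
  have "partial 2 (jac X 1 3) p = 0"
    using comm[of 2 1 3] partial_eq_0[OF U p, of "jac X 2 3" 0 1] S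
    by (simp add: shape_system_def)
  then show "partial 2 \<beta> p = 0" unfolding d using comm[of 2 3 2] con(2) by simp
  show "partial 3 \<beta> p = partial 1 (jac X 3 3) p - 2 * partial 1 e p"
    unfolding d e(1) using comm[of 3 1 3] by simp
qed

text \<open>Along the prolongation, the derivative of \<open>F1\<close> is \<open>(\<alpha> - 2 \<eta>\<^sub>y) F1\<close> and that of \<open>F2\<close> is
  \<open>\<gamma> F1 + (2 \<alpha> - 2 \<eta>\<^sub>y) F2\<close>, where \<open>\<alpha> = \<eta>\<^sub>y - T\<^sub>t\<close> and \<open>\<gamma> = \<xi>\<^sub>y\<close>; both vanish on \<open>E2\<close>.\<close>

theorem lift_is_point_symmetry:
  assumes W: "open W" and Y: "smooth_on W Y" and S: "shape_system (fst ` W) X"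
    and YX: "\<And>z. z \<in> W \<Longrightarrow> fst (Y z) = X (fst z)"
    and Yuv: "\<And>z. z \<in> W \<Longrightarrow> snd (Y z) $ 1 = lift_u X z" "\<And>z. z \<in> W \<Longrightarrow> snd (Y z) $ 2 = lift_v X z"
  shows "Y \<in> point_symmetries W"
  unfolding point_symmetries_def
proof (intro CollectI conjI ballI impI)
  let ?U = "fst ` W"
  have U: "open ?U" using W by (rule open_fst_image)
  define \<alpha> where "\<alpha> = (\<lambda>p. jac X 3 3 p - jac X 1 1 p)"
  define \<beta> where "\<beta> = (\<lambda>p. jac X 1 3 p - 2 * jac X 3 2 p)"
  define \<gamma> where "\<gamma> = jac X 3 2"
  define \<delta> where "\<delta> = jac X 1 2"
  define e where "e = jac X 2 2"
  note L = lift_coefficient_derivatives[OF S U, folded \<alpha>_def \<beta>_def \<gamma>_def \<delta>_def e_def]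
  show "smooth_on W Y" by (rule Y)
  fix j assume j: "j \<in> E2" "fst (fst j) \<in> W"
  obtain z q r where jz: "j = ((z, q), r)" by (metis prod.collapse)
  have z: "z \<in> W" using j jz by simp
  then have p: "fst z \<in> ?U" by blast
  interpret affine_field W Y X \<alpha> \<beta> \<gamma> \<delta>
  proof
    show "smooth_on ?U X" using S by (simp add: shape_system_def)
    show "snd (Y z) $ 1 = \<alpha> (fst z) * snd z $ 1 + \<beta> (fst z)" if "z \<in> W" for z
      using Yuv(1)[OF that] by (simp add: lift_u_def \<alpha>_def \<beta>_def)
    show "snd (Y z) $ 2 = 2 * (\<alpha> (fst z) * snd z $ 2) + \<gamma> (fst z) * snd z $ 1 + \<delta> (fst z)" if "z \<in> W" for z
      using Yuv(2)[OF that] by (simp add: lift_v_def \<alpha>_def \<gamma>_def \<delta>_def)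
  qed (use W YX L(1-4)[OF p] in auto)
  have sme: "smooth_on ?U e" using L(5)[OF p] .
  note sm = smooth_on_differentiable[OF smooth_on_partial _]
  have zero: "partial i (partial k f) (fst z) = 0 \<and> partial k (partial i f) (fst z) = 0"
    if "smooth_on ?U f" "\<And>p. p \<in> ?U \<Longrightarrow> partial k f p = 0" for i k f
    using partial_eq_0[OF U p that(2), where i = i] partial_commute[OF U that(1) p, of i k] by simp
  have same: "partial i (partial k f) (fst z) = partial i (partial m g) (fst z)"
    if "\<And>p. p \<in> ?U \<Longrightarrow> partial k f p = partial m g p" for i k f m g
    by (rule partial_cong[OF U p that])
  have e2: "partial 2 (partial 1 e) (fst z) = 0" "partial 3 (partial 1 e) (fst z) = 0"
    using zero[OF sme L(7)] zero[OF sme L(8)] by blast+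
  have \<alpha>2: "partial i (partial 2 \<alpha>) (fst z) = 0" "partial i (partial 3 \<alpha>) (fst z) = 0"
    "partial 2 (partial i \<alpha>) (fst z) = 0" for i
    using zero[OF coeffs(1) L(10)] zero[OF coeffs(1) L(11)] by blast+
  have \<beta>2: "partial i (partial 2 \<beta>) (fst z) = 0" "partial 2 (partial i \<beta>) (fst z) = 0" for i
    using zero[OF coeffs(2) L(12)] by blast+
  have \<gamma>2: "partial i (partial 2 \<gamma>) (fst z) = 0" "partial 2 (partial i \<gamma>) (fst z) = 0" for i
    using zero[OF coeffs(3) L(14)] by blast+
  have \<beta>3: "partial 3 \<beta> p = (- 1) * partial 1 e p - partial 1 \<alpha> p" if "p \<in> ?U" for p
    using L(6)[OF that] L(9)[OF that] L(13)[OF that] by simp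
  have \<beta>33: "partial 3 (partial 3 \<beta>) (fst z) = 0"
  proof -
    have "partial 3 (partial 3 \<beta>) (fst z) = partial 3 (\<lambda>p. (- 1) * partial 1 e p - partial 1 \<alpha> p) (fst z)"
      by (rule partial_cong[OF U p \<beta>3])
    also have "\<dots> = (- 1) * partial 3 (partial 1 e) (fst z) - partial 3 (partial 1 \<alpha>) (fst z)"
      using sm[OF sme p] sm[OF coeffs(1) p] by (simp only: partial_diff partial_cmult differentiable_mult differentiable_const)
    finally show ?thesis using e2 zero[OF coeffs(1) L(11)] by simp
  qed
  have \<gamma>33: "partial 3 (partial 3 \<gamma>) (fst z) = 0" using same[of 3 \<gamma> 1 e 3] L(15) e2 by simp
  have \<delta>2: "partial 2 (partial 1 \<delta>) (fst z) = partial 1 (partial 1 e) (fst z)"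
    "partial 2 (partial 2 \<delta>) (fst z) = 0" "partial 3 (partial 2 \<delta>) (fst z) = 0"
    "partial 2 (partial 3 \<delta>) (fst z) = 0" "partial 3 (partial 3 \<delta>) (fst z) = partial 1 (partial 1 e) (fst z)"
    using same[of 2 \<delta> 1 e] L(16) e2 partial_commute[OF U coeffs(4) p, of 2 1] partial_commute[OF U coeffs(4) p, of 2 3]
      same[of 3 \<delta> 1 \<gamma> 3] L(17) partial_commute[OF U coeffs(3) p, of 3 1] same[of 3 \<gamma> 1 e 1] L(15)
    by simp_all
  have \<alpha>33: "partial 3 (partial i \<alpha>) (fst z) = 0" for i
    using zero[OF coeffs(1) L(11)] by blast
  note eqs = S[unfolded shape_system_def, THEN conjunct2, rule_format]
  have X1: "partial i (jac X 2 1) (fst z) = 0" "partial i (jac X 3 1) (fst z) = 0"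
    "partial 2 (jac X i 1) (fst z) = 0" for i
    using zero[OF XC[of 1], of 2 i] zero[OF XC[of 1], of 3 i] eqs by blast+
  have X3: "partial i (jac X 2 3) (fst z) = 0" "partial 3 (jac X 3 3) (fst z) = 0"
    "partial 2 (jac X i 3) (fst z) = 0" for i
    using zero[OF XC[of 3], of 2 i] eqs p by blast+
  have X2: "partial 2 (jac X 1 2) (fst z) = partial 1 e (fst z)"
    "partial 2 (jac X 3 2) (fst z) = 0" "partial 3 (jac X 3 2) (fst z) = partial 1 e (fst z)"
    "partial 2 (jac X 2 2) (fst z) = 0" "partial 3 (jac X 2 2) (fst z) = 0"
    using L(7,8,14,15,16)[OF p] by (simp_all add: \<gamma>_def \<delta>_def e_def)
  have X11: "jac X 2 1 (fst z) = 0" "jac X 3 1 (fst z) = 0" "jac X 2 3 (fst z) = 0"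
    "jac X 2 2 (fst z) = 2 * jac X 3 3 (fst z) - jac X 1 1 (fst z)"
    "\<alpha> (fst z) = jac X 3 3 (fst z) - jac X 1 1 (fst z)"
    "\<beta> (fst z) = jac X 1 3 (fst z) - 2 * jac X 3 2 (fst z)"
    "\<gamma> (fst z) = jac X 3 2 (fst z)" "\<delta> (fst z) = jac X 1 2 (fst z)"
    using eqs[OF p] by (simp_all add: \<alpha>_def \<beta>_def \<gamma>_def \<delta>_def)
  have r: "r $ a $ 2 $ 1 = r $ a $ 1 $ 2" "r $ a $ 3 $ 1 = r $ a $ 1 $ 3" "r $ a $ 3 $ 2 = r $ a $ 2 $ 3" for a
    using j(1) jz by (auto simp: E2_def J2_def)
  note all = prolong1_affine[OF z] prolong2_affine[OF z] \<alpha>2 \<alpha>33 \<beta>2 \<beta>33 \<gamma>2 \<gamma>33 \<delta>2 X1 X2 X3 X11 L(10-12)[OF p] \<beta>3[OF p] L(14-17)[OF p] r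
  have F: "F1 ((z, q), r) = 0" "F2 ((z, q), r) = 0" using j(1) jz by (simp_all add: E2_def)
  have "dF1 ((z, q), r) (prolong2 Y ((z, q), r))
      = (\<alpha> (fst z) - 2 * jac X 3 3 (fst z)) * F1 ((z, q), r)"
    unfolding dF1_def prolong2_def split_conv vec_lambda_beta Yu[OF z] Yv[OF z] F1_eq
    by (simp only: all) (simp add: algebra_simps)
  moreover have "dF2 ((z, q), r) (prolong2 Y ((z, q), r))
      = \<gamma> (fst z) * F1 ((z, q), r) + (2 * \<alpha> (fst z) - 2 * jac X 3 3 (fst z)) * F2 ((z, q), r)"
    unfolding dF2_def prolong2_def split_conv vec_lambda_beta Yu[OF z] Yv[OF z] F1_eq F2_eq
    by (simp only: all) (simp add: algebra_simps)
  moreover have "prolong2 Y ((z, q), r) \<in> J2"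
    using prolong2_in_J2[OF _ z] j(1) jz by (simp add: E2_def)
  ultimately show "tangent_to E2 j (prolong2 Y j)"
    using tangent_to_E2(2)[OF j(1)] F unfolding jz by simp
qed

section \<open>Point symmetries are lifted fields\<close>

definition base_partial :: "3 \<Rightarrow> (total \<Rightarrow> real) \<Rightarrow> total \<Rightarrow> real" where
  "base_partial i h z = dderiv h z (axis i 1, 0)"

definition fibre_partial :: "2 \<Rightarrow> (total \<Rightarrow> real) \<Rightarrow> total \<Rightarrow> real" where
  "fibre_partial b h z = dderiv h z (0, axis b 1)"

lemma total_deriv1_expand:
  assumes "h differentiable (at z)"
  shows "total_deriv1 i h (z, q) = base_partial i h z + (\<Sum>b\<in>UNIV. q $ b $ i * fibre_partial b h z)"
proof -
  have "(axis i 1, \<chi> a. q $ a $ i)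
      = (axis i 1 :: base, 0 :: real ^ 2) + (\<Sum>b\<in>UNIV. q $ b $ i *\<^sub>R (0, axis b 1))"
    by (simp add: sum_2 vec_eq_iff forall_2)
  then have "total_deriv1 i h (z, q)
      = dderiv h z ((axis i 1 :: base, 0 :: real ^ 2) + (\<Sum>b\<in>UNIV. q $ b $ i *\<^sub>R (0, axis b 1)))"
    by (simp only: total_deriv1_def split_conv)
  then show ?thesis
    unfolding dderiv_add[OF assms] dderiv_sum[OF assms] dderiv_scale[OF assms]
    by (simp add: base_partial_def fibre_partial_def)
qed

lemma affine_vanish:
  fixes W :: "total set"
  assumes "open W" "z \<in> W" and f: "\<And>w. (fst z, w) \<in> W \<Longrightarrow> a + b * w $ 1 = (0 :: real)"
  shows "a = 0" "b = 0"
proof -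
  obtain r where r: "r > 0" "ball z r \<subseteq> W" using assms openE by blast
  have "(fst z, snd z + (r / 2) *\<^sub>R axis 1 1) \<in> ball z r"
    using r by (simp add: dist_prod_def dist_norm norm_axis_1)
  then have 1: "a + b * (snd z + (r / 2) *\<^sub>R axis 1 1) $ 1 = 0" using f r by blast
  have 2: "a + b * snd z $ 1 = 0" using f[of "snd z"] assms(2) by simp
  have "b * (r / 2) = (a + b * (snd z + (r / 2) *\<^sub>R axis 1 1) $ 1) - (a + b * snd z $ 1)"
    by (simp add: algebra_simps)
  then have "b * (r / 2) = 0" unfolding 1 2 by simp
  then show "b = 0" using r by simp
  then show "a = 0" using 2 by simp
qed

locale point_symmetry =
  fixes W :: "total set" and Y :: "total \<Rightarrow> total"
  assumes W: "open W" and Y: "Y \<in> point_symmetries W"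
begin

lemma smY: "smooth_on W Y" using Y by (simp add: point_symmetries_def)

lemma smC: "smooth_on W (\<lambda>z. fst (Y z) $ k)" "smooth_on W (\<lambda>z. snd (Y z) $ a)"
  using smY W by (auto simp: smooth_on_def intro!: Ck_on_nth Ck_on_fst Ck_on_snd)

lemma invariance:
  assumes "((z, q), r) \<in> E2" "z \<in> W"
  shows "dF1 ((z, q), r) (prolong2 Y ((z, q), r)) = 0"
  using tangent_to_E2(1)[OF assms(1)] Y assms by (simp add: point_symmetries_def)

abbreviation "\<xi> k \<equiv> \<lambda>z. fst (Y z) $ k"
abbreviation "\<eta> a \<equiv> \<lambda>z. snd (Y z) $ a"

lemma total_deriv1_field: "z \<in> W \<Longrightarrow> total_deriv1 i (\<xi> k) (z, q) = base_partial i (\<xi> k) z + (\<Sum>b\<in>UNIV. q $ b $ i * fibre_partial b (\<xi> k) z)"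
  "z \<in> W \<Longrightarrow> total_deriv1 i (\<eta> a) (z, q) = base_partial i (\<eta> a) z + (\<Sum>b\<in>UNIV. q $ b $ i * fibre_partial b (\<eta> a) z)"
  using total_deriv1_expand[OF smooth_on_differentiable[OF smC(1)]]
    total_deriv1_expand[OF smooth_on_differentiable[OF smC(2)]] by blast+

lemma prolong_coeff1_eq:
  "z \<in> W \<Longrightarrow> prolong_coeff1 Y a i (z, q)
    = base_partial i (\<eta> a) z + (\<Sum>b\<in>UNIV. q $ b $ i * fibre_partial b (\<eta> a) z)
      - (\<Sum>k\<in>UNIV. (base_partial i (\<xi> k) z + (\<Sum>b\<in>UNIV. q $ b $ i * fibre_partial b (\<xi> k) z)) * q $ a $ k)"
  by (simp add: prolong_coeff1_def total_deriv1_field)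

lemma open_jets: "open (W \<times> (UNIV :: (real ^ 3 ^ 2) set))"
  using W by (simp add: open_Times)

lemma smooth_prolong_coeff1: "smooth_on (W \<times> UNIV) (prolong_coeff1 Y a i)"
proof (rule smooth_onI)
  fix k
  have b: "Ck_on k (W \<times> UNIV) (\<lambda>j :: jet1. g (fst j))" if "smooth_on W g" for g :: "total \<Rightarrow> real"
    by (rule Ck_on_compose[OF smooth_onD[OF that]])
      (use open_jets in \<open>auto intro!: Ck_on_fst Ck_on_id\<close>)
  have q: "Ck_on k (W \<times> UNIV) (\<lambda>j :: jet1. snd j $ a $ i)" for a i
    by (intro Ck_on_nth Ck_on_snd Ck_on_id open_jets)
  have "Ck_on k (W \<times> UNIV) (\<lambda>j. base_partial i (\<eta> a) (fst j)
      + (\<Sum>b\<in>UNIV. snd j $ b $ i * fibre_partial b (\<eta> a) (fst j))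
      - (\<Sum>k\<in>UNIV. (base_partial i (\<xi> k) (fst j) + (\<Sum>b\<in>UNIV. snd j $ b $ i * fibre_partial b (\<xi> k) (fst j)))
        * snd j $ a $ k))"
    unfolding base_partial_def fibre_partial_def
    by (intro Ck_on_add Ck_on_diff Ck_on_sum Ck_on_mult b q smooth_on_dderiv smC open_jets)
  then show "Ck_on k (W \<times> UNIV) (prolong_coeff1 Y a i)"
    by (rule Ck_on_cong[OF _ open_jets]) (auto simp: prolong_coeff1_eq)
qed

lemma prolong_coeff1_vertical:
  assumes z: "z \<in> W"
  shows "dderiv (prolong_coeff1 Y a i) (z, q) (0, m)
    = (\<Sum>b\<in>UNIV. m $ b $ i * fibre_partial b (\<eta> a) z)
      - (\<Sum>k\<in>UNIV. (\<Sum>b\<in>UNIV. m $ b $ i * fibre_partial b (\<xi> k) z) * q $ a $ k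
        + total_deriv1 i (\<xi> k) (z, q) * m $ a $ k)"
proof -
  have d: "(prolong_coeff1 Y a i has_derivative dderiv (prolong_coeff1 Y a i) (z, q)) (at (z, q))"
    using smooth_on_has_derivative[OF smooth_prolong_coeff1] z by simp
  have "((\<lambda>q. (z, q)) has_derivative (\<lambda>m. (0, m))) (at q)"
    by (auto intro!: derivative_eq_intros)
  from has_derivative_compose[OF this d]
  have 1: "((\<lambda>q. prolong_coeff1 Y a i (z, q)) has_derivative
      (\<lambda>m. dderiv (prolong_coeff1 Y a i) (z, q) (0, m))) (at q)" .
  have c: "((\<lambda>q :: real ^ 3 ^ 2. q $ a $ i) has_derivative (\<lambda>m. m $ a $ i)) (at q)" for a i
    by (intro bounded_linear.has_derivative[OF bounded_linear_vec_nth] has_derivative_ident)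
  have 2: "((\<lambda>q. prolong_coeff1 Y a i (z, q)) has_derivative
      (\<lambda>m. (\<Sum>b\<in>UNIV. m $ b $ i * fibre_partial b (\<eta> a) z)
      - (\<Sum>k\<in>UNIV. (\<Sum>b\<in>UNIV. m $ b $ i * fibre_partial b (\<xi> k) z) * q $ a $ k
        + total_deriv1 i (\<xi> k) (z, q) * m $ a $ k))) (at q)"
    unfolding prolong_coeff1_eq[OF z] total_deriv1_field[OF z]
    by (rule has_derivative_eq_rhs, (rule c derivative_eq_intros refl)+)
      (simp add: sum_2 sum_3 algebra_simps)
  from has_derivative_unique[OF 1 2] show ?thesis by metis
qed

text \<open>The prolongation is affine in the second-order jet coordinates, and its linear part involves only first
  derivatives of \<open>Y\<close>.\<close>

lemma prolong_coeff2_increment: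
  assumes z: "z \<in> W"
  shows "prolong_coeff2 Y a i j ((z, q), r + s)
    = prolong_coeff2 Y a i j ((z, q), r)
      + (\<Sum>b\<in>UNIV. s $ b $ i $ j * fibre_partial b (\<eta> a) z)
      - (\<Sum>k\<in>UNIV. (\<Sum>b\<in>UNIV. s $ b $ i $ j * fibre_partial b (\<xi> k) z) * q $ a $ k
        + total_deriv1 i (\<xi> k) (z, q) * s $ a $ k $ j + total_deriv1 j (\<xi> k) (z, q) * s $ a $ i $ k)"
proof -
  let ?H = "prolong_coeff1 Y a i"
  have d: "?H differentiable (at (z, q))"
    using smooth_on_differentiable[OF smooth_prolong_coeff1] z by simp
  have "((axis j 1, \<chi> a. q $ a $ j), \<chi> a k. (r + s) $ a $ k $ j)
      = ((axis j 1 :: base, \<chi> a. q $ a $ j), \<chi> a k. r $ a $ k $ j) + (0, \<chi> a k. s $ a $ k $ j)"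
    by (simp add: vec_eq_iff)
  then have "total_deriv2 j ?H ((z, q), r + s) = total_deriv2 j ?H ((z, q), r)
      + dderiv ?H (z, q) (0, \<chi> a k. s $ a $ k $ j)"
    unfolding total_deriv2_def split_conv using dderiv_add[OF d] by metis
  then show ?thesis
    unfolding prolong_coeff2_def split_conv
    by (simp add: prolong_coeff1_vertical[OF z] sum.distrib algebra_simps)
qed

text \<open>The invariance condition, differenced along a direction \<open>\<sigma>\<close> of the second derivatives of \<open>u\<close> that is annihilated by the
  symbol \<open>G\<close> and hence stays in \<open>E2\<close>. The conclusion says that \<open>Y G - G(D\<xi>, \<cdot>) - G(\<cdot>, D\<xi>)\<close> annihilates the same
  directions, so that it is a multiple of \<open>G\<close>.\<close>

lemma second_order_part:
  fixes \<sigma> :: "3 \<Rightarrow> 3 \<Rightarrow> real"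
  assumes z: "z \<in> W" and j: "((z, q), r) \<in> E2" and sym: "\<And>i k. \<sigma> i k = \<sigma> k i"
    and G: "\<sigma> 1 2 + snd z $ 1 * \<sigma> 3 2 + snd z $ 2 * \<sigma> 2 2 - \<sigma> 3 3 = 0"
  defines "D \<equiv> \<lambda>i k. total_deriv1 i (\<xi> k) (z, q)"
  shows "snd (Y z) $ 1 * \<sigma> 3 2 + snd (Y z) $ 2 * \<sigma> 2 2
    = (\<Sum>k\<in>UNIV. D 1 k * \<sigma> k 2 + D 2 k * \<sigma> 1 k + snd z $ 1 * (D 3 k * \<sigma> k 2 + D 2 k * \<sigma> 3 k)
      + 2 * (snd z $ 2 * (D 2 k * \<sigma> k 2)) - 2 * (D 3 k * \<sigma> k 3))"
proof -
  define s :: "real ^ 3 ^ 3 ^ 2" where "s = (\<chi> a i k. if a = 1 then \<sigma> i k else 0)"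
  have s1: "s $ 1 $ i $ k = \<sigma> i k" "s $ 2 $ i $ k = 0" for i k by (simp_all add: s_def)
  have "((z, q), r + s) \<in> E2"
    using j G sym by (auto simp: E2_def J2_def F1_eq F2_eq s_def algebra_simps)
  then have "dF1 ((z, q), r + s) (prolong2 Y ((z, q), r + s)) - dF1 ((z, q), r) (prolong2 Y ((z, q), r)) = 0"
    using invariance z j by simp
  then have *: "(fibre_partial 1 (\<eta> 1) z - (\<Sum>k\<in>UNIV. fibre_partial 1 (\<xi> k) z * q $ 1 $ k))
      * (\<sigma> 1 2 + snd z $ 1 * \<sigma> 3 2 + snd z $ 2 * \<sigma> 2 2 - \<sigma> 3 3)
    + (snd (Y z) $ 1 * \<sigma> 3 2 + snd (Y z) $ 2 * \<sigma> 2 2)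
    - (\<Sum>k\<in>UNIV. D 1 k * \<sigma> k 2 + D 2 k * \<sigma> 1 k + snd z $ 1 * (D 3 k * \<sigma> k 2 + D 2 k * \<sigma> 3 k)
      + snd z $ 2 * (D 2 k * \<sigma> k 2 + D 2 k * \<sigma> 2 k) - (D 3 k * \<sigma> k 3 + D 3 k * \<sigma> 3 k)) = 0"
    unfolding dF1_def prolong2_def split_conv vec_lambda_beta prolong_coeff2_increment[OF z]
    by (simp add: D_def s1 sum_2 sum_3 algebra_simps)
  show ?thesis
    using *[unfolded G] by (simp add: sum_3 sym[of 2 1] sym[of 3 1] sym[of 3 2] algebra_simps)
qed

lemma E2_zero: "((z, 0), 0) \<in> E2" by (simp add: E2_def J2_def F1_eq F2_eq)

text \<open>The terms that are linear in the first-order jet say that the symmetric product of the vector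
  \<open>G\<close>-dual to \<open>q\<^sub>b\<close> with the fibre derivative of \<open>\<xi>\<close> is a multiple of \<open>G\<close>. A symmetric product has rank at most two and \<open>G\<close>
  has rank three, so the fibre derivative vanishes. It suffices to switch on the derivative in direction \<open>x\<close> of one
  dependent variable; for \<open>v\<close>, the equation \<open>F2 = 0\<close> then forces a value of \<open>v\<^sub>t\<^sub>x\<close>.\<close>

lemma projectable:
  assumes z: "z \<in> W"
  shows "fibre_partial b (\<xi> k) z = 0"
proof -
  define q :: "real ^ 3 ^ 2" where "q = (\<chi> a i. if a = b \<and> i = 2 then 1 else 0)"
  define r :: "real ^ 3 ^ 3 ^ 2" where
    "r = (\<chi> a i k. if b = 2 \<and> a = 2 \<and> ((i = 1 \<and> k = 2) \<or> (i = 2 \<and> k = 1)) then - 1 else 0)"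
  have j: "((z, q), r) \<in> E2"
    using exhaust_2[of b] by (auto simp: E2_def J2_def F1_eq F2_eq q_def r_def)
  have D: "total_deriv1 1 (\<xi> k) (z, q) = base_partial 1 (\<xi> k) z"
    "total_deriv1 2 (\<xi> k) (z, q) = base_partial 2 (\<xi> k) z + fibre_partial b (\<xi> k) z"
    "total_deriv1 3 (\<xi> k) (z, q) = base_partial 3 (\<xi> k) z"
    "total_deriv1 i (\<xi> k) (z, 0) = base_partial i (\<xi> k) z" for i k
    using exhaust_2[of b] by (auto simp: total_deriv1_field[OF z] q_def sum_2)
  let ?f = "\<lambda>k. fibre_partial b (\<xi> k) z"
  have E: "(\<Sum>k\<in>UNIV. ?f k * (\<sigma> 1 k + snd z $ 1 * \<sigma> 3 k + 2 * (snd z $ 2 * \<sigma> k 2))) = 0"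
    if "\<And>i k. \<sigma> i k = \<sigma> k i" "\<sigma> 1 2 + snd z $ 1 * \<sigma> 3 2 + snd z $ 2 * \<sigma> 2 2 - \<sigma> 3 3 = 0" for \<sigma> :: "3 \<Rightarrow> 3 \<Rightarrow> real"
    using second_order_part[OF z j that] second_order_part[OF z E2_zero that]
    by (simp add: D sum_3 algebra_simps)
  have f1: "?f 1 = 0"
    using E[of "\<lambda>i k. if i = 1 \<and> k = 1 then 1 else 0"] by (simp add: sum_3)
  have f3: "?f 3 = 0"
    using E[of "\<lambda>i k. if (i = 1 \<and> k = 3) \<or> (i = 3 \<and> k = 1) then 1 else 0"] f1 by (simp add: sum_3)
  have "?f 2 = 0"
    using E[of "\<lambda>i k. if (i = 1 \<and> k = 2) \<or> (i = 2 \<and> k = 1) \<or> (i = 3 \<and> k = 3) then 1 else 0"] f1 f3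
    by (simp add: sum_3)
  then show ?thesis using f1 f3 exhaust_3[of k] by auto
qed

text \<open>By connectedness of the fibres the base part of \<open>Y\<close> descends; it is smooth since it can be computed along a
  local section \<open>w = const\<close>.\<close>

lemma base_field:
  assumes conn: "\<And>p. connected {w. (p, w) \<in> W}"
  obtains X where "smooth_on (fst ` W) X" "\<And>z. z \<in> W \<Longrightarrow> fst (Y z) = X (fst z)"
proof
  let ?X = "\<lambda>p. fst (Y (p, SOME w. (p, w) \<in> W))"
  have const: "fst (Y (p, w)) = fst (Y (p, w'))" if w: "(p, w) \<in> W" "(p, w') \<in> W" for p w w'
  proof -
    have o: "open {w. (p, w) \<in> W}"
    proof -
      have "{w. (p, w) \<in> W} = (\<lambda>w. (p, w)) -` W" by auto
      then show ?thesis using W by (simp add: open_vimage continuous_intros)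
    qed
    have "fst (Y (p, w)) $ k = fst (Y (p, w')) $ k" for k
    proof (rule has_derivative_zero_unique_connected[OF o conn, of "\<lambda>w. fst (Y (p, w)) $ k"])
      fix w assume "w \<in> {w. (p, w) \<in> W}"
      then have w: "(p, w) \<in> W" by simp
      have "((\<lambda>w. (p, w)) has_derivative (\<lambda>m. (0, m))) (at w)"
        by (auto intro!: derivative_eq_intros)
      from has_derivative_compose[OF this smooth_on_has_derivative[OF smC(1) w]]
      have "((\<lambda>w. fst (Y (p, w)) $ k) has_derivative (\<lambda>m. dderiv (\<xi> k) (p, w) (0, m))) (at w)" .
      moreover have "dderiv (\<xi> k) (p, w) (0, m) = 0" for m
      proof -
        note d = smooth_on_differentiable[OF smC(1)[of k] w]
        have "(0 :: base, m) = (\<Sum>b\<in>UNIV. m $ b *\<^sub>R (0, axis b 1))"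
          by (simp add: sum_2 vec_eq_iff forall_2)
        then have "dderiv (\<xi> k) (p, w) (0, m) = dderiv (\<xi> k) (p, w) (\<Sum>b\<in>UNIV. m $ b *\<^sub>R (0, axis b 1))"
          by (rule arg_cong)
        then show ?thesis
          unfolding dderiv_sum[OF d] dderiv_scale[OF d]
          using projectable[OF w] by (simp add: fibre_partial_def)
      qed
      ultimately show "((\<lambda>w. fst (Y (p, w)) $ k) has_derivative (\<lambda>m. 0)) (at w)" by simp
    qed (use w in auto)
    then show ?thesis by (simp add: vec_eq_iff)
  qed
  then have eq: "fst (Y (p, w)) = ?X p" if "(p, w) \<in> W" for p w
    using that someI[of "\<lambda>w. (p, w) \<in> W"] by blast
  then show "fst (Y z) = ?X (fst z)" if "z \<in> W" for z using that by (cases z) simp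
  show "smooth_on (fst ` W) ?X"
  proof (rule smooth_onI, rule Ck_on_local)
    fix k p assume "p \<in> fst ` W"
    then obtain w where w: "(p, w) \<in> W" by auto
    let ?T = "(\<lambda>p. (p, w)) -` W"
    have T: "open ?T" using W by (simp add: open_vimage continuous_intros)
    have "Ck_on k ?T (\<lambda>p. Y (p, w))"
      by (rule Ck_on_compose[OF smooth_onD[OF smY]]) (use T in \<open>auto intro!: Ck_on_Pair Ck_on_id Ck_on_const\<close>)
    then have "Ck_on k ?T ?X"
      by (rule Ck_on_cong[OF Ck_on_fst[OF _ T] T]) (simp add: eq)
    then show "\<exists>T. open T \<and> p \<in> T \<and> Ck_on k T ?X" using T w by auto
  qed
qed

lemma base_partial_field:
  assumes X: "smooth_on (fst ` W) X" and YX: "\<forall>z\<in>W. fst (Y z) = X (fst z)" and z: "z \<in> W"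
  shows "total_deriv1 i (\<xi> k) (z, q) = jac X i k (fst z)"
proof -
  have U: "open (fst ` W)" using W by (rule open_fst_image)
  have "total_deriv1 i (\<xi> k) (z, q) = total_deriv1 i (\<lambda>z. X (fst z) $ k) (z, q)"
    by (rule total_deriv1_cong[OF W z]) (simp add: YX)
  moreover have "(\<lambda>p. X p $ k) differentiable (at (fst z))"
    using smooth_on_differentiable[OF smooth_on_nth[OF X U]] z by simp
  ultimately show ?thesis
    using axis3_mult[of i "\<lambda>i. jac X i k (fst z)"]
    by (simp add: total_deriv1_def dderivI[OF has_derivative_base[of "\<lambda>p. X p $ k" z]])
qed

text \<open>For a projectable field and \<open>q = 0\<close> the second-order terms say that \<open>Y\<close> preserves \<open>G\<close>, and therefore the metric, up to a
  factor. The directions \<open>\<sigma>\<close> below are a basis of those annihilated by \<open>G\<close>, each isolating one component. The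
  first-order equations hold for all \<open>u\<close> in an open set, which splits off \<open>T\<^sub>y\<close>.\<close>

lemma first_order:
  assumes X: "smooth_on (fst ` W) X" and YX: "\<forall>z\<in>W. fst (Y z) = X (fst z)" and z: "z \<in> W"
  shows "jac X 2 1 (fst z) = 0" "jac X 3 1 (fst z) = 0"
    "jac X 2 3 (fst z) = 0"
    "jac X 2 2 (fst z) = 2 * jac X 3 3 (fst z) - jac X 1 1 (fst z)"
    "snd (Y z) $ 1 = lift_u X z" "snd (Y z) $ 2 = lift_v X z"
proof -
  let ?P = "\<lambda>i k. jac X i k (fst z)"
  have E: "snd (Y (fst z, w)) $ 1 * \<sigma> 3 2 + snd (Y (fst z, w)) $ 2 * \<sigma> 2 2
    = (\<Sum>k\<in>UNIV. ?P 1 k * \<sigma> k 2 + ?P 2 k * \<sigma> 1 k + w $ 1 * (?P 3 k * \<sigma> k 2 + ?P 2 k * \<sigma> 3 k)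
      + 2 * (w $ 2 * (?P 2 k * \<sigma> k 2)) - 2 * (?P 3 k * \<sigma> k 3))"
    if "(fst z, w) \<in> W" "\<And>i k. \<sigma> i k = \<sigma> k i" "\<sigma> 1 2 + w $ 1 * \<sigma> 3 2 + w $ 2 * \<sigma> 2 2 - \<sigma> 3 3 = 0"
    for \<sigma> :: "3 \<Rightarrow> 3 \<Rightarrow> real" and w
    using second_order_part[OF that(1) E2_zero that(2)] that(3)
    by (simp add: base_partial_field[OF X YX that(1)])
  have z': "(fst z, snd z) \<in> W" using z by simp
  have P21: "?P 2 1 = 0"
    using E[OF z', of "\<lambda>i k. if i = 1 \<and> k = 1 then 1 else 0"] by (simp add: sum_3)
  have P23: "?P 2 3 = 2 * ?P 3 1"
    using E[OF z', of "\<lambda>i k. if (i = 1 \<and> k = 3) \<or> (i = 3 \<and> k = 1) then 1 else 0"] P21 by (simp add: sum_3)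
  have "(?P 1 1 + ?P 2 2 - 2 * ?P 3 3) + (3 * ?P 3 1) * w $ 1 = 0" if "(fst z, w) \<in> W" for w
    using E[OF that, of "\<lambda>i k. if (i = 1 \<and> k = 2) \<or> (i = 2 \<and> k = 1) \<or> (i = 3 \<and> k = 3) then 1 else 0"] P21 P23
    by (simp add: sum_3 algebra_simps)
  from affine_vanish[OF W z this]
  have P31: "?P 3 1 = 0" and P22: "?P 2 2 = 2 * ?P 3 3 - ?P 1 1" by simp_all
  show "?P 2 1 = 0" "?P 3 1 = 0" "?P 2 3 = 0" "?P 2 2 = 2 * ?P 3 3 - ?P 1 1"
    using P21 P31 P23 P22 by simp_all
  show "snd (Y z) $ 1 = lift_u X z"
    using E[OF z', of "\<lambda>i k. if (i = 3 \<and> k = 2) \<or> (i = 2 \<and> k = 3) then 1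
      else if (i = 1 \<and> k = 2) \<or> (i = 2 \<and> k = 1) then - (snd z $ 1) else 0"] P21 P31 P23 P22
    by (simp add: sum_3 lift_u_def algebra_simps)
  show "snd (Y z) $ 2 = lift_v X z"
    using E[OF z', of "\<lambda>i k. if i = 2 \<and> k = 2 then 1
      else if (i = 1 \<and> k = 2) \<or> (i = 2 \<and> k = 1) then - (snd z $ 2) else 0"] P21 P31 P23 P22
    by (simp add: sum_3 lift_v_def algebra_simps)
qed

text \<open>Once \<open>Y\<close> is known to have the form of a lift, evaluating the condition at jets whose only nonzero derivative is \<open>u\<^sub>x\<close> leaves
  an affine function of \<open>u\<close> whose two coefficients are the missing second-order equations.\<close>

lemma shape_system_base:
  assumes X: "smooth_on (fst ` W) X" and YX: "\<forall>z\<in>W. fst (Y z) = X (fst z)"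
  shows "shape_system (fst ` W) X"
  unfolding shape_system_def
proof (intro conjI ballI)
  show "smooth_on (fst ` W) X" by (rule X)
  fix p assume "p \<in> fst ` W"
  then obtain z where z: "z \<in> W" and pz: "p = fst z" by auto
  note fo = first_order[OF X YX]
  show "jac X 2 1 p = 0" "jac X 3 1 p = 0" "jac X 2 3 p = 0"
    "jac X 2 2 p = 2 * jac X 3 3 p - jac X 1 1 p"
    unfolding pz by (rule fo[OF z])+
  have U: "open (fst ` W)" using W by (rule open_fst_image)
  have p: "fst z \<in> fst ` W" using z by simp
  have sm: "smooth_on (fst ` W) (\<lambda>p. X p $ k)" for k by (rule smooth_on_nth[OF X U])
  note sm1 = smooth_on_partial[OF sm]
  define \<alpha> where "\<alpha> = (\<lambda>p. jac X 3 3 p - jac X 1 1 p)"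
  define \<beta> where "\<beta> = (\<lambda>p. jac X 1 3 p - 2 * jac X 3 2 p)"
  define \<gamma> where "\<gamma> = jac X 3 2"
  define \<delta> where "\<delta> = jac X 1 2"
  interpret affine_field W Y X \<alpha> \<beta> \<gamma> \<delta>
  proof
    show "smooth_on (fst ` W) \<alpha>" "smooth_on (fst ` W) \<beta>" "smooth_on (fst ` W) \<gamma>" "smooth_on (fst ` W) \<delta>"
      unfolding \<alpha>_def \<beta>_def \<gamma>_def \<delta>_def
      by (intro sm1 smooth_onI Ck_on_diff Ck_on_mult Ck_on_const smooth_onD[OF sm1] U)+
    show "snd (Y z) $ 1 = \<alpha> (fst z) * snd z $ 1 + \<beta> (fst z)" if "z \<in> W" for z
      using fo(5)[OF that] by (simp add: lift_u_def \<alpha>_def \<beta>_def)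
    show "snd (Y z) $ 2 = 2 * (\<alpha> (fst z) * snd z $ 2) + \<gamma> (fst z) * snd z $ 1 + \<delta> (fst z)" if "z \<in> W" for z
      using fo(6)[OF that] by (simp add: lift_v_def \<alpha>_def \<gamma>_def \<delta>_def)
  qed (use W X YX in auto)
  let ?X = "\<lambda>k p. X p $ k"
  note [simp] = smooth_on_differentiable[OF sm1 p]
  note comm = partial_commute[OF U sm p]
  have zero: "partial i (partial k (?X m)) (fst z) = 0" "partial k (partial i (?X m)) (fst z) = 0"
    if that_zero: "\<And>z. z \<in> W \<Longrightarrow> partial k (?X m) (fst z) = 0" for i k m
  proof -
    have "partial k (?X m) q = 0" if "q \<in> fst ` W" for q using that that_zero by blast
    from partial_eq_0[OF U p this, where i = i]
    show "partial i (partial k (?X m)) (fst z) = 0" "partial k (partial i (?X m)) (fst z) = 0"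
      using comm[of i k m] by simp_all
  qed
  have X2: "partial i (partial 2 (?X 2)) (fst z) = 2 * partial i (partial 3 (?X 3)) (fst z) - partial i (partial 1 (?X 1)) (fst z)" for i
  proof -
    have "partial i (partial 2 (?X 2)) (fst z) = partial i (\<lambda>p. 2 * partial 3 (?X 3) p - partial 1 (?X 1) p) (fst z)"
      by (rule partial_cong[OF U p]) (use fo(4) in auto)
    then show ?thesis by (simp add: partial_diff partial_cmult)
  qed
  have d: "partial i \<alpha> (fst z) = partial i (partial 3 (?X 3)) (fst z) - partial i (partial 1 (?X 1)) (fst z)"
    "partial i \<beta> (fst z) = partial i (partial 1 (?X 3)) (fst z) - 2 * partial i (partial 3 (?X 2)) (fst z)" for i
    unfolding \<alpha>_def \<beta>_def by (simp_all add: partial_diff partial_cmult)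
  note second = zero[OF fo(1)] zero[OF fo(2)] zero[OF fo(3)] X2 d
  \<comment> \<open>The part of the condition that is linear in \<open>u\<^sub>x\<close>, isolated by comparing \<open>u\<^sub>x = 1\<close> and \<open>u\<^sub>x = - 1\<close>.\<close>
  have "(2 * partial 1 (partial 3 (?X 3)) (fst z) - partial 1 (partial 1 (?X 1)) (fst z) - partial 3 (partial 3 (?X 2)) (fst z))
      + (2 * partial 3 (partial 3 (?X 3)) (fst z)) * w $ 1 = 0" if w: "(fst z, w) \<in> W" for w
  proof -
    let ?q = "\<lambda>c. \<chi> a i. if a = 1 \<and> i = 2 then c else (0 :: real)"
    have j: "(((fst z, w), ?q c), 0) \<in> E2" for c by (simp add: E2_def J2_def F1_eq F2_eq)
    have "dF1 (((fst z, w), ?q 1), 0) (prolong2 Y (((fst z, w), ?q 1), 0))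
        - dF1 (((fst z, w), ?q (- 1)), 0) (prolong2 Y (((fst z, w), ?q (- 1)), 0)) = 0"
      using invariance[OF j w] by simp
    then show ?thesis
      unfolding dF1_def prolong2_def split_conv vec_lambda_beta prolong1_affine[OF w] prolong2_affine[OF w]
      using comm[of 3 1 3] comm[of 2 1 2] comm[of 2 3 2] comm[of 2 3 3]
      by (simp add: second \<gamma>_def \<delta>_def algebra_simps)
  qed
  from affine_vanish[OF W z this]
  show "partial 3 (partial 3 (?X 3)) p = 0" "partial 3 (partial 3 (?X 2)) p = partial 1 (partial 2 (?X 2)) p"
    unfolding pz by (simp_all add: X2)
qed

end

section \<open>Comparison of the two Lie algebras\<close>

theorem corollary1:
  fixes W :: "total set"
  assumes "open W"
    and "\<And>p. connected {w. (p, w) \<in> W}"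
  shows "lifted_shape_fields W = point_symmetries W"
proof (intro equalityI subsetI)
  have U: "open (fst ` W)" using assms(1) by (rule open_fst_image)
  fix Y
  {
    assume "Y \<in> lifted_shape_fields W"
    then obtain X where "X \<in> shape_fields (fst ` W)" and L: "is_lift W X Y"
      unfolding lifted_shape_fields_def by blast
    then have S: "shape_system (fst ` W) X" using shape_fields_imp_shape_system U by blast
    have Y: "smooth_on W Y" "\<And>z. z \<in> W \<Longrightarrow> fst (Y z) = X (fst z)"
      using L by (auto simp: is_lift_def)
    have "\<forall>z\<in>W. snd (Y z) $ 1 = lift_u X z \<and> snd (Y z) $ 2 = lift_v X z"
      using lift_coefficients[OF assms(1) Y(1) S Y(2)] L by (simp add: is_lift_def)
    then show "Y \<in> point_symmetries W"
      using lift_is_point_symmetry[OF assms(1) Y(1) S Y(2)] by blast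
  next
    assume "Y \<in> point_symmetries W"
    then interpret point_symmetry W Y using assms(1) by unfold_locales
    obtain X where X: "smooth_on (fst ` W) X" and YX: "\<And>z. z \<in> W \<Longrightarrow> fst (Y z) = X (fst z)"
      using base_field[OF assms(2)] by blast
    have YX': "\<forall>z\<in>W. fst (Y z) = X (fst z)" using YX by blast
    have S: "shape_system (fst ` W) X" by (rule shape_system_base[OF X YX'])
    have "\<forall>z\<in>W. snd (Y z) $ 1 = lift_u X z \<and> snd (Y z) $ 2 = lift_v X z"
      using first_order(5,6)[OF X YX'] by blast
    then have "is_lift W X Y"
      using lift_coefficients[OF assms(1) smY S YX] smY YX by (simp add: is_lift_def)
    then show "Y \<in> lifted_shape_fields W"
      using shape_system_imp_shape_fields[OF S U] unfolding lifted_shape_fields_def by blast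
  }
qed

end
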